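(* The non-oriented Thompson group $T^{no}$ acts faithfully on the infinite associahedron $C$ by (combinatorial) automorphisms, the action being given by $t\cdot f_A=f_{t\cdot A}$ for $t\in T^{no}$ and $A\in\mathcal{I}$. Furthermore, the automorphism group $\mathrm{Aut}(C)$ of $C$ is isomorphic to $T^{no}$.
   Context: **Dyadic arcs.** Let $D$ be the open disk in $\mathbb{R}^2$ with center $(0,0)$ and perimeter $1$, and let $\gamma:[0,1]\to\partial D$ be the arc-length parametrization of its boundary circle with $\gamma(0)=\gamma(1)=(\tfrac{1}{2\pi},0)$. A *dyadic arc* is a geodesic segment (chord) of $D$ joining two distinct points of $\gamma(\mathbb{Z}[1/2]\cap[0,1])$; $(x,y)$ denotes the (unoriented) dyadic arc with endpoints $\gamma(x),\gamma(y)$. Let $$A_F=\{(0,\tfrac12)\}\cup\{(\tfrac{m}{2^n},\tfrac{m+1}{2^n}) : m,n\in\mathbb{Z},\ n>1,\ 0\le m\le 2^n-1\}.$$ **$F$-triangulations and $F$-tessellations.** An *$F$-triangulation* is a set $A$ of dyadic arcs, no two of which cross inside $D$ (common endpoints are allowed), such that (1) $D$ minus the union of the arcs in $A$ is a disjoint union of open triangles; (2) for every $a\in A$, the set $A\setminus\{a\}$ no longer has this property; (3) the symmetric difference of $A$ and $A_F$ is finite. An *$F$-tessellation* is a set $B=A\setminus\{a_1,\dots,a_k\}$ with $A$ an $F$-triangulation and $a_1,\dots,a_k$ ($k\ge 0$) distinct arcs of $A$; the number $k$ depends only on $B$ and is called the *rank* of $B$. Let $\mathcal{I}$ be the set of all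 $F$-tessellations, partially ordered by $A<B$ iff $B\subsetneq A$. The complement $D\setminus B$ of an $F$-tessellation is a disjoint union of infinitely many open triangles and finitely many non-triangular open polygons. **Associahedra.** For a convex polygon $P$ with $n\ge 3$ vertices, a tessellation of $P$ is a (possibly empty) set $\alpha$ of pairwise non-crossing interior diagonals, with $\alpha<\beta$ iff $\beta\subsetneq\alpha$. Stasheff's associahedron $\mathcal{A}(P)$ is a closed $(n-3)$-ball with a cell structure having one closed cell $f_\alpha$, of dimension $n-3-|\alpha|$, for each tessellation $\alpha$, with $f_\emptyset=\mathcal{A}(P)$, $f_\alpha\subset f_\beta$ for $\alpha<\beta$, and $f_\alpha\cong\prod_Q\mathcal{A}(Q)$ over the polygons $Q$ obtained by cutting $P$ along $\alpha$. **The infinite associahedron $C$.** To $A\in\mathcal{I}$ of rank $k$ associate the closed $k$-cell $f_A=\prod_Q\mathcal{A}(Q)$ over the non-triangular polygons $Q$ of $D\setminus A$ (a point if $k=0$). If $A<B$, then $A$ restricts to a tessellation $\alpha_Q$ of each non-triangular polygon $Q$ of $D\setminus B$, and the inclusions $f_{\alpha_Q}\subset\mathcal{A}(Q)$ give an injection $\iota_{BA}:f_A\cong\prod_Q f_{\alpha_Q}\to f_B$. Then $C=(\bigsqcup_{A\in\mathcal{I}}f_A)/\sim$, where $\sim$ is generated by $x\sim\iota_{BA}(x)$ for $A<B$, $x\in f_A$. Thus $C$ is a regular CW complex with one closed cell $f_A$, of dimension $\mathrm{rank}(A)$, for each $A\in\mathcal{I}$; $f_A\subseteq f_B$ iff $B\subseteq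 A$; and $\partial f_B$ is the union of the cells $f_A$ with $A<B$. **Automorphisms.** A (combinatorial) automorphism of $C$ is a bijection from the set of closed cells $\{f_A : A\in\mathcal{I}\}$ to itself preserving dimensions, inclusions and boundaries (the cells in the boundary of the image of $f_B$ are exactly the images of the cells in $\partial f_B$). $\mathrm{Aut}(C)$ is the group of these under composition. **The group $T^{no}$.** $T^{no}$ is the group of piecewise linear homeomorphisms (orientation preserving or reversing) of the circle $S^1$, viewed as $[0,1]$ with endpoints identified, which (1) map the set of dyadic rationals to itself; (2) are differentiable except at finitely many points, all dyadic rational; (3) on intervals of differentiability have derivative equal, up to sign, to an integral power of $2$. It is a semi-direct product $T\rtimes\mathbb{Z}/2\mathbb{Z}$, where $T$ is Thompson's group $T$, the subgroup of orientation-preserving elements. **Action on $\mathcal{I}$.** For $t\in T^{no}$ and $A\in\mathcal{I}$, $t\cdot A=\{(t(d_1),t(d_2)) : (d_1,d_2)\in A\}$, which is again an element of $\mathcal{I}$. *)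

theory Defs
  imports "HOL-Analysis.Analysis" "HOL-Algebra.Group_Action"
begin

section \<open>Dyadic arcs\<close>

type_synonym point = "real \<times> real"
type_synonym chord = "point set"

definition disk :: "point set" where
  "disk = ball (0, 0) (1 / (2 * pi))"

definition circle :: "point set" where
  "circle = sphere (0, 0) (1 / (2 * pi))"

text \<open>The arc-length parametrization, extended periodically (with period 1) to all reals. It
  identifies \<^term>\<open>circle\<close> with the unit interval with its endpoints glued.\<close>

definition gam :: "real \<Rightarrow> point" where
  "gam t = (cos (2 * pi * t) / (2 * pi), sin (2 * pi * t) / (2 * pi))"

definition dyadics :: "real set" where
  "dyadics = {of_int m / 2 ^ n | (m :: int) (n :: nat). True}"

definition dyadic_points :: "point set" where
  "dyadic_points = gam ` (dyadics \<inter> {0..1})"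

definition dyadic_arcs :: "chord set" where
  "dyadic_arcs = {closed_segment p q | p q. p \<in> dyadic_points \<and> q \<in> dyadic_points \<and> p \<noteq> q}"

definition arc_of :: "real \<Rightarrow> real \<Rightarrow> chord" where
  "arc_of x y = closed_segment (gam x) (gam y)"

definition A_F :: "chord set" where
  "A_F = insert (arc_of 0 (1 / 2))
     {arc_of (real m / 2 ^ n) ((real m + 1) / 2 ^ n) | (m :: nat) (n :: nat). n > 1 \<and> m \<le> 2 ^ n - 1}"


section \<open>F-triangulations and F-tessellations\<close>

definition noncrossing :: "point set \<Rightarrow> chord set \<Rightarrow> bool" where
  "noncrossing U A \<longleftrightarrow> pairwise (\<lambda>a b. a \<inter> b \<inter> U = {}) A"

definition open_triangle :: "point set \<Rightarrow> bool" where
  "open_triangle T \<longleftrightarrow> (\<exists>a b c. \<not> collinear {a, b, c} \<and> T = interior (convex hull {a, b, c}))"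

definition triangulates :: "chord set \<Rightarrow> bool" where
  "triangulates A \<longleftrightarrow> (\<exists>\<T>. (\<forall>T\<in>\<T>. open_triangle T) \<and> disjoint \<T> \<and> \<Union>\<T> = disk - \<Union>A)"

definition F_triangulation :: "chord set \<Rightarrow> bool" where
  "F_triangulation A \<longleftrightarrow>
     A \<subseteq> dyadic_arcs \<and> noncrossing disk A \<and>
     triangulates A \<and>
     (\<forall>a\<in>A. \<not> triangulates (A - {a})) \<and>
     finite (sym_diff A A_F)"

definition F_tessellations :: "chord set set" where
  "F_tessellations = {A - K | A K. F_triangulation A \<and> finite K \<and> K \<subseteq> A}"

definition tess_rank :: "chord set \<Rightarrow> nat" where
  "tess_rank B = (THE k. \<exists>A K. F_triangulation A \<and> finite K \<and> K \<subseteq> A \<and> B = A - K \<and> card K = k)"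


section \<open>Polygons and associahedra\<close>

text \<open>A convex polygon is represented by its interior, a bounded open convex set of points.\<close>

definition pieces :: "point set \<Rightarrow> chord set \<Rightarrow> point set set" where
  "pieces U A = components (U - \<Union>A)"

definition nontriangular_pieces :: "point set \<Rightarrow> chord set \<Rightarrow> point set set" where
  "nontriangular_pieces U A = {Q \<in> pieces U A. \<not> open_triangle Q}"

definition vertices :: "point set \<Rightarrow> point set" where
  "vertices P = {v. v extreme_point_of (closure P)}"

definition diagonals :: "point set \<Rightarrow> chord set" where
  "diagonals P =
     {closed_segment x y | x y.
        x \<in> vertices P \<and> y \<in> vertices P \<and> x \<noteq> y \<and> open_segment x y \<subseteq> P}"

definition tessellation :: "point set \<Rightarrow> chord set \<Rightarrow> bool" where
  "tessellation P \<alpha> \<longleftrightarrow> \<alpha> \<subseteq> diagonals P \<and> noncrossing P \<alpha>"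

text \<open>Stasheff's associahedron in the realization of Boardman and Vogt, as a space of planar trees
  whose inner edges have a length between 0 and 1, edges of length 0 being contracted. Tessellations
  of a polygon are dual to planar trees, the diagonals being dual to the inner edges; a point is thus
  a weight on the diagonals whose support is a tessellation. The closed cell of a tessellation
  \<open>\<alpha>\<close> consists of the weights equal to 1 on \<open>\<alpha>\<close>; the cell of the empty tessellation is the
  whole associahedron.\<close>

type_synonym weight = "chord \<Rightarrow> real"

definition associahedron :: "point set \<Rightarrow> weight set" where
  "associahedron P =
     {w \<in> diagonals P \<rightarrow>\<^sub>E {0..1}. tessellation P {d \<in> diagonals P. w d \<noteq> 0}}"

definition associahedron_cell :: "point set \<Rightarrow> chord set \<Rightarrow> weight set" where
  "associahedron_cell P \<alpha> = {w \<in> associahedron P. \<forall>d\<in>\<alpha>. w d = 1}"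

text \<open>The product of the associahedra of the polygons obtained by cutting \<open>P\<close> along \<open>\<alpha>\<close> (those of
  triangles are points and are omitted), and its identification with the cell of \<open>\<alpha>\<close>. The sum has
  at most one term, since a diagonal of \<open>P\<close> is a diagonal of at most one of these polygons; it is 0
  for the diagonals that cross \<open>\<alpha>\<close>.\<close>

definition associahedra_product :: "point set \<Rightarrow> chord set \<Rightarrow> (point set \<Rightarrow> weight) set" where
  "associahedra_product P \<alpha> = (\<Pi>\<^sub>E Q\<in>nontriangular_pieces P \<alpha>. associahedron Q)"

definition cell_iso :: "point set \<Rightarrow> chord set \<Rightarrow> (point set \<Rightarrow> weight) \<Rightarrow> weight" where
  "cell_iso P \<alpha> x =
     (\<lambda>d\<in>diagonals P.
        if d \<in> \<alpha> then 1
        else \<Sum>Q | Q \<in> nontriangular_pieces P \<alpha> \<and> d \<in> diagonals Q. x Q d)"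

lemma associahedron_cell_empty: "associahedron_cell P {} = associahedron P"
  by (simp add: associahedron_cell_def)

lemma associahedron_cell_mono:
  "\<beta> \<subseteq> \<alpha> \<Longrightarrow> associahedron_cell P \<alpha> \<subseteq> associahedron_cell P \<beta>"
  by (auto simp: associahedron_cell_def)


section \<open>The infinite associahedron\<close>

definition cell :: "chord set \<Rightarrow> (point set \<Rightarrow> weight) set" where
  "cell A = associahedra_product disk A"

text \<open>The injection of \<^term>\<open>cell A\<close> into \<^term>\<open>cell B\<close>, for \<open>B \<subset> A\<close>. The arcs of \<open>A\<close> that are
  diagonals of a polygon \<open>R\<close> of \<open>B\<close> form the restriction of \<open>A\<close> to a tessellation of \<open>R\<close>, and the
  polygons that this cuts \<open>R\<close> into are the polygons of \<open>A\<close> contained in \<open>R\<close>.\<close>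

definition cell_inclusion ::
    "chord set \<Rightarrow> chord set \<Rightarrow> (point set \<Rightarrow> weight) \<Rightarrow> (point set \<Rightarrow> weight)" where
  "cell_inclusion B A x =
     (\<lambda>R\<in>nontriangular_pieces disk B.
        let \<alpha> = A \<inter> diagonals R in cell_iso R \<alpha> (restrict x (nontriangular_pieces R \<alpha>)))"

definition cell_points :: "(chord set \<times> (point set \<Rightarrow> weight)) set" where
  "cell_points = Sigma F_tessellations cell"

inductive glued ::
    "chord set \<times> (point set \<Rightarrow> weight) \<Rightarrow> chord set \<times> (point set \<Rightarrow> weight) \<Rightarrow> bool" where
  "\<lbrakk>A \<in> F_tessellations; B \<in> F_tessellations; B \<subset> A; x \<in> cell A\<rbrakk>
     \<Longrightarrow> glued (A, x) (B, cell_inclusion B A x)"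

type_synonym cpoint = "(chord set \<times> (point set \<Rightarrow> weight)) set"

definition infinite_associahedron :: "cpoint set" where
  "infinite_associahedron = cell_points // {(p, q). equivclp glued p q}"

text \<open>The image of the cell \<^term>\<open>cell A\<close> in the quotient.\<close>

definition closed_cell :: "chord set \<Rightarrow> cpoint set" where
  "closed_cell A = ({A} \<times> cell A) // {(p, q). equivclp glued p q}"

definition closed_cells :: "cpoint set set" where
  "closed_cells = closed_cell ` F_tessellations"

definition cell_boundary :: "chord set \<Rightarrow> cpoint set" where
  "cell_boundary B = \<Union>{closed_cell A | A. A \<in> F_tessellations \<and> B \<subset> A}"

lemma infinite_associahedron_eq: "infinite_associahedron = \<Union>closed_cells"
  by (auto simp: infinite_associahedron_def closed_cells_def closed_cell_def cell_points_def
      quotient_def)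


section \<open>Combinatorial automorphisms\<close>

definition preserves_dimensions :: "(cpoint set \<Rightarrow> cpoint set) \<Rightarrow> bool" where
  "preserves_dimensions \<phi> \<longleftrightarrow>
     (\<forall>A\<in>F_tessellations. \<forall>B\<in>F_tessellations.
        \<phi> (closed_cell A) = closed_cell B \<longrightarrow> tess_rank B = tess_rank A)"

definition preserves_inclusions :: "(cpoint set \<Rightarrow> cpoint set) \<Rightarrow> bool" where
  "preserves_inclusions \<phi> \<longleftrightarrow>
     (\<forall>c\<in>closed_cells. \<forall>c'\<in>closed_cells. c \<subseteq> c' \<longleftrightarrow> \<phi> c \<subseteq> \<phi> c')"

definition preserves_boundaries :: "(cpoint set \<Rightarrow> cpoint set) \<Rightarrow> bool" where
  "preserves_boundaries \<phi> \<longleftrightarrow>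
     (\<forall>A\<in>F_tessellations. \<forall>B\<in>F_tessellations.
        \<phi> (closed_cell A) = closed_cell B \<longrightarrow>
        {c \<in> closed_cells. c \<subseteq> cell_boundary B} = \<phi> ` {c \<in> closed_cells. c \<subseteq> cell_boundary A})"

definition Aut_C :: "(cpoint set \<Rightarrow> cpoint set) monoid" where
  "Aut_C = (BijGroup closed_cells)
     \<lparr>carrier := {\<phi> \<in> Bij closed_cells.
        preserves_dimensions \<phi> \<and> preserves_inclusions \<phi> \<and> preserves_boundaries \<phi>}\<rparr>"


section \<open>The non-oriented Thompson group\<close>

text \<open>A map \<open>h\<close> of the circle has derivative \<open>d\<close> at \<^term>\<open>gam s\<close> with respect to the arc-length
  parameter if a local lift of \<open>h\<close> to the line has derivative \<open>d\<close> at \<open>s\<close>. A lift that is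
  differentiable at \<open>s\<close> is continuous there, hence unique near \<open>s\<close> up to an integer constant when
  \<open>h\<close> is continuous.\<close>

definition has_circle_derivative :: "(point \<Rightarrow> point) \<Rightarrow> real \<Rightarrow> real \<Rightarrow> bool" where
  "has_circle_derivative h d s \<longleftrightarrow>
     (\<exists>g. (\<forall>\<^sub>F u in nhds s. h (gam u) = gam (g u)) \<and> (g has_real_derivative d) (at s))"

definition piecewise_linear :: "(point \<Rightarrow> point) \<Rightarrow> bool" where
  "piecewise_linear h \<longleftrightarrow>
     (\<exists>S. finite S \<and>
        (\<forall>a b. a < b \<and> {a<..<b} \<subseteq> {0..1} - S \<longrightarrow>
           (\<exists>m c. \<forall>u\<in>{a<..<b}. h (gam u) = gam (m * u + c))))"

definition T_no :: "(point \<Rightarrow> point) monoid" where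
  "T_no = (BijGroup circle)
     \<lparr>carrier := {h \<in> Bij circle.
        (\<exists>k. homeomorphism circle circle h k) \<and>
        piecewise_linear h \<and>
        h ` dyadic_points = dyadic_points \<and>
        (\<exists>S. finite S \<and> S \<subseteq> dyadics \<inter> {0..1} \<and>
           (\<forall>s\<in>{0..1} - S. \<exists>d. has_circle_derivative h d s)) \<and>
        (\<forall>s\<in>{0..1}. \<forall>d. has_circle_derivative h d s \<longrightarrow> (\<exists>k :: int. \<bar>d\<bar> = 2 powi k))}\<rparr>"

definition act :: "(point \<Rightarrow> point) \<Rightarrow> chord set \<Rightarrow> chord set" where
  "act t A = {closed_segment (t p) (t q) | p q. closed_segment p q \<in> A}"

end

theory Submission
  imports Defs
begin

text \<open>
  A noncrossing set of dyadic arcs is an \<open>F\<close>-tessellation iff it differs from \<^term>\<open>A_F\<close> by finitely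
  many arcs, and the closed cells of \<open>C\<close>, ordered by inclusion, form the reverse of the poset of
  \<open>F\<close>-tessellations; dimensions and boundaries are determined by this order. The poset is closed under
  intersections, and the coatoms below a tessellation correspond to its arcs, so an order automorphism
  comes from a bijection of the dyadic arcs. The latter preserves crossing, and since incidence of arcs
  can be expressed by crossing, it comes from a bijection of the dyadic points. Almost all arcs of
  \<^term>\<open>A_F\<close> are sent to arcs of \<^term>\<open>A_F\<close>; hence on small standard dyadic intervals midpoints go to
  midpoints, and the bijection is affine there and extends to an element of \<^term>\<open>T_no\<close>.\<close>

section \<open>Chords of the circle\<close>

text \<open>The conditions on an \<open>F\<close>-triangulation are topological and infinite. They
  become finite because arcs of \<open>A_F\<close> of high level hug the circle: near a point of the
  disk only finitely many arcs matter, and standard arcs of level at least N never cross a chord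
  between points of level N, so that maximality can be tested in a finite inscribed polygon.
  Inclusion of closed cells concerns classes of a generated equivalence relation; an invariant
  function on chords, equal to 1 exactly on \<open>A\<close> at the centre of the cell of
  \<open>A\<close>, decides it without a description of the classes. A bijection of dyadic points
  that comes from the order carries no continuity. It is forced to be locally affine because the
  midpoint of a small standard interval is the only point inside the interval that completes its arc
  to a triangle of standard arcs. Membership in the Thompson group is handled through one normal
  form: a homeomorphism that preserves the dyadic points and is affine, with slope plus or minus a
  power of 2 and dyadic constant, on every interval of some level N.\<close>

declare split_paired_All [simp del] split_paired_Ex [simp del]

abbreviation rad :: real where "rad \<equiv> 1 / (2 * pi)"

lemma mem_disk: "p \<in> disk \<longleftrightarrow> norm p < rad"
  by (simp add: disk_def zero_prod_def[symmetric])

lemma mem_circle: "p \<in> circle \<longleftrightarrow> norm p = rad"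
  by (simp add: circle_def zero_prod_def[symmetric])

lemma circle_disjoint_disk: "p \<in> circle \<Longrightarrow> p \<notin> disk"
  by (simp add: mem_disk mem_circle)

lemma norm_sq_point: "(norm (p :: point))\<^sup>2 = (fst p)\<^sup>2 + (snd p)\<^sup>2"
  by (cases p) (simp add: norm_Pair)

lemma gam_circle: "gam t \<in> circle"
proof -
  have "(norm (gam t))\<^sup>2 = ((cos (2 * pi * t))\<^sup>2 + (sin (2 * pi * t))\<^sup>2) / (2 * pi)\<^sup>2"
    unfolding norm_sq_point gam_def by (simp add: power_divide add_divide_distrib del: sin_cos_squared_add sin_cos_squared_add2)
  also have "\<dots> = rad\<^sup>2"
    by (simp add: power_divide)
  finally have "norm (gam t) = rad"
    by (simp add: power2_eq_iff_nonneg)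
  then show ?thesis by (simp add: mem_circle)
qed

lemma gam_eq_iff: "gam x = gam y \<longleftrightarrow> (\<exists>i::int. x = y + of_int i)"
proof -
  have "gam x = gam y \<longleftrightarrow> sin (2 * pi * x) = sin (2 * pi * y) \<and> cos (2 * pi * x) = cos (2 * pi * y)"
    by (auto simp: gam_def)
  also have "\<dots> \<longleftrightarrow> (\<exists>n::int. 2 * pi * x = 2 * pi * y + 2 * pi * n)"
    by (rule sin_cos_eq_iff)
  also have "\<dots> \<longleftrightarrow> (\<exists>i::int. x = y + of_int i)"
    by (simp add: distrib_left[symmetric] mult.assoc)
  finally show ?thesis .
qed

lemma gam_add_int [simp]: "gam (x + of_int i) = gam x"
  using gam_eq_iff by auto

lemma gam_add_1 [simp]: "gam (x + 1) = gam x"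
  using gam_add_int[of x 1] by simp

lemma gam_inj: "gam x = gam y \<Longrightarrow> \<bar>x - y\<bar> < 1 \<Longrightarrow> x = y"
  unfolding gam_eq_iff by auto

lemma circle_param:
  assumes "w \<in> circle"
  obtains z where "x \<le> z" "z < x + 1" "w = gam z"
proof -
  have "(2 * pi * norm w)\<^sup>2 = 1"
    using assms by (simp add: mem_circle)
  then have "(2 * pi)\<^sup>2 * ((fst w)\<^sup>2 + (snd w)\<^sup>2) = 1"
    by (simp only: power_mult_distrib norm_sq_point)
  then have "(2 * pi * fst w)\<^sup>2 + (2 * pi * snd w)\<^sup>2 = 1"
    by (simp only: power_mult_distrib distrib_left)
  then obtain t where t: "2 * pi * fst w = cos t" "2 * pi * snd w = sin t"
    by (rule sincos_total_2pi)
  define y where "y = t / (2 * pi)"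
  have "w = gam y"
    using t by (simp add: prod_eq_iff gam_def y_def field_simps)
  moreover define z where "z = y - of_int \<lfloor>y - x\<rfloor>"
  moreover have "gam y = gam z"
    unfolding gam_eq_iff z_def by auto
  moreover have "x \<le> z" "z < x + 1"
    unfolding z_def by linarith+
  ultimately show ?thesis using that by auto
qed

lemma circle_eq_gam: "circle = range gam"
proof -
  have "w \<in> range gam" if "w \<in> circle" for w
    using circle_param[OF that, of 0] by blast
  then show ?thesis using gam_circle by blast
qed

text \<open>The cross product of \<open>q - p\<close> and \<open>w - p\<close>, that is, twice the
  signed area of the triangle. It is affine in \<open>w\<close> and vanishes on the line through
  \<open>p\<close> and \<open>q\<close>, so its sign tells the two half planes apart.\<close>

definition side :: "point \<Rightarrow> point \<Rightarrow> point \<Rightarrow> real" where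
  "side p q w = (fst q - fst p) * (snd w - snd p) - (snd q - snd p) * (fst w - fst p)"

lemma side_same [simp]: "side p q p = 0" "side p q q = 0"
  by (simp_all add: side_def algebra_simps)

lemma side_swap: "side q p w = - side p q w"
  by (simp add: side_def algebra_simps)

lemma side_rotate: "side p q w = side q w p"
  by (simp add: side_def algebra_simps)

lemma side_comb: "side p q ((1 - s) *\<^sub>R u + s *\<^sub>R v) = (1 - s) * side p q u + s * side p q v"
  by (simp add: side_def algebra_simps)

lemma continuous_side [continuous_intros]: "continuous_on S (side p q)"
  unfolding side_def by (intro continuous_intros)

text \<open>The formula abc / (2R) for twice the area of a triangle with circumradius R: each chord
  has length 2R times the sine of half its central angle, and 2R = 1 / pi leaves the factor 1 /
  pi^2. The signs of the sines carry the orientation.\<close>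

lemma side_gam:
  "side (gam x) (gam y) (gam z) = sin (pi * (y - x)) * sin (pi * (z - y)) * sin (pi * (z - x)) / pi\<^sup>2"
proof -
  \<comment> \<open>Half angles turn the sum-to-product formulas into products without
    fractions.\<close>
  define a b c where "a = pi * x" and "b = pi * y" and "c = pi * z"
  have g: "gam x = (cos (2 * a) / (2 * pi), sin (2 * a) / (2 * pi))"
     "gam y = (cos (2 * b) / (2 * pi), sin (2 * b) / (2 * pi))"
     "gam z = (cos (2 * c) / (2 * pi), sin (2 * c) / (2 * pi))"
    by (simp_all add: gam_def a_def b_def c_def algebra_simps)
  have e1: "(cos (2 * u) - cos (2 * v)) = 2 * (sin (v + u) * sin (v - u))" for u v :: real
  proof -
    have "(2 * u + 2 * v) / 2 = v + u" "(2 * v - 2 * u) / 2 = v - u" by simp_all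
    then show ?thesis by (simp only: cos_diff_cos mult.assoc)
  qed
  have e2: "(sin (2 * u) - sin (2 * v)) = 2 * (sin (u - v) * cos (u + v))" for u v :: real
  proof -
    have "(2 * u + 2 * v) / 2 = u + v" "(2 * u - 2 * v) / 2 = u - v" by simp_all
    then show ?thesis by (simp only: sin_diff_sin mult.assoc)
  qed
  have "side (gam x) (gam y) (gam z) * (4 * pi\<^sup>2) =
     (cos (2 * b) - cos (2 * a)) * (sin (2 * c) - sin (2 * a)) - (sin (2 * b) - sin (2 * a)) * (cos (2 * c) - cos (2 * a))"
    unfolding g side_def by (simp add: field_simps power2_eq_square)
  also have "\<dots> = 4 * (sin (b - a) * sin (c - a) * (sin (a + c) * cos (a + b) - cos (a + c) * sin (a + b)))"
    unfolding e1 e2 using sin_minus[of "a - b"] sin_minus[of "a - c"]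
    by (simp add: algebra_simps)
  also have "sin (a + c) * cos (a + b) - cos (a + c) * sin (a + b) = sin (c - b)"
    using sin_diff[of "a + c" "a + b"] by (simp add: algebra_simps)
  finally show ?thesis
    by (simp add: a_def b_def c_def field_simps)
qed

text \<open>Fixes the sign convention: the open arc passed when running counterclockwise from
  \<open>gam x\<close> to \<open>gam y\<close> is on the negative side, the complementary arc on the
  positive side.\<close>

lemma side_gam_neg:
  assumes "x < z" "z < y" "y < x + 1"
  shows "side (gam x) (gam y) (gam z) < 0"
proof -
  have "sin (pi * (y - x)) > 0" "sin (pi * (z - x)) > 0" "sin (pi * (y - z)) > 0"
    using assms by (auto intro!: sin_gt_zero mult_pos_pos)
  moreover have "sin (pi * (z - y)) = - sin (pi * (y - z))"
    using sin_minus[of "pi * (y - z)"] by (simp add: algebra_simps)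
  ultimately show ?thesis
    unfolding side_gam by (simp add: field_simps)
qed

lemma side_gam_pos:
  assumes "x < y" "y < z" "z < x + 1"
  shows "side (gam x) (gam y) (gam z) > 0"
  using side_gam_neg[OF assms] side_rotate side_swap by (metis neg_0_less_iff_less)

text \<open>The window from \<open>x\<close> to \<open>x + 1\<close> selects the representative for
  which the cyclic position of a point becomes an inequality.\<close>

lemma side_gam_neg_iff:
  assumes "x < y" "y < x + 1" "x \<le> z" "z < x + 1"
  shows "side (gam x) (gam y) (gam z) < 0 \<longleftrightarrow> x < z \<and> z < y"
  using assms side_gam_neg[of x z y] side_gam_pos[of x y z]
  by (cases "z = x"; cases "z = y"; cases "z < y") auto

lemma side_gam_pos_iff:
  assumes "x < y" "y < x + 1" "x \<le> z" "z < x + 1"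
  shows "side (gam x) (gam y) (gam z) > 0 \<longleftrightarrow> y < z"
  using assms side_gam_neg[of x z y] side_gam_pos[of x y z]
  by (cases "z = x"; cases "z = y"; cases "z < y") auto

lemma side_eq_0_iff:
  assumes "p \<in> circle" "q \<in> circle" "w \<in> circle" "p \<noteq> q"
  shows "side p q w = 0 \<longleftrightarrow> w = p \<or> w = q"
proof -
  obtain x where x: "p = gam x" using circle_param[OF assms(1)] by metis
  obtain y where y: "x \<le> y" "y < x + 1" "q = gam y" using circle_param[OF assms(2)] by metis
  obtain z where z: "x \<le> z" "z < x + 1" "w = gam z" using circle_param[OF assms(3)] by metis
  have "x \<noteq> y" using assms x y by auto
  with y have "x < y" by simp
  with x y z side_gam_neg_iff[of x y z] side_gam_pos_iff[of x y z] show ?thesis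
    by (smt (verit) side_same)
qed

lemma open_segment_in_disk:
  assumes "u \<in> circle" "v \<in> circle"
  shows "open_segment u v \<subseteq> disk"
proof
  fix x assume "x \<in> open_segment u v"
  from dist_decreases_open_segment[OF this, of 0] assms show "x \<in> disk"
    by (simp add: mem_disk mem_circle)
qed

lemma closed_segment_Int_disk:
  assumes "u \<in> circle" "v \<in> circle"
  shows "closed_segment u v \<inter> disk = open_segment u v"
  using open_segment_in_disk[OF assms] assms circle_disjoint_disk
  by (auto simp: closed_segment_eq_open)

lemma closed_segment_Int_circle:
  assumes "u \<in> circle" "v \<in> circle"
  shows "closed_segment u v \<inter> circle = {u, v}"
  using open_segment_in_disk[OF assms] assms circle_disjoint_disk
  by (auto simp: closed_segment_eq_open)

text \<open>With w = p + t (q - p) and \<open>p\<close>, \<open>q\<close> of equal norm, the squared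
  norms of \<open>w\<close> and \<open>p\<close> differ by t (t - 1) L, where L is the squared
  length of the chord. This being at most 0 confines t to the unit interval.\<close>

lemma on_line_in_segment:
  assumes "p \<in> circle" "q \<in> circle" "p \<noteq> q" "side p q w = 0" "norm w \<le> rad"
  shows "w \<in> closed_segment p q"
proof -
  define L where "L = (fst q - fst p)\<^sup>2 + (snd q - snd p)\<^sup>2"
  have L: "L > 0"
    using \<open>p \<noteq> q\<close> unfolding L_def
    by (metis prod_eq_iff eq_iff_diff_eq_0 sum_power2_gt_zero_iff)
  \<comment> \<open>The coordinate of the orthogonal projection of \<open>w\<close> to the
    line.\<close>
  define t where "t = ((fst w - fst p) * (fst q - fst p) + (snd w - snd p) * (snd q - snd p)) / L"
  have w1: "(fst w - fst p) * L = t * L * (fst q - fst p)"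
  proof -
    have "t * L = (fst w - fst p) * (fst q - fst p) + (snd w - snd p) * (snd q - snd p)"
      using L by (simp add: t_def)
    then show ?thesis using assms(4) unfolding side_def L_def by algebra
  qed
  have w2: "(snd w - snd p) * L = t * L * (snd q - snd p)"
  proof -
    have "t * L = (fst w - fst p) * (fst q - fst p) + (snd w - snd p) * (snd q - snd p)"
      using L by (simp add: t_def)
    then show ?thesis using assms(4) unfolding side_def L_def by algebra
  qed
  have f: "fst w = fst p + t * (fst q - fst p)" "snd w = snd p + t * (snd q - snd p)"
  proof -
    have "fst w - fst p = t * (fst q - fst p)" "snd w - snd p = t * (snd q - snd p)"
      using w1 w2 L by (simp_all add: mult.commute mult.left_commute)
    then show "fst w = fst p + t * (fst q - fst p)" "snd w = snd p + t * (snd q - snd p)" by simp_all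
  qed
  have "(norm w)\<^sup>2 \<le> rad\<^sup>2" using assms(5) by (intro power_mono) auto
  then have "(norm w)\<^sup>2 \<le> (norm p)\<^sup>2" "(norm p)\<^sup>2 = (norm q)\<^sup>2" using assms(1,2) by (simp_all add: mem_circle)
  then have *: "(fst w)\<^sup>2 + (snd w)\<^sup>2 \<le> (fst p)\<^sup>2 + (snd p)\<^sup>2" "(fst p)\<^sup>2 + (snd p)\<^sup>2 = (fst q)\<^sup>2 + (snd q)\<^sup>2"
    by (simp_all add: norm_sq_point)
  have "(fst w)\<^sup>2 + (snd w)\<^sup>2 - ((fst p)\<^sup>2 + (snd p)\<^sup>2) =
     t * (t - 1) * L + t * (((fst q)\<^sup>2 + (snd q)\<^sup>2) - ((fst p)\<^sup>2 + (snd p)\<^sup>2))"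
    unfolding f L_def by algebra
  then have "t * (t - 1) * L \<le> 0" using * by simp
  then have "t * (t - 1) \<le> 0" using L by (simp add: mult_le_0_iff)
  then have "0 \<le> t" "t \<le> 1" by (auto simp: mult_le_0_iff)
  moreover have "w = (1 - t) *\<^sub>R p + t *\<^sub>R q"
    using f by (auto simp: prod_eq_iff algebra_simps)
  ultimately show ?thesis by (auto simp: in_segment)
qed

lemma side_on_segment: "w \<in> closed_segment p q \<Longrightarrow> side p q w = 0"
  by (auto simp: in_segment side_comb)

definition crosses :: "chord \<Rightarrow> chord \<Rightarrow> bool" where
  "crosses a b \<longleftrightarrow> a \<noteq> b \<and> a \<inter> b \<inter> disk \<noteq> {}"

lemma noncrossing_disk_iff: "noncrossing disk A \<longleftrightarrow> (\<forall>a\<in>A. \<forall>b\<in>A. \<not> crosses a b)"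
  by (auto simp: noncrossing_def pairwise_def crosses_def)

lemma crosses_sym: "crosses a b \<longleftrightarrow> crosses b a"
  by (auto simp: crosses_def)

lemma not_crosses_self [simp]: "\<not> crosses a a"
  by (simp add: crosses_def)

abbreviation "seg \<equiv> closed_segment :: point \<Rightarrow> point \<Rightarrow> chord"

lemma side_between:
  assumes "w \<in> open_segment u v"
  shows "min (side p q u) (side p q v) \<le> side p q w \<and> side p q w \<le> max (side p q u) (side p q v)"
    and "side p q u < side p q v \<Longrightarrow> side p q u < side p q w \<and> side p q w < side p q v"
proof -
  obtain s where s: "0 < s" "s < 1" "w = (1 - s) *\<^sub>R u + s *\<^sub>R v"
    using assms by (auto simp: in_segment)
  have e: "side p q w - side p q u = s * (side p q v - side p q u)"
    unfolding s(3) side_comb by (simp add: algebra_simps)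
  have e': "side p q v - side p q w = (1 - s) * (side p q v - side p q u)"
    unfolding s(3) side_comb by (simp add: algebra_simps)
  show 2: "side p q u < side p q v \<Longrightarrow> side p q u < side p q w \<and> side p q w < side p q v"
    using s(1,2) mult_pos_pos[of s "side p q v - side p q u"] mult_pos_pos[of "1-s" "side p q v - side p q u"] e e' by linarith
  have 3: "side p q v < side p q u \<Longrightarrow> side p q v < side p q w \<and> side p q w < side p q u"
    using s(1,2) mult_pos_neg[of s "side p q v - side p q u"] mult_pos_neg[of "1-s" "side p q v - side p q u"] e e' by linarith
  show "min (side p q u) (side p q v) \<le> side p q w \<and> side p q w \<le> max (side p q u) (side p q v)"
    using 2 3 e by (cases "side p q u" "side p q v" rule: linorder_cases) auto
qed

text \<open>A common point inside the disk is a proper convex combination of \<open>u\<close> and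
  \<open>v\<close> at which the affine function \<open>side p q\<close> vanishes, so its values at
  \<open>u\<close> and \<open>v\<close> have opposite signs or are both 0; in the latter case the
  chords coincide. Conversely, the zero between \<open>u\<close> and \<open>v\<close> lies in the
  disk, hence on the chord by \<open>on_line_in_segment\<close>.\<close>

lemma crosses_iff:
  assumes "p \<in> circle" "q \<in> circle" "p \<noteq> q" "u \<in> circle" "v \<in> circle" "u \<noteq> v"
  shows "crosses (seg p q) (seg u v) \<longleftrightarrow> side p q u * side p q v < 0"
proof
  assume "crosses (seg p q) (seg u v)"
  then obtain w where ne: "seg p q \<noteq> seg u v" and w: "w \<in> seg p q" "w \<in> seg u v" "w \<in> disk"
    by (auto simp: crosses_def)
  have "w \<in> open_segment u v" using w assms closed_segment_Int_disk by blast
  then obtain s where s: "0 < s" "s < 1" "w = (1 - s) *\<^sub>R u + s *\<^sub>R v" by (auto simp: in_segment)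
  have e: "(1 - s) * side p q u + s * side p q v = 0"
    using side_on_segment[OF w(1)] s(3) side_comb by simp
  have "\<not> (side p q u = 0 \<and> side p q v = 0)"
  proof
    assume "side p q u = 0 \<and> side p q v = 0"
    then have "{u, v} = {p, q}" using assms by (auto simp: side_eq_0_iff)
    then show False using ne by (metis closed_segment_eq)
  qed
  then have "side p q u \<noteq> 0" using e s by auto
  have "side p q u * side p q v * s = - ((1 - s) * (side p q u)\<^sup>2)"
    using e by (simp add: power2_eq_square) algebra
  also have "\<dots> < 0" using s \<open>side p q u \<noteq> 0\<close> by simp
  finally show "side p q u * side p q v < 0" using s by (simp add: mult_less_0_iff)
next
  assume neg: "side p q u * side p q v < 0"
  define a b where "a = side p q u" and "b = side p q v"
  \<comment> \<open>The zero of the affine function (1 - s) a + s b.\<close>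
  define s where "s = a / (a - b)"
  have ab: "a \<noteq> b" "a * b < 0" using neg by (auto simp: a_def b_def mult_less_0_iff)
  have s: "0 < s" "s < 1"
    using ab unfolding s_def by (auto simp: mult_less_0_iff field_simps)
  define w where "w = (1 - s) *\<^sub>R u + s *\<^sub>R v"
  have "side p q w = (1 - s) * a + s * b" by (simp add: w_def side_comb a_def b_def)
  also have "\<dots> = 0" using ab by (simp add: s_def field_simps)
  finally have w0: "side p q w = 0" .
  have w1: "w \<in> open_segment u v" using s assms(6) by (auto simp: in_segment w_def)
  then have "w \<in> disk" using open_segment_in_disk assms by blast
  then have "w \<in> seg p q" using on_line_in_segment[OF assms(1-3) w0] by (simp add: mem_disk)
  moreover have "seg p q \<noteq> seg u v"
    using ab(2) side_on_segment[of u p q] ends_in_segment(1)[of u v]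
    by (metis a_def less_irrefl mult_zero_left)
  ultimately show "crosses (seg p q) (seg u v)"
    using w1 \<open>w \<in> disk\<close> by (auto simp: crosses_def dest: open_closed_segment)
qed

section \<open>Dyadic arcs and the standard triangulation\<close>

lemma dyadicsI [intro]: "of_int m / 2 ^ n \<in> dyadics"
  unfolding dyadics_def by blast

lemma dyadicsE:
  assumes "x \<in> dyadics" obtains m n where "x = of_int m / 2 ^ n"
  using assms unfolding dyadics_def by blast

lemma dyadics_of_int [simp]: "of_int i \<in> dyadics"
  using dyadicsI[of i 0] by simp

lemma dyadics_raise: "of_int m / 2 ^ n = (of_int (m * 2 ^ k) / 2 ^ (n + k) :: real)"
  by (simp add: power_add)

lemma dyadics_add [intro]:
  assumes "x \<in> dyadics" "y \<in> dyadics" shows "x + y \<in> dyadics"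
proof -
  obtain m n where x: "x = of_int m / 2 ^ n" using assms dyadicsE by metis
  obtain k l where y: "y = of_int k / 2 ^ l" using assms dyadicsE by metis
  have "x + y = of_int (m * 2 ^ l + k * 2 ^ n) / 2 ^ (n + l)"
    unfolding x y by (simp add: power_add field_simps)
  then show ?thesis by (simp only: dyadicsI)
qed

lemma dyadics_uminus [intro]: "x \<in> dyadics \<Longrightarrow> - x \<in> dyadics"
  by (metis dyadicsE dyadicsI minus_divide_left of_int_minus)

lemma dyadics_diff [intro]: "x \<in> dyadics \<Longrightarrow> y \<in> dyadics \<Longrightarrow> x - y \<in> dyadics"
  using dyadics_add[of x "- y"] dyadics_uminus[of y] by simp

lemma dyadics_mult [intro]:
  assumes "x \<in> dyadics" "y \<in> dyadics" shows "x * y \<in> dyadics"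
proof -
  obtain m n where x: "x = of_int m / 2 ^ n" using assms dyadicsE by metis
  obtain k l where y: "y = of_int k / 2 ^ l" using assms dyadicsE by metis
  have "x * y = of_int (m * k) / 2 ^ (n + l)"
    unfolding x y by (simp add: power_add field_simps)
  then show ?thesis by (metis dyadicsI)
qed

lemma dyadics_powi [intro, simp]: "2 powi k \<in> dyadics"
proof (cases "k \<ge> 0")
  case True
  then have "(2::real) powi k = of_int (2 ^ nat k)" by (simp add: power_int_def)
  then show ?thesis by (metis dyadics_of_int)
next
  case False
  then have "(2::real) powi k = of_int 1 / 2 ^ nat (- k)" by (simp add: power_int_def field_simps)
  then show ?thesis by (metis dyadicsI)
qed

lemma gam_mem_dyadic_points_iff: "gam x \<in> dyadic_points \<longleftrightarrow> x \<in> dyadics"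
proof
  assume "gam x \<in> dyadic_points"
  then obtain y where "y \<in> dyadics" "gam x = gam y" unfolding dyadic_points_def by blast
  then show "x \<in> dyadics" by (auto simp: gam_eq_iff)
next
  assume x: "x \<in> dyadics"
  have "x - of_int \<lfloor>x\<rfloor> \<in> dyadics \<inter> {0..1}" using x by (auto intro: less_imp_le) linarith
  moreover have "gam x = gam (x - of_int \<lfloor>x\<rfloor>)" by (auto simp: gam_eq_iff)
  ultimately show "gam x \<in> dyadic_points" unfolding dyadic_points_def by blast
qed

lemma dyadic_points_circle: "p \<in> dyadic_points \<Longrightarrow> p \<in> circle"
  unfolding dyadic_points_def using gam_circle by auto

text \<open>The vertices of a regular polygon with 2^n vertices. These finite nested sets exhaust
  the dyadic points; indexing by all integers keeps the arithmetic free of reductions modulo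
  2^n.\<close>

definition Lev :: "nat \<Rightarrow> point set" where
  "Lev n = range (\<lambda>i::int. gam (of_int i / 2 ^ n))"

lemma LevI [intro]: "gam (of_int i / 2 ^ n) \<in> Lev n"
  by (auto simp: Lev_def)

lemma Lev_mono: "n \<le> k \<Longrightarrow> Lev n \<subseteq> Lev k"
proof -
  assume "n \<le> k"
  then have "gam (of_int i / 2 ^ n) = gam (of_int (i * 2 ^ (k - n)) / 2 ^ k)" for i :: int
    using dyadics_raise[of i n "k - n"] by (simp only: le_add_diff_inverse)
  then have "gam (of_int i / 2 ^ n) \<in> Lev k" for i :: int by (simp only: LevI)
  then show ?thesis unfolding Lev_def[of n] by blast
qed

lemma Lev_dyadic_points: "p \<in> Lev n \<Longrightarrow> p \<in> dyadic_points"
  unfolding Lev_def by (auto simp: gam_mem_dyadic_points_iff)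

lemma Lev_circle: "p \<in> Lev n \<Longrightarrow> p \<in> circle"
  using Lev_dyadic_points dyadic_points_circle by blast

lemma dyadic_points_eq: "dyadic_points = (\<Union>n. Lev n)"
proof -
  have "p \<in> (\<Union>n. Lev n)" if "p \<in> dyadic_points" for p
  proof -
    obtain x where "p = gam x" using \<open>p \<in> dyadic_points\<close> by (auto simp: dyadic_points_def)
    moreover from this have "x \<in> dyadics" using that gam_mem_dyadic_points_iff by simp
    then obtain m n where "x = of_int m / 2 ^ n" by (rule dyadicsE)
    ultimately show ?thesis using LevI[of m n] by blast
  qed
  then show ?thesis using Lev_dyadic_points by blast
qed

lemma gam_Lev_shift: "gam (of_int (i + 2 ^ n * j) / 2 ^ n) = gam (of_int i / 2 ^ n)"
proof -
  have "(of_int (i + 2 ^ n * j) / 2 ^ n :: real) = of_int i / 2 ^ n + of_int j" by (simp add: field_simps)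
  then show ?thesis by simp
qed

lemma Lev_eq: "Lev n = (\<lambda>i::int. gam (of_int i / 2 ^ n)) ` {0..<2 ^ n}"
proof -
  have "gam (of_int i / 2 ^ n) \<in> (\<lambda>i::int. gam (of_int i / 2 ^ n)) ` {0..<2 ^ n}" for i :: int
  proof
    show "gam (of_int i / 2 ^ n) = gam (of_int (i mod 2 ^ n) / 2 ^ n)"
      using gam_Lev_shift[of "i mod 2 ^ n" n "i div 2 ^ n"] by simp
  qed simp
  then show ?thesis by (auto simp: Lev_def)
qed

lemma finite_Lev: "finite (Lev n)"
  unfolding Lev_eq by simp

lemma gam_mem_Lev_iff: "gam x \<in> Lev n \<longleftrightarrow> (\<exists>i::int. x = of_int i / 2 ^ n)"
proof
  assume "gam x \<in> Lev n"
  then obtain i :: int where "gam x = gam (of_int i / 2 ^ n)" unfolding Lev_def by auto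
  then obtain j :: int where "x = of_int i / 2 ^ n + of_int j" unfolding gam_eq_iff by auto
  then have "x = of_int (i + 2 ^ n * j) / 2 ^ n" by (simp add: field_simps)
  then show "\<exists>i::int. x = of_int i / 2 ^ n" by blast
qed auto

text \<open>The arcs of \<^term>\<open>A_F\<close>, indexed periodically; \<^term>\<open>arc_of 0 (1 / 2)\<close> occurs twice, as the arc
  of index 0 and of index 1 on level 1.\<close>

definition sarc :: "nat \<Rightarrow> int \<Rightarrow> chord" where
  "sarc n m = seg (gam (of_int m / 2 ^ n)) (gam ((of_int m + 1) / 2 ^ n))"

lemma sarc_shift: "sarc n (m + 2 ^ n * j) = sarc n m"
  unfolding sarc_def using gam_Lev_shift[of m n j] gam_Lev_shift[of "m + 1" n j]
  by (simp add: algebra_simps)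

lemma sarc_mod: "sarc n (m mod 2 ^ n) = sarc n m"
  using sarc_shift[of n "m mod 2 ^ n" "m div 2 ^ n"] by simp

lemma pow_ge_2: "n \<ge> 1 \<Longrightarrow> (2::real) \<le> 2 ^ n"
  using power_increasing[of 1 n "2::real"] by simp

lemma sarc_ends:
  assumes "n \<ge> 1" shows "gam (of_int m / 2 ^ n) \<noteq> gam ((of_int m + 1) / 2 ^ n)"
proof
  assume "gam (of_int m / 2 ^ n) = gam ((of_int m + 1) / 2 ^ n)"
  moreover have "\<bar>of_int m / 2 ^ n - (of_int m + 1) / 2 ^ n\<bar> < (1::real)"
    using pow_ge_2[OF assms] by (simp add: field_simps)
  ultimately have "of_int m / 2 ^ n = (of_int m + 1) / (2 ^ n :: real)" by (rule gam_inj)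
  then show False by (simp add: field_simps)
qed

lemma A_F_eq: "A_F = {sarc n m | n m. n \<ge> 1}"
proof -
  have s: "arc_of (real m / 2 ^ n) ((real m + 1) / 2 ^ n) = sarc n (int m)" for m n
    by (simp add: arc_of_def sarc_def del: closed_segment_eq)
  have s0: "arc_of 0 (1 / 2) = sarc 1 0" by (simp add: arc_of_def sarc_def)
  have s1: "sarc 1 1 = sarc 1 0"
    using gam_add_1[of 0] by (simp add: sarc_def insert_commute)
  have "sarc n m \<in> A_F" if "n \<ge> 1" for n m
  proof (cases "n = 1")
    case True
    have "m mod 2 = 0 \<or> m mod 2 = 1" by presburger
    then have "sarc 1 (m mod 2) = sarc 1 0" by (metis s1)
    then have "sarc n m = sarc 1 0" using sarc_mod[of n m] True by simp
    then show ?thesis unfolding A_F_def s0 by simp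
  next
    case False
    have "sarc n m = sarc n (int (nat (m mod 2 ^ n)))" using sarc_mod by simp
    moreover have "nat (m mod 2 ^ n) \<le> 2 ^ n - 1"
    proof -
      have "m mod 2 ^ n < 2 ^ n" by simp
      then have "nat (m mod 2 ^ n) < 2 ^ n" by (simp add: nat_less_iff)
      then show ?thesis by linarith
    qed
    moreover have "n > 1" using False that by simp
    ultimately have "sarc n m \<in> {sarc n (int m) | m n. n > 1 \<and> m \<le> 2 ^ n - 1}"
      by (intro CollectI exI conjI)
    then show ?thesis unfolding A_F_def s by (rule insertI2)
  qed
  then have "{sarc n m | n m. n \<ge> 1} \<subseteq> A_F" by blast
  moreover have "d \<in> {sarc n m | n m. n \<ge> 1}" if "d \<in> A_F" for d
  proof -
    have "d = sarc 1 0 \<or> (\<exists>m n. d = sarc n (int m) \<and> n > 1)"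
      using that unfolding A_F_def s s0 by blast
    then show ?thesis
    proof
      assume "d = sarc 1 0"
      then show ?thesis by blast
    next
      assume "\<exists>m n. d = sarc n (int m) \<and> n > 1"
      then obtain m n where "d = sarc n (int m)" "n \<ge> 1" by fastforce
      then show ?thesis by blast
    qed
  qed
  ultimately show ?thesis by blast
qed

lemma sarc_A_F: "n \<ge> 1 \<Longrightarrow> sarc n m \<in> A_F"
  unfolding A_F_eq by blast

lemma sarc_ends_Lev: "gam (of_int m / 2 ^ n) \<in> Lev n" "gam ((of_int m + 1) / 2 ^ n) \<in> Lev n"
  using LevI[of m n] LevI[of "m + 1" n] by simp_all

text \<open>A finite exhaustion of the dyadic arcs: finiteness of a set of arcs is shown by placing
  it inside some \<open>larcs N\<close>.\<close>

definition larcs :: "nat \<Rightarrow> chord set" where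
  "larcs n = {seg p q | p q. p \<in> Lev n \<and> q \<in> Lev n \<and> p \<noteq> q}"

lemma larcs_mono: "n \<le> k \<Longrightarrow> larcs n \<subseteq> larcs k"
  unfolding larcs_def using Lev_mono by blast

lemma finite_larcs: "finite (larcs n)"
proof -
  have "larcs n \<subseteq> (\<lambda>(p, q). seg p q) ` (Lev n \<times> Lev n)"
    unfolding larcs_def by auto
  then show ?thesis using finite_Lev finite_subset by blast
qed

lemma dyadic_arcs_eq: "dyadic_arcs = (\<Union>n. larcs n)"
proof
  show "dyadic_arcs \<subseteq> (\<Union>n. larcs n)"
  proof
    fix d assume "d \<in> dyadic_arcs"
    then obtain p q where d: "d = seg p q" "p \<in> dyadic_points" "q \<in> dyadic_points" "p \<noteq> q"
      by (auto simp: dyadic_arcs_def)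
    then obtain n k where "p \<in> Lev n" "q \<in> Lev k" by (auto simp: dyadic_points_eq)
    then have "p \<in> Lev (max n k)" "q \<in> Lev (max n k)" using Lev_mono[of n "max n k"] Lev_mono[of k "max n k"] by auto
    then show "d \<in> (\<Union>n. larcs n)" using d unfolding larcs_def by blast
  qed
  show "(\<Union>n. larcs n) \<subseteq> dyadic_arcs"
    unfolding larcs_def dyadic_arcs_def using Lev_dyadic_points by blast
qed

lemma larcs_dyadic_arcs: "d \<in> larcs n \<Longrightarrow> d \<in> dyadic_arcs"
  unfolding dyadic_arcs_eq by blast

lemma sarc_larcs: "n \<ge> 1 \<Longrightarrow> sarc n m \<in> larcs n"
  unfolding larcs_def sarc_def using sarc_ends sarc_ends_Lev by blast

lemma A_F_dyadic_arcs: "A_F \<subseteq> dyadic_arcs"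
  unfolding A_F_eq using sarc_larcs larcs_dyadic_arcs by blast

lemma finite_dyadic_arcs_level:
  assumes "finite F" "F \<subseteq> dyadic_arcs"
  obtains N where "F \<subseteq> larcs N" "N \<ge> 1"
proof -
  have "\<exists>N\<ge>1. F \<subseteq> larcs N" using assms
  proof (induction F rule: finite_induct)
    case (insert d F)
    then obtain N where N: "N \<ge> 1" "F \<subseteq> larcs N" by auto
    obtain k where "d \<in> larcs k" using insert by (auto simp: dyadic_arcs_eq)
    then have "insert d F \<subseteq> larcs (max N k)"
      using N larcs_mono[of N "max N k"] larcs_mono[of k "max N k"] by auto
    then show ?case using N by (metis max.coboundedI1)
  qed auto
  then show ?thesis using that by blast
qed

lemma odd_not_Lev:
  assumes "odd (i::int)" "k < n" shows "gam (of_int i / 2 ^ n) \<notin> Lev k"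
proof
  assume "gam (of_int i / 2 ^ n) \<in> Lev k"
  then have "gam (of_int i / 2 ^ n) \<in> Lev (n - 1)" using Lev_mono[of k "n - 1"] assms by (metis One_nat_def Suc_leI Suc_pred gr_implies_not_zero not_gr_zero le_Suc_eq not_less subsetD)
  then obtain j :: int where "(of_int i / 2 ^ n :: real) = of_int j / 2 ^ (n - 1)" unfolding gam_mem_Lev_iff by blast
  moreover have "(2::real) ^ n = 2 * 2 ^ (n - 1)" using assms by (cases n) auto
  ultimately have "(of_int i :: real) = of_int (2 * j)" by (simp add: field_simps)
  then have "i = 2 * j" by linarith
  then show False using assms by simp
qed

text \<open>One of \<open>m\<close> and \<open>m + 1\<close> is odd, so an end of the arc is new at
  level \<open>n\<close>.\<close>

lemma sarc_not_larcs:
  assumes "k < n" "n \<ge> 1" shows "sarc n m \<notin> larcs k"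
proof
  assume "sarc n m \<in> larcs k"
  then obtain p q where "sarc n m = seg p q" "p \<in> Lev k" "q \<in> Lev k" unfolding larcs_def by blast
  then have "gam (of_int m / 2 ^ n) \<in> Lev k" "gam ((of_int (m + 1)) / 2 ^ n) \<in> Lev k"
    unfolding sarc_def closed_segment_eq doubleton_eq_iff by auto
  moreover have "odd m \<or> odd (m + 1)" by simp
  ultimately show False using odd_not_Lev[OF _ \<open>k < n\<close>] by blast
qed

lemma Lev_param:
  assumes "p \<in> Lev n"
  obtains i :: int where "m \<le> i" "i < m + 2 ^ n" "p = gam (of_int i / 2 ^ n)"
proof -
  obtain j :: int where j: "p = gam (of_int j / 2 ^ n)" using assms by (auto simp: Lev_def)
  define i where "i = m + (j - m) mod 2 ^ n"
  have "j = i + 2 ^ n * ((j - m) div 2 ^ n)" unfolding i_def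
    by (metis add.commute add_diff_cancel_left' diff_add_cancel group_cancel.add1 mult_div_mod_eq)
  then have "p = gam (of_int i / 2 ^ n)" using j gam_Lev_shift by metis
  moreover have "m \<le> i" "i < m + 2 ^ n" by (auto simp: i_def)
  ultimately show ?thesis using that by blast
qed

text \<open>The open interval under a standard arc of level \<open>n\<close> contains no point of
  level \<open>n\<close>.\<close>

lemma Lev_side_sarc:
  assumes "n \<ge> 1" "p \<in> Lev n"
  shows "side (gam (of_int m / 2 ^ n)) (gam ((of_int m + 1) / 2 ^ n)) p \<ge> 0"
proof -
  obtain i :: int where i: "m \<le> i" "i < m + 2 ^ n" "p = gam (of_int i / 2 ^ n)"
    using Lev_param[OF assms(2)] by blast
  have "real_of_int i < real_of_int (m + 2 ^ n)" using i(2) by linarith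
  then have l: "real_of_int i < of_int m + 2 ^ n" by simp
  have "\<not> side (gam (of_int m / 2 ^ n)) (gam ((of_int m + 1) / 2 ^ n)) p < 0"
    unfolding i(3)
    by (subst side_gam_neg_iff) (use pow_ge_2[OF assms(1)] i l in \<open>auto simp: field_simps\<close>)
  then show ?thesis by simp
qed

text \<open>All points of level at most \<open>n\<close> lie on one closed side of the arc. Hence a
  dyadic arc of level \<open>k\<close> can be crossed only by the finitely many standard arcs of
  level below \<open>k\<close>, and standard arcs do not cross each other.\<close>

lemma sarc_not_crosses_larcs:
  assumes "1 \<le> n" "k \<le> n" "d \<in> larcs k" shows "\<not> crosses (sarc n m) d"
proof -
  obtain p q where d: "d = seg p q" "p \<in> Lev k" "q \<in> Lev k" "p \<noteq> q" using assms by (auto simp: larcs_def)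
  have pq: "p \<in> Lev n" "q \<in> Lev n" using d Lev_mono[OF assms(2)] by auto
  show ?thesis unfolding d sarc_def
    using crosses_iff[of "gam (of_int m / 2 ^ n)" "gam ((of_int m + 1) / 2 ^ n)" p q]
      sarc_ends[OF assms(1)] d Lev_circle gam_circle
      Lev_side_sarc[OF assms(1) pq(1)] Lev_side_sarc[OF assms(1) pq(2)]
    by (simp add: not_less)
qed

lemma finite_A_F_crossing:
  assumes "d \<in> dyadic_arcs" shows "finite {a \<in> A_F. crosses a d}"
proof -
  obtain k where "d \<in> larcs k" using assms by (auto simp: dyadic_arcs_eq)
  have "{a \<in> A_F. crosses a d} \<subseteq> larcs k"
  proof
    fix a assume "a \<in> {a \<in> A_F. crosses a d}"
    then obtain n m where a: "a = sarc n m" "n \<ge> 1" "crosses a d" by (auto simp: A_F_eq)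
    then have "n < k" using sarc_not_crosses_larcs \<open>d \<in> larcs k\<close> not_less by blast
    then show "a \<in> larcs k" using sarc_larcs a larcs_mono[of n k] by auto
  qed
  then show ?thesis using finite_larcs finite_subset by blast
qed

lemma A_F_noncrossing: "noncrossing disk A_F"
proof -
  have "\<not> crosses (sarc n m) (sarc k l)" if "1 \<le> n" "1 \<le> k" for n m k l
    using sarc_not_crosses_larcs sarc_larcs that crosses_sym by (metis nle_le)
  then show ?thesis unfolding noncrossing_disk_iff A_F_eq by auto
qed

text \<open>A point new at level n + 1 is the midpoint of an interval of level \<open>n\<close>. A
  chord from it to a point of level n + 1 either ends at an end of this interval, and is then
  standard, or leaves the interval and crosses the arc over it.\<close>

lemma top_level_crosses:
  assumes "p \<in> Lev (Suc n)" "q \<in> Lev (Suc n)" "p \<notin> Lev n" "p \<noteq> q" "n \<ge> 1"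
  shows "seg p q \<in> A_F \<or> (\<exists>m. crosses (sarc n m) (seg p q))"
proof -
  obtain i :: int where i: "p = gam (of_int i / 2 ^ Suc n)" using assms by (auto simp: Lev_def)
  have "odd i"
  proof
    assume "even i"
    then obtain j where "i = 2 * j" by blast
    then have "p = gam (of_int j / 2 ^ n)" using i by simp
    then show False using assms(3) by auto
  qed
  then obtain m where m: "i = 2 * m + 1" by (auto elim: oddE)
  \<comment> \<open>The index of \<open>q\<close> is counted from the left end of the interval whose
    midpoint is \<open>p\<close>.\<close>
  obtain j where j: "2 * m \<le> j" "j < 2 * m + 2 ^ Suc n" "q = gam (of_int j / 2 ^ Suc n)"
    using Lev_param[OF assms(2)] by blast
  have "real_of_int j < real_of_int (2 * m + 2 ^ Suc n)" using j(2) by linarith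
  then have l: "real_of_int j < 2 * of_int m + 2 * 2 ^ n" by simp
  have n2: "(2::real) \<le> 2 ^ n" using pow_ge_2 assms by simp
  have "j \<noteq> 2 * m + 1" using assms(4) i j m by auto
  then consider "j = 2 * m" | "j = 2 * m + 2" | "2 * m + 2 < j" using j by linarith
  then show ?thesis
  proof cases
    case 1
    then have "seg p q = sarc (Suc n) (2 * m)" by (simp add: i j m sarc_def insert_commute)
    then show ?thesis using sarc_A_F by simp
  next
    case 2
    then have "seg p q = sarc (Suc n) (2 * m + 1)" by (simp add: i j m sarc_def add.commute)
    then show ?thesis using sarc_A_F by simp
  next
    case 3
    have "side (gam (of_int m / 2 ^ n)) (gam ((of_int m + 1) / 2 ^ n)) p < 0"
      unfolding i m by (rule side_gam_neg) (use n2 in \<open>auto simp: field_simps\<close>)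
    moreover have "real_of_int j > of_int (2 * m + 2)" using 3 by linarith
    then have "side (gam (of_int m / 2 ^ n)) (gam ((of_int m + 1) / 2 ^ n)) q > 0"
    proof -
      have e: "of_int m / 2 ^ n = 2 * of_int m / (2 ^ Suc n :: real)" "(of_int m + 1) / 2 ^ n = (2 * of_int m + 2) / (2 ^ Suc n :: real)"
        by (simp_all add: field_simps)
      have "real_of_int j / 2 ^ Suc n < (2 * of_int m + 2 * 2 ^ n) / 2 ^ Suc n"
        using l by (intro divide_strict_right_mono) auto
      also have "\<dots> = 2 * of_int m / (2 ^ Suc n :: real) + 1" by (simp add: field_simps)
      finally have A: "real_of_int j / 2 ^ Suc n < 2 * of_int m / (2 ^ Suc n :: real) + 1" .
      have B: "(2 * of_int m + 2) / (2 ^ Suc n :: real) < real_of_int j / 2 ^ Suc n"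
        using \<open>real_of_int j > of_int (2 * m + 2)\<close> by (intro divide_strict_right_mono) auto
      have C: "2 * of_int m / (2 ^ Suc n :: real) < (2 * of_int m + 2) / (2 ^ Suc n :: real)"
        by (intro divide_strict_right_mono) auto
      show ?thesis unfolding j e by (rule side_gam_pos[OF C B A])
    qed
    ultimately have "crosses (sarc n m) (seg p q)" unfolding sarc_def
      using assms(4) sarc_ends[OF assms(5)] gam_circle assms(1,2) Lev_circle by (simp add: crosses_iff mult_less_0_iff)
    then show ?thesis by blast
  qed
qed

text \<open>At the least level of \<open>d\<close> one of its ends is new, so
  \<open>top_level_crosses\<close> applies one level lower, which is still at least
  \<open>N\<close>. This lower bound on the level makes the set of candidates in
  \<open>tess_extend\<close> finite.\<close>

lemma not_A_F_crosses_level: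
  assumes "d \<in> dyadic_arcs" "d \<notin> A_F" "d \<notin> larcs N" "N \<ge> 1"
  shows "\<exists>n\<ge>N. \<exists>m. crosses (sarc n m) d"
proof -
  define k where "k = (LEAST k. d \<in> larcs k)"
  have "\<exists>k. d \<in> larcs k" using assms by (auto simp: dyadic_arcs_eq)
  then have k: "d \<in> larcs k" unfolding k_def by (rule LeastI_ex)
  have "N < k" using larcs_mono[of k N] k assms(3) not_less by blast
  then obtain n where n: "k = Suc n" "n \<ge> N" by (cases k) auto
  have "d \<notin> larcs n" using n not_less_Least[of n "\<lambda>k. d \<in> larcs k"] unfolding k_def by simp
  moreover obtain p q where d: "d = seg p q" "p \<in> Lev (Suc n)" "q \<in> Lev (Suc n)" "p \<noteq> q" using k n by (auto simp: larcs_def)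
  ultimately have "p \<notin> Lev n \<or> q \<notin> Lev n" unfolding larcs_def by blast
  then have "\<exists>m. crosses (sarc n m) d"
    using top_level_crosses[of p n q] top_level_crosses[of q n p] d assms(2,4) n closed_segment_commute[of p q] by auto
  then show ?thesis using n by blast
qed

lemma A_F_maximal:
  assumes "d \<in> dyadic_arcs" "d \<notin> A_F" shows "\<exists>a\<in>A_F. crosses a d"
proof (cases "d \<in> larcs 1")
  case True
  have "Lev 1 = {gam 0, gam (1/2)}"
  proof -
    have "{0..<2^1} = {0, 1::int}" by auto
    then show ?thesis unfolding Lev_eq by simp
  qed
  moreover obtain p q where "d = seg p q" "p \<in> Lev 1" "q \<in> Lev 1" "p \<noteq> q"
    using True unfolding larcs_def by blast
  moreover have "sarc 1 0 = seg (gam 0) (gam (1/2))" by (simp add: sarc_def)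
  ultimately have "d = sarc 1 0" by (metis closed_segment_commute insertE singletonD)
  then show ?thesis using assms sarc_A_F by auto
next
  case False
  then show ?thesis using not_A_F_crosses_level[OF assms False] sarc_A_F by auto
qed

section \<open>Noncrossing families almost equal to the standard one\<close>

definition tess :: "chord set \<Rightarrow> bool" where
  "tess B \<longleftrightarrow> B \<subseteq> dyadic_arcs \<and> noncrossing disk B \<and> finite (sym_diff B A_F)"

definition maxtess :: "chord set \<Rightarrow> bool" where
  "maxtess B \<longleftrightarrow> tess B \<and> (\<forall>d\<in>dyadic_arcs. (\<forall>b\<in>B. \<not> crosses d b) \<longrightarrow> d \<in> B)"

lemma tess_A_F: "tess A_F"
  by (simp add: tess_def A_F_dyadic_arcs A_F_noncrossing)

lemma noncrossing_subset: "noncrossing U A \<Longrightarrow> B \<subseteq> A \<Longrightarrow> noncrossing U B"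
  unfolding noncrossing_def by (rule pairwise_subset)

lemma tess_Int: "tess A \<Longrightarrow> tess B \<Longrightarrow> tess (A \<inter> B)"
proof -
  assume A: "tess A" and B: "tess B"
  have "sym_diff (A \<inter> B) A_F \<subseteq> sym_diff A A_F \<union> sym_diff B A_F" by blast
  then have "finite (sym_diff (A \<inter> B) A_F)"
    using A B finite_subset unfolding tess_def by (metis finite_Un)
  then show ?thesis using A B noncrossing_subset[of disk A "A \<inter> B"] by (auto simp: tess_def)
qed

lemma tess_Diff: "tess A \<Longrightarrow> finite K \<Longrightarrow> tess (A - K)"
proof -
  assume A: "tess A" and K: "finite K"
  have "sym_diff (A - K) A_F \<subseteq> sym_diff A A_F \<union> K" by blast
  then have "finite (sym_diff (A - K) A_F)"
    using A K finite_subset unfolding tess_def by (metis finite_Un)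
  then show ?thesis using A noncrossing_subset[of disk A "A - K"] by (auto simp: tess_def)
qed

lemma tess_finite_Diff: "tess A \<Longrightarrow> tess B \<Longrightarrow> finite (A - B)"
proof -
  assume A: "tess A" and B: "tess B"
  have "A - B \<subseteq> sym_diff A A_F \<union> sym_diff B A_F" by blast
  then show ?thesis
    using A B finite_subset unfolding tess_def by (metis finite_Un)
qed

lemma finite_sarc_level:
  assumes "finite F" "F \<subseteq> dyadic_arcs"
  obtains N where "N \<ge> 1" "\<And>n m. n \<ge> N \<Longrightarrow> sarc n m \<notin> F"
proof -
  obtain N where "F \<subseteq> larcs N" "N \<ge> 1" using finite_dyadic_arcs_level[OF assms] .
  then have "\<And>n m. n \<ge> Suc N \<Longrightarrow> sarc n m \<notin> F" using sarc_not_larcs[of N] by fastforce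
  then show ?thesis using that[of "Suc N"] by simp
qed

lemma tess_sarc_level:
  assumes "tess B" obtains N where "N \<ge> 1" "\<And>n m. n \<ge> N \<Longrightarrow> sarc n m \<in> B"
proof -
  have "finite (A_F - B)" using assms tess_finite_Diff tess_A_F by blast
  then obtain N where "N \<ge> 1" "\<And>n m. n \<ge> N \<Longrightarrow> sarc n m \<notin> A_F - B"
    using finite_sarc_level[of "A_F - B"] A_F_dyadic_arcs by blast
  then show ?thesis using that[of N] sarc_A_F by fastforce
qed

text \<open>Only finitely many arcs outside \<open>B\<close> are compatible with \<open>B\<close>.
  So a maximal noncrossing extension exists within a finite collection, and it stays almost equal to
  \<open>A_F\<close>.\<close>

lemma tess_extend:
  assumes "tess B" obtains A where "B \<subseteq> A" "maxtess A"
proof -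
  define E where "E = {d \<in> dyadic_arcs. \<forall>b\<in>B. \<not> crosses d b}"
  obtain N where N: "N \<ge> 1" "\<And>n m. n \<ge> N \<Longrightarrow> sarc n m \<in> B" using tess_sarc_level[OF assms] by blast
  \<comment> \<open>A compatible arc that is neither standard nor of level \<open>N\<close> would
    cross a standard arc of level at least \<open>N\<close>, and those all belong to
    \<open>B\<close>.\<close>
  have "E - B \<subseteq> (A_F - B) \<union> larcs N"
    using not_A_F_crosses_level[of _ N] N crosses_sym unfolding E_def by blast
  then have finE: "finite (E - B)"
    using tess_finite_Diff[OF tess_A_F assms] finite_larcs finite_subset by blast
  have BE: "B \<subseteq> E" using assms by (auto simp: E_def tess_def noncrossing_disk_iff)
  define C where "C = {A. B \<subseteq> A \<and> A \<subseteq> E \<and> noncrossing disk A}"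
  have "C \<subseteq> (\<lambda>X. B \<union> X) ` Pow (E - B)"
  proof
    fix A assume "A \<in> C"
    then have "A = B \<union> (A - B)" "A - B \<in> Pow (E - B)" by (auto simp: C_def)
    then show "A \<in> (\<lambda>X. B \<union> X) ` Pow (E - B)" by blast
  qed
  then have "finite C" using finE finite_subset by blast
  moreover have "B \<in> C" using assms BE by (auto simp: C_def tess_def)
  ultimately obtain A where A: "A \<in> C" "\<And>A'. A' \<in> C \<Longrightarrow> A \<subseteq> A' \<Longrightarrow> A' = A"
    using finite_has_maximal[of C] by (metis empty_iff)
  have "sym_diff A A_F \<subseteq> sym_diff B A_F \<union> (E - B)" using A(1) by (auto simp: C_def)
  then have "finite (sym_diff A A_F)" using assms finE finite_subset unfolding tess_def by (metis finite_Un)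
  then have "tess A" using A(1) by (auto simp: C_def tess_def E_def)
  moreover have "d \<in> A" if d: "d \<in> dyadic_arcs" "\<forall>b\<in>A. \<not> crosses d b" for d
  proof -
    have "insert d A \<in> C" using A(1) d crosses_sym by (auto simp: C_def E_def noncrossing_disk_iff)
    then show ?thesis using A(2) by blast
  qed
  ultimately show ?thesis using that[of A] A(1) by (auto simp: maxtess_def C_def)
qed

text \<open>By maximality a missing standard arc crosses some arc of \<open>A\<close>, necessarily
  one of the finitely many nonstandard ones, and each of these crosses only finitely many standard
  arcs. For images of \<open>A_F\<close> this leaves one half of the symmetric difference to
  estimate.\<close>

lemma maximal_finite_sym_diff:
  assumes "A \<subseteq> dyadic_arcs" "\<And>d. d \<in> dyadic_arcs \<Longrightarrow> \<forall>b\<in>A. \<not> crosses d b \<Longrightarrow> d \<in> A" "finite (A - A_F)"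
  shows "finite (A_F - A)"
proof -
  have "A_F - A \<subseteq> (\<Union>a\<in>A - A_F. {d \<in> A_F. crosses d a})"
  proof
    fix d assume d: "d \<in> A_F - A"
    then obtain a where a: "a \<in> A" "crosses d a" using assms(2)[of d] A_F_dyadic_arcs by blast
    then have "a \<notin> A_F" using d A_F_noncrossing by (auto simp: noncrossing_disk_iff)
    then show "d \<in> (\<Union>a\<in>A - A_F. {d \<in> A_F. crosses d a})" using a d by blast
  qed
  moreover have "finite (\<Union>a\<in>A - A_F. {d \<in> A_F. crosses d a})"
    using assms finite_A_F_crossing by auto
  ultimately show ?thesis by (rule finite_subset)
qed

text \<open>Add both arcs to \<open>A_F\<close> and discard the finitely many standard arcs that
  they cross. Thus two arcs are compatible iff some tessellation contains both, which lets an order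
  automorphism detect crossings.\<close>

lemma compatible_tess:
  assumes "d \<in> dyadic_arcs" "d' \<in> dyadic_arcs" "\<not> crosses d d'"
  obtains A where "tess A" "d \<in> A" "d' \<in> A"
proof -
  define A where "A = {d, d'} \<union> {a \<in> A_F. \<not> crosses a d \<and> \<not> crosses a d'}"
  have "noncrossing disk A" using A_F_noncrossing assms(3) crosses_sym
    unfolding A_def noncrossing_disk_iff by auto
  moreover have "sym_diff A A_F \<subseteq> {d, d'} \<union> {a \<in> A_F. crosses a d} \<union> {a \<in> A_F. crosses a d'}"
    unfolding A_def by blast
  then have "finite (sym_diff A A_F)"
    using finite_A_F_crossing assms by (meson finite.emptyI finite.insertI finite_UnI finite_subset)
  ultimately have "tess A" using assms A_F_dyadic_arcs by (auto simp: tess_def A_def)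
  then show ?thesis using that[of A] by (simp add: A_def)
qed

section \<open>Local finiteness in the open disk\<close>

lemma sarc_norm:
  assumes "w \<in> sarc n m" shows "rad * cos (pi / 2 ^ n) \<le> norm w"
proof -
  \<comment> \<open>The direction of the midpoint of the interval: the chord is perpendicular to
    \<open>u\<close>, at signed distance \<open>rad * cos (pi / 2 ^ n)\<close> from the
    centre.\<close>
  define th where "th = 2 * pi * ((of_int m + 1/2) / 2 ^ n)"
  define u :: point where "u = (cos th, sin th)"
  have nu: "norm u = 1" by (simp add: u_def norm_Pair)
  have e: "gam t \<bullet> u = rad * cos (2 * pi * t - th)" for t
    by (simp add: gam_def u_def inner_Pair cos_diff add_divide_distrib)
  have a1: "2 * pi * (of_int m / 2 ^ n) - th = - (pi / 2 ^ n)"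
    unfolding th_def by (simp add: field_simps)
  have a2: "2 * pi * ((of_int m + 1) / 2 ^ n) - th = pi / 2 ^ n"
    unfolding th_def by (simp add: field_simps)
  have 1: "gam (of_int m / 2 ^ n) \<bullet> u = rad * cos (pi / 2 ^ n)"
      "gam ((of_int m + 1) / 2 ^ n) \<bullet> u = rad * cos (pi / 2 ^ n)"
    unfolding e a1 a2 by simp_all
  obtain s where "w = (1 - s) *\<^sub>R gam (of_int m / 2 ^ n) + s *\<^sub>R gam ((of_int m + 1) / 2 ^ n)"
    using assms by (auto simp: sarc_def in_segment)
  then have "w \<bullet> u = (1 - s) * (rad * cos (pi / 2 ^ n)) + s * (rad * cos (pi / 2 ^ n))"
    using 1 by (simp add: inner_add_left)
  also have "\<dots> = rad * cos (pi / 2 ^ n)" by algebra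
  finally show ?thesis using norm_cauchy_schwarz[of w u] nu by simp
qed

lemma sarc_avoids:
  assumes "r < rad" obtains N where "\<And>n m w. n \<ge> N \<Longrightarrow> w \<in> sarc n m \<Longrightarrow> r < norm w"
proof -
  have "(\<lambda>n. pi * (1/2) ^ n) \<longlonglongrightarrow> pi * 0"
    by (intro tendsto_intros LIMSEQ_power_zero) simp
  then have "(\<lambda>n. pi / 2 ^ n) \<longlonglongrightarrow> 0" by (simp add: power_one_over field_simps)
  then have "(\<lambda>n. rad * cos (pi / 2 ^ n)) \<longlonglongrightarrow> rad * cos 0"
    by (intro tendsto_intros)
  then have "\<forall>\<^sub>F n in sequentially. r < rad * cos (pi / 2 ^ n)"
    using assms by (intro order_tendstoD(1)) auto
  then obtain N where "\<And>n. n \<ge> N \<Longrightarrow> r < rad * cos (pi / 2 ^ n)"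
    by (auto simp: eventually_sequentially)
  then show ?thesis using that[of N] sarc_norm by fastforce
qed

text \<open>The ball whose radius is half the distance from \<open>w\<close> to the circle stays
  away from the circle, while standard arcs of high level lie wholly near it. So the ball meets only
  nonstandard arcs and standard arcs of bounded level.\<close>

lemma tess_locally_finite:
  assumes "finite (B - A_F)" "w \<in> disk"
  obtains e where "e > 0" "ball w e \<subseteq> disk" "finite {d \<in> B. d \<inter> ball w e \<noteq> {}}"
proof -
  define e where "e = (rad - norm w) / 2"
  have e: "e > 0" "norm w + e < rad" using assms(2) by (auto simp: e_def mem_disk field_simps)
  obtain N where N: "\<And>n m v. n \<ge> N \<Longrightarrow> v \<in> sarc n m \<Longrightarrow> norm w + e < norm v" using sarc_avoids[OF e(2)] by blast
  have b: "norm v < norm w + e" if "v \<in> ball w e" for v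
    using that norm_triangle_sub[of v w] by (simp add: dist_norm norm_minus_commute)
  have "{d \<in> B. d \<inter> ball w e \<noteq> {}} \<subseteq> (B - A_F) \<union> larcs N"
  proof
    fix d assume d: "d \<in> {d \<in> B. d \<inter> ball w e \<noteq> {}}"
    show "d \<in> (B - A_F) \<union> larcs N"
    proof (cases "d \<in> A_F")
      case True
      then obtain n m where nm: "d = sarc n m" "n \<ge> 1" by (auto simp: A_F_eq)
      obtain v where "v \<in> d" "v \<in> ball w e" using d by blast
      then have "\<not> n \<ge> N" using N[of n v m] b[of v] nm by auto
      then show ?thesis using nm sarc_larcs larcs_mono[of n N] by auto
    qed (use d in auto)
  qed
  then have "finite {d \<in> B. d \<inter> ball w e \<noteq> {}}" using finite_larcs assms(1) finite_subset by blast
  moreover have "ball w e \<subseteq> disk" using b e by (force simp: mem_disk)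
  ultimately show ?thesis using that[OF e(1)] by blast
qed

section \<open>Triangulations are maximal noncrossing families\<close>

text \<open>A disk is strictly convex: a point inside a segment of the closed disk has norm below
  \<open>rad\<close>.\<close>

lemma extreme_on_circle:
  assumes "H \<subseteq> cball 0 rad" "p \<in> H" "p \<in> circle"
  shows "p extreme_point_of H"
  unfolding extreme_point_of_def
proof (intro conjI ballI notI)
  fix a b assume "a \<in> H" "b \<in> H" "p \<in> open_segment a b"
  then show False
    using dist_decreases_open_segment[of p a b 0] assms(1,3) by (force simp: mem_circle)
qed fact

lemma convex_hull_circle: "V \<subseteq> circle \<Longrightarrow> convex hull V \<subseteq> cball 0 rad"
  by (intro hull_minimal) (auto simp: mem_circle)

lemma segment_in_hull3:
  assumes "p \<in> {a, b, c}" "q \<in> {a, b, c}" "p \<noteq> q"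
  shows "seg p q \<subseteq> seg a b \<union> seg b c \<union> seg c a"
proof -
  have c: "seg b a = seg a b" "seg c b = seg b c" "seg a c = seg c a" by (rule closed_segment_commute)+
  show ?thesis using assms by (elim insertE emptyE; hypsubst; (simp only: c)?; blast)
qed

text \<open>The ends of the chord are on the circle, so they are extreme points of the triangle,
  hence vertices of it; then the chord is a side and lies on the frontier.\<close>

lemma no_chord_in_triangle:
  assumes H: "convex hull {a, b, c} \<subseteq> cball 0 rad"
    and pq: "p \<in> circle" "q \<in> circle" "p \<noteq> q"
    and sub: "open_segment p q \<subseteq> interior (convex hull {a, b, c})"
  shows False
proof -
  let ?H = "convex hull {a, b, c}"
  have "compact ?H" by (simp add: compact_convex_hull)
  then have cl: "closed ?H" by (rule compact_imp_closed)
  have "seg p q = closure (open_segment p q)" using pq by simp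
  also have "\<dots> \<subseteq> ?H" using sub interior_subset cl by (intro closure_minimal) auto
  finally have "p \<in> ?H" "q \<in> ?H" by auto
  then have "p \<in> {a, b, c} \<and> q \<in> {a, b, c}"
    using extreme_on_circle[OF H] pq extreme_point_of_convex_hull by blast
  then have "seg p q \<subseteq> frontier ?H"
    using segment_in_hull3[of p a b c q] pq frontier_of_triangle[of a b c] by auto
  moreover have "midpoint p q \<in> open_segment p q" using pq by simp
  ultimately show False using sub unfolding frontier_def
    by (meson Diff_iff open_closed_segment subset_iff)
qed

lemma triangle_interior_nonempty:
  assumes "\<not> collinear {a :: point, b, c}" shows "interior (convex hull {a, b, c}) \<noteq> {}"
proof -
  have "(1/3) *\<^sub>R a + (1/3) *\<^sub>R b + (1/3) *\<^sub>R c \<in> interior (convex hull {a, b, c})"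
    by (subst interior_convex_hull_3_minimal[OF assms])
      (simp, intro CollectI exI[of _ "1/3 :: real"], simp)
  then show ?thesis by blast
qed

lemma triangle_hull_in_cball:
  assumes "\<not> collinear {a, b, c}" "interior (convex hull {a, b, c}) \<subseteq> disk"
  shows "convex hull {a, b, c} \<subseteq> cball 0 rad"
proof -
  have "convex hull {a, b, c} \<subseteq> closure (interior (convex hull {a, b, c}))"
    using convex_closure_interior[OF convex_convex_hull triangle_interior_nonempty[OF assms(1)]] closure_subset by simp
  also have "\<dots> \<subseteq> cball 0 rad"
    using assms(2) by (intro closure_minimal) (auto simp: mem_disk less_imp_le)
  finally show ?thesis .
qed

text \<open>The open chord would be a connected subset of a disjoint union of open triangles, hence
  lie in one of them, against \<open>no_chord_in_triangle\<close>. Applied to a triangulation this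
  gives maximality, applied to a triangulation minus one arc it gives minimality.\<close>

lemma triangulates_no_extra:
  assumes "triangulates B" and pq: "p \<in> circle" "q \<in> circle" "p \<noteq> q"
    and nc: "\<And>b. b \<in> B \<Longrightarrow> \<not> crosses (seg p q) b" and "seg p q \<notin> B"
  shows False
proof -
  obtain \<T> where T: "\<And>T. T \<in> \<T> \<Longrightarrow> open_triangle T" "disjoint \<T>" "\<Union>\<T> = disk - \<Union>B"
    using assms(1) unfolding triangulates_def by blast
  have sub: "open_segment p q \<subseteq> \<Union>\<T>"
    using open_segment_in_disk[OF pq(1,2)] nc assms(6) unfolding T(3) crosses_def
    by (fastforce dest: open_closed_segment)
  have op: "open T" if "T \<in> \<T>" for T using T(1)[OF that] by (auto simp: open_triangle_def)
  have "midpoint p q \<in> open_segment p q" using pq by simp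
  then obtain T where T0: "T \<in> \<T>" "midpoint p q \<in> T" using sub by blast
  have "T \<inter> \<Union>(\<T> - {T}) = {}" using T(2) T0 unfolding disjoint_def by blast
  moreover have "open (\<Union>(\<T> - {T}))" using op by blast
  moreover have "open_segment p q \<subseteq> T \<union> \<Union>(\<T> - {T})" using sub by blast
  ultimately have "T \<inter> open_segment p q = {} \<or> \<Union>(\<T> - {T}) \<inter> open_segment p q = {}"
    using connectedD[OF convex_connected[OF convex_open_segment[of p q]], of T "\<Union>(\<T> - {T})"] op[OF T0(1)] by blast
  then have "open_segment p q \<subseteq> T" using T0 \<open>midpoint p q \<in> open_segment p q\<close> sub by blast
  moreover obtain a b c where abc: "\<not> collinear {a, b, c}" "T = interior (convex hull {a, b, c})"
    using T(1)[OF T0(1)] by (auto simp: open_triangle_def)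
  moreover have "convex hull {a, b, c} \<subseteq> cball 0 rad"
    using triangle_hull_in_cball[OF abc(1)] T(3) T0 unfolding abc(2) by blast
  ultimately show False using no_chord_in_triangle[of a b c p q] pq by blast
qed

section \<open>Chords of finite inscribed polygons\<close>

lemma side_gam01:
  assumes "0 \<le> x" "x < y" "y < 1" "0 \<le> z" "z < 1"
  shows "side (gam x) (gam y) (gam z) < 0 \<longleftrightarrow> x < z \<and> z < y"
    and "side (gam x) (gam y) (gam z) > 0 \<longleftrightarrow> z < x \<or> y < z"
proof -
  show "side (gam x) (gam y) (gam z) < 0 \<longleftrightarrow> x < z \<and> z < y"
  proof (cases "x \<le> z")
    case False
    \<comment> \<open>A parameter before \<open>x\<close> is replaced by its representative in the
      window that starts at \<open>x\<close>.\<close>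
    then show ?thesis using side_gam_neg_iff[of x y "z + 1"] assms by auto
  qed (use side_gam_neg_iff[of x y z] assms in auto)
  show "side (gam x) (gam y) (gam z) > 0 \<longleftrightarrow> z < x \<or> y < z"
  proof (cases "x \<le> z")
    case False
    then show ?thesis using side_gam_pos_iff[of x y "z + 1"] assms by auto
  qed (use side_gam_pos_iff[of x y z] assms in auto)
qed

lemma crosses_gam:
  assumes "0 \<le> x" "x < 1" "0 \<le> y" "y < 1" "0 \<le> z" "z < 1" "0 \<le> w" "w < 1" "distinct [x, y, z, w]"
  shows "crosses (seg (gam x) (gam y)) (seg (gam z) (gam w)) \<longleftrightarrow>
    (min x y < z \<and> z < max x y) \<noteq> (min x y < w \<and> w < max x y)"
proof -
  have ne: "gam x \<noteq> gam y" "gam z \<noteq> gam w"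
    using gam_inj[of x y] gam_inj[of z w] assms by (auto simp: abs_less_iff)
  have *: "crosses (seg (gam x) (gam y)) (seg (gam z) (gam w)) \<longleftrightarrow> (x < z \<and> z < y) \<noteq> (x < w \<and> w < y)"
    if "x < y" "0 \<le> x" "y < 1" "gam x \<noteq> gam y" "distinct [x, y, z, w]" for x y
    unfolding crosses_iff[OF gam_circle gam_circle that(4) gam_circle gam_circle ne(2)] mult_less_0_iff
      side_gam01(1)[OF that(2,1,3) assms(5,6)] side_gam01(2)[OF that(2,1,3) assms(5,6)]
      side_gam01(1)[OF that(2,1,3) assms(7,8)] side_gam01(2)[OF that(2,1,3) assms(7,8)]
    using that(1,5) unfolding distinct.simps list.set by simp linarith
  show ?thesis
  proof (cases "x < y")
    case True
    then show ?thesis using *[of x y] ne assms by (simp add: min_def max_def)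
  next
    case False
    then have "y < x" using assms by auto
    then show ?thesis unfolding closed_segment_commute[of "gam x" "gam y"]
      using *[of y x] ne assms by (simp add: min_def max_def)
  qed
qed

text \<open>The pairing of opposite vertices of the inscribed quadrilateral crosses. In parameters
  from the unit interval this is a statement about the order of four reals, left to linear
  arithmetic.\<close>

lemma pairings_cross:
  assumes "{a, b, c, d} \<subseteq> circle" "distinct [a, b, c, d]"
  shows "crosses (seg a b) (seg c d) \<or> crosses (seg a c) (seg b d) \<or> crosses (seg a d) (seg b c)"
proof -
  obtain x where x: "0 \<le> x" "x < 1" "a = gam x" using circle_param[of a 0] assms by auto
  obtain y where y: "0 \<le> y" "y < 1" "b = gam y" using circle_param[of b 0] assms by auto
  obtain z where z: "0 \<le> z" "z < 1" "c = gam z" using circle_param[of c 0] assms by auto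
  obtain w where w: "0 \<le> w" "w < 1" "d = gam w" using circle_param[of d 0] assms by auto
  have d: "distinct [x, y, z, w]" "distinct [x, z, y, w]" "distinct [x, w, y, z]" using assms(2) x y z w by auto
  show ?thesis unfolding x y z w
    unfolding crosses_gam[OF x(1,2) y(1,2) z(1,2) w(1,2) d(1)]
      crosses_gam[OF x(1,2) z(1,2) y(1,2) w(1,2) d(2)]
      crosses_gam[OF x(1,2) w(1,2) y(1,2) z(1,2) d(3)]
    using d(1) unfolding min_def max_def distinct.simps list.set by (simp split: if_splits) linarith
qed

lemma not_crosses_share:
  assumes "a \<in> circle" "b \<in> circle" "c \<in> circle" "a \<noteq> b" "a \<noteq> c"
  shows "\<not> crosses (seg a b) (seg a c)"
  using assms by (simp add: crosses_iff)

lemma side_closed_between: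
  assumes "w \<in> closed_segment u v"
  shows "min (side p q u) (side p q v) \<le> side p q w \<and> side p q w \<le> max (side p q u) (side p q v)"
  using assms side_between(1)[of w u v p q] by (auto simp: closed_segment_eq_open)

lemma side_zero_exists:
  assumes "side p q x > 0" "side p q y \<le> 0"
  obtains z where "z \<in> closed_segment x y" "side p q z = 0"
proof -
  define a b where "a = side p q x" and "b = side p q y"
  define t where "t = a / (a - b)"
  have ab: "a > 0" "b \<le> 0" using assms by (simp_all add: a_def b_def)
  have "side p q ((1 - t) *\<^sub>R x + t *\<^sub>R y) = (1 - t) * a + t * b" by (simp add: side_comb a_def b_def)
  also have "\<dots> = 0" using ab by (simp add: t_def field_simps)
  finally have "side p q ((1 - t) *\<^sub>R x + t *\<^sub>R y) = 0" .
  moreover have "0 \<le> t" "t \<le> 1" using ab by (auto simp: t_def field_simps)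
  ultimately show ?thesis using that[of "(1 - t) *\<^sub>R x + t *\<^sub>R y"] by (auto simp: in_segment)
qed

text \<open>Cutting an inscribed polygon along a chord between two vertices leaves the polygon of
  the vertices on either side. The points of the disk that are in the smaller hull or not strictly
  on the positive side form a convex set containing \<open>V\<close>.\<close>

lemma convex_hull_one_side:
  assumes V: "V \<subseteq> circle" and pq: "p \<in> V" "q \<in> V" "p \<noteq> q"
    and w: "w \<in> convex hull V" "side p q w > 0"
  shows "w \<in> convex hull {v \<in> V. side p q v \<ge> 0}"
proof -
  let ?V = "{v \<in> V. side p q v \<ge> 0}"
  have pqc: "p \<in> circle" "q \<in> circle" using pq V by auto
  have pqV: "seg p q \<subseteq> convex hull ?V"
    using pq by (simp add: closed_segment_subset_convex_hull hull_inc)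
  \<comment> \<open>The bound on the norm ensures that a point of the line through \<open>p\<close>
    and \<open>q\<close> lies on the chord itself.\<close>
  define K where "K = {x. norm x \<le> rad \<and> (side p q x > 0 \<longrightarrow> x \<in> convex hull ?V)}"
  have *: "z \<in> convex hull ?V"
    if x: "x \<in> K" "side p q x > 0" and y: "y \<in> K" and z: "z \<in> closed_segment x y" "side p q z > 0" for x y z
  proof (cases "side p q y > 0")
    case True
    then show ?thesis using x y z convex_convex_hull[of ?V] unfolding K_def convex_contains_segment by blast
  next
    case False
    then obtain z0 where z0: "z0 \<in> closed_segment x y" "side p q z0 = 0"
      using side_zero_exists[OF x(2), of y] by (metis not_less)
    have "norm x \<le> rad" "norm y \<le> rad" using x y by (auto simp: K_def)
    then have "x \<in> cball 0 rad" "y \<in> cball 0 rad" by simp_all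
    then have "z0 \<in> cball 0 rad" using z0 convex_cball[of "0::point" rad] unfolding convex_contains_segment by blast
    then have "z0 \<in> convex hull ?V" using on_line_in_segment[OF pqc pq(3) z0(2)] pqV by auto
    moreover have "x \<in> convex hull ?V" using x by (auto simp: K_def)
    moreover have "z \<in> closed_segment x z0"
    proof (rule ccontr)
      assume "z \<notin> closed_segment x z0"
      then have "z \<in> closed_segment z0 y" using Un_closed_segment[OF z0(1)] z by auto
      then show False using side_closed_between[of z z0 y p q] z0 False z by auto
    qed
    ultimately show ?thesis using convex_convex_hull[of ?V] unfolding convex_contains_segment by blast
  qed
  have "convex K" unfolding convex_contains_segment
  proof (intro ballI subsetI)
    fix x y z assume xyz: "x \<in> K" "y \<in> K" "z \<in> closed_segment x y"
    then have "norm x \<le> rad" "norm y \<le> rad" by (auto simp: K_def)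
    then have "x \<in> cball 0 rad" "y \<in> cball 0 rad" by simp_all
    then have "z \<in> cball 0 rad" using xyz(3) convex_cball[of "0::point" rad] unfolding convex_contains_segment by blast
    then have "norm z \<le> rad" by simp
    moreover have "z \<in> convex hull ?V" if "side p q z > 0"
    proof -
      have "side p q x > 0 \<or> side p q y > 0" using side_closed_between[OF xyz(3), of p q] that by auto
      then show ?thesis using *[of x y z] *[of y x z] xyz that by (auto simp: closed_segment_commute)
    qed
    ultimately show "z \<in> K" by (simp add: K_def)
  qed
  moreover have "V \<subseteq> K" using V by (auto simp: K_def mem_circle hull_inc)
  ultimately have "convex hull V \<subseteq> K" by (simp add: hull_minimal)
  then show ?thesis using w by (auto simp: K_def)
qed

lemma card_4E:
  assumes "card W = 4" obtains a b c d where "W = {a, b, c, d}" "distinct [a, b, c, d]"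
  using assms by (auto simp: card_Suc_eq numeral_eq_Suc)

lemma pairs_of_three_meet:
  assumes "x \<in> {a, b, c}" "y \<in> {a, b, c}" "x \<noteq> y" "r \<in> {a, b, c}" "s \<in> {a, b, c}" "r \<noteq> s"
  shows "r = x \<or> r = y \<or> s = x \<or> s = y"
  using assms by auto

text \<open>\<open>D\<close> is a maximal noncrossing set of chords of the inscribed polygon
  \<open>V\<close>, sides included. Induction on the number of vertices: a chord with vertices on
  both sides cuts off a smaller polygon containing \<open>w\<close>, and a polygon without such a
  chord has at most three vertices.\<close>

lemma polygon_triangulated:
  assumes "finite V" "V \<subseteq> circle"
    and "\<And>d. d \<in> D \<Longrightarrow> \<exists>p\<in>V. \<exists>q\<in>V. p \<noteq> q \<and> d = seg p q"
    and "noncrossing disk D"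
    and "\<And>p q. p \<in> V \<Longrightarrow> q \<in> V \<Longrightarrow> p \<noteq> q \<Longrightarrow> \<forall>d\<in>D. \<not> crosses (seg p q) d \<Longrightarrow> seg p q \<in> D"
    and "w \<in> convex hull V" "w \<in> disk" "w \<notin> \<Union>D"
  shows "\<exists>a\<in>V. \<exists>b\<in>V. \<exists>c\<in>V. distinct [a, b, c] \<and> seg a b \<in> D \<and> seg b c \<in> D \<and> seg c a \<in> D \<and>
     w \<in> interior (convex hull {a, b, c})"
  using assms
proof (induction "card V" arbitrary: V D rule: less_induct)
  case (less V D)
  note V = less.prems(1,2) and D = less.prems(3) and nc = less.prems(4) and mx = less.prems(5) and w = less.prems(6-8)
  have wnorm: "norm w \<le> rad" using w by (simp add: mem_disk)
  show ?case
  proof (cases "\<exists>p\<in>V. \<exists>q\<in>V. p \<noteq> q \<and> seg p q \<in> D \<and> (\<exists>v\<in>V. side p q v > 0) \<and> (\<exists>v\<in>V. side p q v < 0)")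
    case True
    then obtain p0 q0 where pq0: "p0 \<in> V" "q0 \<in> V" "p0 \<noteq> q0" "seg p0 q0 \<in> D" "\<exists>v\<in>V. side p0 q0 v > 0" "\<exists>v\<in>V. side p0 q0 v < 0"
      by blast
    have "side p0 q0 w \<noteq> 0" using on_line_in_segment[of p0 q0 w] pq0 V w wnorm by auto
    \<comment> \<open>The cutting chord is oriented so that \<open>w\<close> is on its positive
      side.\<close>
    then obtain p q where pq: "p \<in> V" "q \<in> V" "p \<noteq> q" "seg p q \<in> D" "\<exists>v\<in>V. side p q v < 0" "side p q w > 0"
    proof (cases "side p0 q0 w > 0")
      case False
      then have "side q0 p0 w > 0" using \<open>side p0 q0 w \<noteq> 0\<close> side_swap[of q0 p0 w] by auto
      moreover have "\<exists>v\<in>V. side q0 p0 v < 0" using pq0(5) side_swap[of q0 p0] by auto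
      ultimately show ?thesis using that[of q0 p0] pq0 closed_segment_commute[of q0 p0] by auto
    qed (use that pq0 in blast)
    have pqc: "p \<in> circle" "q \<in> circle" using pq V by auto
    define V' where "V' = {v \<in> V. side p q v \<ge> 0}"
    define D' where "D' = {d \<in> D. \<exists>p\<in>V'. \<exists>q\<in>V'. p \<noteq> q \<and> d = seg p q}"
    have V'V: "V' \<subseteq> V" by (auto simp: V'_def)
    have pqV': "p \<in> V'" "q \<in> V'" using pq by (auto simp: V'_def)
    have "V' \<subset> V" using pq(5) unfolding V'_def by force
    then have "card V' < card V" using V by (simp add: psubset_card_mono)
    then have "\<exists>a\<in>V'. \<exists>b\<in>V'. \<exists>c\<in>V'. distinct [a, b, c] \<and> seg a b \<in> D' \<and> seg b c \<in> D' \<and> seg c a \<in> D' \<and>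
     w \<in> interior (convex hull {a, b, c})"
    proof (rule less.hyps)
      show "finite V'" "V' \<subseteq> circle" using V V'V finite_subset by auto
      show "\<exists>p\<in>V'. \<exists>q\<in>V'. p \<noteq> q \<and> d = seg p q" if "d \<in> D'" for d using that unfolding D'_def by blast
      show "noncrossing disk D'" using nc noncrossing_subset[of disk D D'] unfolding D'_def by blast
      show "w \<in> convex hull V'" unfolding V'_def using convex_hull_one_side pq V w by blast
      show "w \<in> disk" by fact
      show "w \<notin> \<Union>D'" using w unfolding D'_def by blast
      fix u v assume uv: "u \<in> V'" "v \<in> V'" "u \<noteq> v" "\<forall>d\<in>D'. \<not> crosses (seg u v) d"
      \<comment> \<open>Maximality passes to \<open>D'\<close>: an arc of \<open>D\<close> outside
        \<open>D'\<close> has its ends on the closed negative side and its interior strictly on that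
        side, whereas the chord from \<open>u\<close> to \<open>v\<close> stays on the nonnegative
        side.\<close>
      have "\<not> crosses (seg u v) d" if "d \<in> D" for d
      proof
        assume cr: "crosses (seg u v) d"
        obtain r s where rs: "r \<in> V" "s \<in> V" "r \<noteq> s" "d = seg r s" using D \<open>d \<in> D\<close> by blast
        have "d \<notin> D'" using cr uv by blast
        then have nV': "\<not> (r \<in> V' \<and> s \<in> V')" using rs \<open>d \<in> D\<close> unfolding D'_def by blast
        have c: "u \<in> circle" "v \<in> circle" "r \<in> circle" "s \<in> circle" using uv rs V V'V by auto
        have "\<not> crosses (seg p q) d" using nc pq(4) \<open>d \<in> D\<close> by (auto simp: noncrossing_disk_iff)
        then have "\<not> side p q r * side p q s < 0" using crosses_iff[of p q r s] pqc pq(3) c rs by simp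
        then have neg: "side p q r \<le> 0" "side p q s \<le> 0" "side p q r < 0 \<or> side p q s < 0"
          using nV' rs unfolding V'_def by (auto simp: mult_less_0_iff not_le)
        have pos: "side p q u \<ge> 0" "side p q v \<ge> 0" using uv by (auto simp: V'_def)
        obtain x where x: "x \<in> seg u v" "x \<in> seg r s" "x \<in> disk" using cr rs by (auto simp: crosses_def)
        have x': "x \<in> open_segment r s" using x c closed_segment_Int_disk by blast
        have "side p q x \<ge> 0" using side_closed_between[OF x(1), of p q] pos by auto
        moreover have "side p q x < 0"
        proof (cases "side p q r" "side p q s" rule: linorder_cases)
          case less
          then show ?thesis using side_between(2)[OF x', of p q] neg by auto
        next
          case equal
          then show ?thesis using side_between(1)[OF x', of p q] neg by auto
        next
          case greater
          have "x \<in> open_segment s r" using x' by (simp add: open_segment_commute)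
          then show ?thesis using side_between(2)[of x s r p q] greater neg by auto
        qed
        ultimately show False by simp
      qed
      then have "seg u v \<in> D" using mx[of u v] uv V'V by blast
      then show "seg u v \<in> D'" using uv unfolding D'_def by blast
    qed
    then show ?thesis using V'V unfolding D'_def by blast
  next
    case False
    \<comment> \<open>Among four vertices two chords cross. Either the first belongs to
      \<open>D\<close> and separates the ends of the second, or by maximality an arc of
      \<open>D\<close> crosses it and separates its ends; both contradict the case
      assumption.\<close>
    have "card V < 4"
    proof (rule ccontr)
      assume "\<not> card V < 4"
      then obtain W where W: "W \<subseteq> V" "card W = 4" by (meson not_less obtain_subset_with_card_n)
      obtain a b c d where W4: "W = {a, b, c, d}" "distinct [a, b, c, d]"
        using W(2) by (rule card_4E)
      have abcd: "{a, b, c, d} \<subseteq> V" using W(1) unfolding W4(1) .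
      have "\<exists>x y z t. {x, y, z, t} \<subseteq> V \<and> distinct [x, y, z, t] \<and> crosses (seg x y) (seg z t)"
        using pairings_cross[OF subset_trans[OF abcd V(2)] W4(2)]
      proof (elim disjE)
        assume "crosses (seg a b) (seg c d)"
        then show ?thesis using abcd W4(2) by metis
      next
        assume "crosses (seg a c) (seg b d)"
        moreover have "{a, c, b, d} \<subseteq> V" "distinct [a, c, b, d]" using abcd W4(2) by auto
        ultimately show ?thesis by metis
      next
        assume "crosses (seg a d) (seg b c)"
        moreover have "{a, d, b, c} \<subseteq> V" "distinct [a, d, b, c]" using abcd W4(2) by auto
        ultimately show ?thesis by metis
      qed
      then obtain x y z t where xy: "{x, y, z, t} \<subseteq> V" "distinct [x, y, z, t]" "crosses (seg x y) (seg z t)" by blast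
      have xV: "x \<in> V" "y \<in> V" "z \<in> V" "t \<in> V" using xy(1) by simp_all
      have xd: "x \<noteq> y" "z \<noteq> t" using xy(2) by simp_all
      have split: False if "seg p q \<in> D" "p \<in> V" "q \<in> V" "p \<noteq> q" "crosses (seg p q) (seg u v)" "u \<in> V" "v \<in> V" "u \<noteq> v" for p q u v
      proof -
        have "side p q u * side p q v < 0"
          using that(5) crosses_iff[OF subsetD[OF V(2) that(2)] subsetD[OF V(2) that(3)] that(4)
              subsetD[OF V(2) that(6)] subsetD[OF V(2) that(7)] that(8)] by blast
        then have "(\<exists>v\<in>V. side p q v > 0) \<and> (\<exists>v\<in>V. side p q v < 0)"
          using that(6,7) unfolding mult_less_0_iff by blast
        then show False using that(1-4) False by blast
      qed
      show False
      proof (cases "seg x y \<in> D")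
        case True
        then show False using split[of x y z t] xV xd xy(3) by blast
      next
        case False
        then obtain d where d: "d \<in> D" "crosses (seg x y) d" using mx[OF xV(1,2) xd(1)] by blast
        then obtain p q where "p \<in> V" "q \<in> V" "p \<noteq> q" "d = seg p q" using D by blast
        then show False using split[of p q x y] d xV xd crosses_sym by metis
      qed
    qed
    then consider "card V = 0" | "card V = 1" | "card V = 2" | "card V = 3" by linarith
    then show ?thesis
    proof cases
      case 1
      then show ?thesis using V w by simp
    next
      case 2
      then obtain a where "V = {a}" by (auto simp: card_1_singleton_iff)
      then show ?thesis using V w circle_disjoint_disk by auto
    next
      case 3
      then obtain a b where ab: "V = {a, b}" "a \<noteq> b" by (auto simp: card_2_iff)
      have "\<not> crosses (seg a b) d" if dD: "d \<in> D" for d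
      proof -
        obtain r s where rs: "r \<in> {a, b}" "s \<in> {a, b}" "r \<noteq> s" "d = seg r s" using D[OF dD] ab by blast
        then have "d = seg a b" by (metis closed_segment_commute insertE singletonD)
        then show ?thesis by simp
      qed
      then have "seg a b \<in> D" using mx[of a b] ab by blast
      then show ?thesis using w ab by (auto simp: segment_convex_hull[symmetric])
    next
      case 4
      then obtain a b c where abc: "V = {a, b, c}" "a \<noteq> b" "b \<noteq> c" "a \<noteq> c" unfolding card_3_iff by blast
      have cc: "a \<in> circle" "b \<in> circle" "c \<in> circle" using abc V by auto
      \<comment> \<open>Any two chords between three points share an end, so maximality puts every
        side into \<open>D\<close>.\<close>
      have sides: "seg x y \<in> D" if xy: "x \<in> V" "y \<in> V" "x \<noteq> y" for x y
      proof -
        have "\<not> crosses (seg x y) d" if dD: "d \<in> D" for d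
        proof -
          obtain r s where rs: "r \<in> V" "s \<in> V" "r \<noteq> s" "d = seg r s" using D dD by blast
          have "r = x \<or> r = y \<or> s = x \<or> s = y"
            using pairs_of_three_meet[of x a b c y r s] xy rs(1-3) unfolding abc(1) by simp
          then have "side x y r * side x y s = 0" by (elim disjE) simp_all
          moreover have "x \<in> circle" "y \<in> circle" "r \<in> circle" "s \<in> circle"
            by (rule subsetD[OF V(2)], fact)+
          ultimately show ?thesis using crosses_iff[of x y r s] xy(3) rs(3,4) by (simp only: less_irrefl not_False_eq_True)
        qed
        then show ?thesis using mx xy by blast
      qed
      have "compact (convex hull V)" using V by (simp add: compact_convex_hull finite_imp_compact)
      then have "w \<in> interior (convex hull V) \<or> w \<in> frontier (convex hull V)"
        using w(1) by (auto simp: frontier_def compact_imp_closed)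
      moreover have "w \<notin> frontier (convex hull V)"
        unfolding abc(1) using frontier_of_triangle[of a b c] sides[of a b] sides[of b c] sides[of c a] abc w by auto
      ultimately show ?thesis unfolding abc(1) using sides[of a b] sides[of b c] sides[of c a] abc by auto
    qed
  qed
qed

section \<open>Density of the dyadic points\<close>

lemma dyadic_between:
  assumes "a < b" obtains m :: int and n where "n \<ge> N" "a < of_int m / 2 ^ n" "of_int m / 2 ^ n < (b::real)"
proof -
  have "(\<lambda>n. (1/2) ^ n :: real) \<longlonglongrightarrow> 0" by (rule LIMSEQ_power_zero) simp
  then have "\<forall>\<^sub>F n in sequentially. (1/2) ^ n < b - a" using assms by (intro order_tendstoD(2)) auto
  then obtain n0 where n0: "\<And>n. n \<ge> n0 \<Longrightarrow> (1/2::real) ^ n < b - a" by (auto simp: eventually_sequentially)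
  define n where "n = max n0 N"
  define m where "m = \<lfloor>a * 2 ^ n\<rfloor> + 1"
  have "1 / 2 ^ n < b - a" using n0[of n] by (simp add: n_def power_one_over)
  moreover have "a * 2 ^ n < of_int m" "of_int m \<le> a * 2 ^ n + 1" unfolding m_def by linarith+
  ultimately have "a < of_int m / 2 ^ n" "of_int m / 2 ^ n < b"
    by (auto simp: field_simps)
  then show ?thesis using that[of n m] by (simp add: n_def)
qed

lemma dyadics_dense:
  assumes "a < b" obtains x where "x \<in> dyadics" "a < x" "x < b"
  using dyadic_between[OF assms, of 0] dyadicsI by metis

lemma continuous_gam: "continuous_on S gam"
  unfolding gam_def by (intro continuous_intros) auto

lemma closure_dyadics: "closure dyadics = UNIV"
proof -
  have "\<exists>y\<in>dyadics. dist y x < e" if e: "e > 0" for x e :: real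
  proof -
    obtain y where "y \<in> dyadics" "x < y" "y < x + e" using dyadics_dense[of x "x + e"] e by auto
    then show ?thesis by (intro bexI[of _ y]) (auto simp: dist_real_def)
  qed
  then show ?thesis by (auto simp: closure_approachable)
qed

lemma closure_dyadic_points: "closure dyadic_points = circle"
proof -
  have "gam ` closure dyadics \<subseteq> closure (gam ` dyadics)"
    by (rule image_closure_subset[OF continuous_gam]) (auto intro: closure_subset[THEN subsetD])
  moreover have "gam ` dyadics \<subseteq> dyadic_points" using gam_mem_dyadic_points_iff by auto
  ultimately have "circle \<subseteq> closure dyadic_points"
    unfolding closure_dyadics circle_eq_gam using closure_mono by blast
  moreover have "closure dyadic_points \<subseteq> circle"
    using dyadic_points_circle by (intro closure_minimal) (auto simp: circle_def)
  ultimately show ?thesis by blast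
qed

text \<open>The dyadic points are dense in the circle, so the closure of their hull is the closed
  disk. A convex set has the same interior as its closure, hence \<open>w\<close> is in the hull
  itself, and by Caratheodory in the hull of finitely many points, which have a common
  level.\<close>

lemma disk_in_hull_Lev:
  assumes "w \<in> disk" obtains N where "\<And>n. n \<ge> N \<Longrightarrow> w \<in> convex hull (Lev n)"
proof -
  have "cball 0 rad = convex hull circle"
    using Krein_Milman_frontier[of "cball (0::point) rad"] by (simp add: circle_def zero_prod_def)
  also have "\<dots> \<subseteq> closure (convex hull dyadic_points)"
  proof (rule hull_minimal)
    show "circle \<subseteq> closure (convex hull dyadic_points)"
      using closure_dyadic_points closure_mono[of dyadic_points "convex hull dyadic_points"] hull_subset[of dyadic_points convex] by auto
  qed (simp add: convex_closure)
  finally have "interior (cball 0 rad) \<subseteq> interior (closure (convex hull dyadic_points))"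
    by (rule interior_mono)
  also have "\<dots> = interior (convex hull dyadic_points)" by (rule convex_interior_closure) simp
  finally have "w \<in> convex hull dyadic_points" using assms interior_subset by (force simp: mem_disk)
  then obtain S where S: "finite S" "S \<subseteq> dyadic_points" "w \<in> convex hull S"
    unfolding caratheodory[of dyadic_points] by blast
  have "\<exists>N. S \<subseteq> Lev N" using S(1,2)
  proof (induction S rule: finite_induct)
    case (insert p F)
    then obtain N where N: "F \<subseteq> Lev N" by auto
    obtain k where "p \<in> Lev k" using insert by (auto simp: dyadic_points_eq)
    then have "insert p F \<subseteq> Lev (max N k)"
      using N Lev_mono[of N "max N k"] Lev_mono[of k "max N k"] by auto
    then show ?case by blast
  qed auto
  then obtain N where "S \<subseteq> Lev N" by blast
  then have "w \<in> convex hull (Lev n)" if "n \<ge> N" for n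
    using S(3) Lev_mono[OF that] hull_mono[of S "Lev n" convex] by blast
  then show ?thesis using that by blast
qed

lemma not_collinear_circle:
  assumes "a \<in> circle" "b \<in> circle" "c \<in> circle" "distinct [a, b, c]"
  shows "\<not> collinear {a, b, c}"
  unfolding collinear_between_cases between_mem_segment
  using assms closed_segment_Int_circle[of b c] closed_segment_Int_circle[of c a] closed_segment_Int_circle[of a b] by auto

text \<open>The triangles are the inscribed ones with all three sides in \<open>A\<close>. That they
  cover the complement of the arcs is checked point by point, in a regular polygon of a level so
  high that the remaining arcs do not interfere.\<close>

lemma maxtess_triangulates:
  assumes "maxtess A" shows "triangulates A"
proof -
  have A: "A \<subseteq> dyadic_arcs" "noncrossing disk A" "finite (A - A_F)"
    using assms by (auto simp: maxtess_def tess_def)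
  define \<T> where "\<T> = {interior (convex hull {a, b, c}) | a b c. {a, b, c} \<subseteq> circle \<and> distinct [a, b, c] \<and>
     seg a b \<in> A \<and> seg b c \<in> A \<and> seg c a \<in> A}"
  have T1: "open_triangle T" if "T \<in> \<T>" for T
    using that not_collinear_circle unfolding \<T>_def open_triangle_def by blast
  have conn: "connected T" if "T \<in> \<T>" for T
    using that unfolding \<T>_def by (auto intro!: convex_connected convex_interior)
  have fr: "frontier T \<subseteq> \<Union>A" if T: "T \<in> \<T>" for T
  proof -
    obtain a b c where abc: "T = interior (convex hull {a, b, c})" "seg a b \<in> A" "seg b c \<in> A" "seg c a \<in> A"
      using T unfolding \<T>_def by blast
    have "frontier T \<subseteq> frontier (convex hull {a, b, c})" unfolding abc(1) by (rule frontier_interior_subset)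
    then show ?thesis using frontier_of_triangle[of a b c] abc by auto
  qed
  have T2: "T \<subseteq> disk - \<Union>A" if T: "T \<in> \<T>" for T
  proof -
    obtain a b c where abc: "T = interior (convex hull {a, b, c})" "{a, b, c} \<subseteq> circle" "distinct [a, b, c]"
      "seg a b \<in> A" "seg b c \<in> A" "seg c a \<in> A"
      using T unfolding \<T>_def by blast
    have H: "convex hull {a, b, c} \<subseteq> cball 0 rad" using convex_hull_circle abc by blast
    have "T \<subseteq> interior (cball 0 rad)" unfolding abc(1) using H by (rule interior_mono)
    then have Td: "T \<subseteq> disk" by (auto simp: mem_disk)
    \<comment> \<open>An arc through an interior point of the triangle cannot cross the sides, so it
      would lie wholly inside.\<close>
    moreover have False if w: "w \<in> T" "w \<in> d" "d \<in> A" for w d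
    proof -
      obtain p q where pq: "d = seg p q" "p \<in> circle" "q \<in> circle" "p \<noteq> q"
        using A(1) w dyadic_points_circle unfolding dyadic_arcs_def by blast
      have "w \<in> open_segment p q" using w Td pq closed_segment_Int_disk by blast
      have frT: "frontier (convex hull {a, b, c}) = seg a b \<union> seg b c \<union> seg c a" by (simp add: frontier_of_triangle)
      have disj: "frontier (convex hull {a, b, c}) \<inter> T = {}" unfolding abc(1) by (auto simp: frontier_def)
      have "open_segment p q \<inter> e = {}" if "e \<in> {seg a b, seg b c, seg c a}" for e
      proof -
        have "e \<in> A" using that abc by auto
        have "e \<subseteq> frontier (convex hull {a, b, c})" using that frT by auto
        then have "d \<noteq> e" using disj w by blast
        then have "d \<inter> e \<inter> disk = {}" using A(2) \<open>e \<in> A\<close> w by (auto simp: noncrossing_disk_iff crosses_def)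
        then show ?thesis using open_segment_in_disk[OF pq(2,3)] open_closed_segment unfolding pq(1) by blast
      qed
      then have "open_segment p q \<inter> frontier (convex hull {a, b, c}) = {}" unfolding frT by blast
      then have "open_segment p q \<subseteq> convex hull {a, b, c}"
        using connected_Int_frontier[OF convex_connected[OF convex_open_segment[of p q]], of "convex hull {a, b, c}"] \<open>w \<in> open_segment p q\<close>
          interior_subset[of "convex hull {a, b, c}"] w(1) unfolding abc(1) by blast
      then have "open_segment p q \<subseteq> interior (convex hull {a, b, c})"
        using \<open>open_segment p q \<inter> frontier (convex hull {a, b, c}) = {}\<close> closure_subset unfolding frontier_def by blast
      then show False using no_chord_in_triangle H pq by blast
    qed
    ultimately show ?thesis by blast
  qed
  have T3: "disk - \<Union>A \<subseteq> \<Union>\<T>"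
  proof
    fix w assume w: "w \<in> disk - \<Union>A"
    obtain N1 where N1: "\<And>n. n \<ge> N1 \<Longrightarrow> w \<in> convex hull (Lev n)" using disk_in_hull_Lev w by blast
    obtain N2 where N2: "A - A_F \<subseteq> larcs N2" using finite_dyadic_arcs_level A by (metis Diff_subset subset_trans)
    \<comment> \<open>Beyond level \<open>N\<close> the family \<open>A\<close> consists of standard
      arcs, and these do not cross chords of level \<open>N\<close>. So \<open>D\<close> is a
      maximal noncrossing set of chords of the polygon.\<close>
    define N where "N = max N1 N2"
    define D where "D = A \<inter> larcs N"
    have DN: "A - D \<subseteq> {sarc n m | n m. 1 \<le> n \<and> N \<le> n}"
    proof
      fix d assume d: "d \<in> A - D"
      then have "d \<notin> larcs N" by (simp add: D_def)
      then have "d \<notin> larcs N2" using larcs_mono[of N2 N] by (auto simp: N_def)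
      then have "d \<in> A_F" using d N2 by blast
      then obtain n m where nm: "d = sarc n m" "n \<ge> 1" unfolding A_F_eq by blast
      then have "\<not> n \<le> N" using \<open>d \<notin> larcs N\<close> sarc_larcs larcs_mono by blast
      then show "d \<in> {sarc n m | n m. 1 \<le> n \<and> N \<le> n}" using nm by auto
    qed
    have "\<exists>a\<in>Lev N. \<exists>b\<in>Lev N. \<exists>c\<in>Lev N. distinct [a, b, c] \<and> seg a b \<in> D \<and> seg b c \<in> D \<and> seg c a \<in> D \<and>
     w \<in> interior (convex hull {a, b, c})"
    proof (rule polygon_triangulated)
      show "finite (Lev N)" by (rule finite_Lev)
      show "Lev N \<subseteq> circle" using Lev_circle by blast
      show "\<exists>p\<in>Lev N. \<exists>q\<in>Lev N. p \<noteq> q \<and> d = seg p q" if "d \<in> D" for d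
        using that unfolding D_def larcs_def by blast
      show "noncrossing disk D" using A noncrossing_subset[of disk A D] by (simp add: D_def)
      show "w \<in> convex hull Lev N" using N1 by (simp add: N_def)
      show "w \<in> disk" "w \<notin> \<Union>D" using w by (auto simp: D_def)
      fix p q assume pq: "p \<in> Lev N" "q \<in> Lev N" "p \<noteq> q" "\<forall>d\<in>D. \<not> crosses (seg p q) d"
      have l: "seg p q \<in> larcs N" using pq unfolding larcs_def by blast
      have "\<not> crosses (seg p q) d" if dA: "d \<in> A" for d
      proof (cases "d \<in> D")
        case False
        then obtain n m where "d = sarc n m" "1 \<le> n" "N \<le> n" using DN dA by blast
        then show ?thesis using sarc_not_crosses_larcs[of n N "seg p q" m] l crosses_sym by blast
      qed (use pq in blast)
      then have "seg p q \<in> A" using assms larcs_dyadic_arcs[OF l] unfolding maxtess_def by blast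
      then show "seg p q \<in> D" using l by (simp add: D_def)
    qed
    then obtain a b c where abc: "a \<in> Lev N" "b \<in> Lev N" "c \<in> Lev N" "distinct [a, b, c]" "seg a b \<in> A" "seg b c \<in> A" "seg c a \<in> A"
     "w \<in> interior (convex hull {a, b, c})" unfolding D_def by blast
    then have "interior (convex hull {a, b, c}) \<in> \<T>" using Lev_circle unfolding \<T>_def by blast
    then show "w \<in> \<Union>\<T>" using abc by blast
  qed
  \<comment> \<open>Triangles that meet are equal: a connected \<open>S\<close> that meets
    \<open>T\<close> without being contained in it would meet the frontier of \<open>T\<close>,
    which consists of arcs.\<close>
  have sub: "S \<subseteq> T" if "S \<in> \<T>" "T \<in> \<T>" "S \<inter> T \<noteq> {}" for S T
    using connected_Int_frontier[OF conn[OF that(1)] that(3)] fr[OF that(2)] T2[OF that(1)] by blast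
  have "disjoint \<T>" unfolding disjoint_def using sub by blast
  then show ?thesis unfolding triangulates_def using T1 T2 T3
    by (intro exI[of _ \<T>]) blast
qed

text \<open>Both directions rest on \<open>triangulates_no_extra\<close>: an arc compatible with a
  triangulation belongs to it, and after removal of \<open>a\<close> the arc \<open>a\<close> itself
  would be an extra one.\<close>

lemma F_triangulation_iff: "F_triangulation A \<longleftrightarrow> maxtess A"
proof
  assume A: "F_triangulation A"
  then have "tess A" by (simp add: F_triangulation_def tess_def)
  moreover have "d \<in> A" if d: "d \<in> dyadic_arcs" "\<forall>b\<in>A. \<not> crosses d b" for d
  proof (rule ccontr)
    assume "d \<notin> A"
    obtain p q where "d = seg p q" "p \<in> circle" "q \<in> circle" "p \<noteq> q"
      using d dyadic_points_circle unfolding dyadic_arcs_def by blast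
    then show False using triangulates_no_extra[of A p q] A d \<open>d \<notin> A\<close> unfolding F_triangulation_def by blast
  qed
  ultimately show "maxtess A" by (simp add: maxtess_def)
next
  assume A: "maxtess A"
  have "\<not> triangulates (A - {a})" if a: "a \<in> A" for a
  proof
    assume t: "triangulates (A - {a})"
    have a': "a \<in> dyadic_arcs" using A a by (auto simp: maxtess_def tess_def)
    obtain p q where "a = seg p q" "p \<in> circle" "q \<in> circle" "p \<noteq> q"
      using a' dyadic_points_circle unfolding dyadic_arcs_def by blast
    moreover have "\<not> crosses a b" if "b \<in> A - {a}" for b
      using that a A by (auto simp: maxtess_def tess_def noncrossing_disk_iff)
    ultimately show False using triangulates_no_extra[OF t, of p q] by blast
  qed
  then show "F_triangulation A"
    using A maxtess_triangulates[OF A] by (auto simp: F_triangulation_def maxtess_def tess_def)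
qed

lemma F_tessellations_eq: "F_tessellations = Collect tess"
proof (intro equalityI subsetI CollectI)
  fix B assume "B \<in> F_tessellations"
  then obtain A K where "B = A - K" "maxtess A" "finite K" by (auto simp: F_tessellations_def F_triangulation_iff)
  then show "tess B" using tess_Diff by (simp add: maxtess_def)
next
  fix B assume "B \<in> Collect tess"
  then have B: "tess B" by simp
  then obtain A where A: "B \<subseteq> A" "maxtess A" by (rule tess_extend)
  then have "B = A - (A - B)" "finite (A - B)" using tess_finite_Diff B by (auto simp: maxtess_def)
  then show "B \<in> F_tessellations" unfolding F_tessellations_def F_triangulation_iff using A by blast
qed

section \<open>Inclusions of closed cells\<close>

lemma dyadic_arcE:
  assumes "d \<in> dyadic_arcs"
  obtains p q where "d = seg p q" "p \<in> dyadic_points" "q \<in> dyadic_points" "p \<in> circle" "q \<in> circle" "p \<noteq> q"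
  using assms dyadic_points_circle unfolding dyadic_arcs_def by blast

lemma tess_dyadic_arcs: "tess A \<Longrightarrow> d \<in> A \<Longrightarrow> d \<in> dyadic_arcs"
  unfolding tess_def by blast

lemma tess_not_crosses: "tess A \<Longrightarrow> d \<in> A \<Longrightarrow> d' \<in> A \<Longrightarrow> \<not> crosses d d'"
  unfolding tess_def noncrossing_disk_iff by blast

lemma piece_subset: "Q \<in> pieces U A \<Longrightarrow> Q \<subseteq> U - \<Union>A"
  unfolding pieces_def by (rule in_components_subset)

lemma piece_closure: "Q \<in> pieces disk A \<Longrightarrow> closure Q \<subseteq> cball 0 rad"
  using piece_subset[of Q disk A] by (intro closure_minimal) (auto simp: mem_disk less_imp_le)

lemma midpoint_not_extreme:
  assumes "v extreme_point_of S" "v - z \<in> S" "v + z \<in> S" shows "z = 0"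
proof (rule ccontr)
  assume "z \<noteq> 0"
  then have "v - z \<noteq> v + z" by (metis add_diff_cancel_left' add_diff_cancel_right' add_0 diff_0 diff_add_cancel eq_neg_iff_add_eq_0 group_cancel.sub1 real_vector.scale_eq_0_iff scaleR_2 zero_neq_numeral)
  moreover have "v = midpoint (v - z) (v + z)" by (simp add: midpoint_def scaleR_2[symmetric])
  ultimately have "v \<in> open_segment (v - z) (v + z)" by (metis midpoint_in_open_segment)
  then show False using assms unfolding extreme_point_of_def by blast
qed

text \<open>Near a boundary point inside the disk a piece contains an open half disk whose diameter lies on
  an arc, so the point is the midpoint of a segment in the closure of the piece.\<close>

lemma tess_vertices_circle:
  assumes A: "tess A" and Q: "Q \<in> pieces disk A" and v: "v \<in> vertices Q"
  shows "v \<in> circle"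
proof (rule ccontr)
  assume nc: "v \<notin> circle"
  have ext: "v extreme_point_of closure Q" using v by (simp add: vertices_def)
  then have vQ: "v \<in> closure Q" by (simp add: extreme_point_of_def)
  then have "norm v \<le> rad" using piece_closure[OF Q] by auto
  then have vd: "v \<in> disk" using nc by (simp add: mem_disk mem_circle)
  have "finite (A - A_F)" using A by (simp add: tess_def)
  then obtain e0 where e0: "e0 > 0" "ball v e0 \<subseteq> disk" "finite {d \<in> A. d \<inter> ball v e0 \<noteq> {}}"
    using tess_locally_finite[OF _ vd] by blast
  \<comment> \<open>Arcs that meet the ball without passing through \<open>v\<close> are finitely
    many closed sets, so a smaller ball meets only arcs through \<open>v\<close>.\<close>
  define G where "G = {d \<in> A. d \<inter> ball v e0 \<noteq> {} \<and> v \<notin> d}"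
  have "finite G" using e0(3) by (rule rev_finite_subset) (auto simp: G_def)
  moreover have "closed d" if "d \<in> G" for d
    using that dyadic_arcE[of d] tess_dyadic_arcs[OF A] unfolding G_def by (metis (lifting) closed_segment mem_Collect_eq)
  ultimately have "closed (\<Union>G)" by (intro closed_Union) auto
  moreover have "v \<notin> \<Union>G" by (auto simp: G_def)
  ultimately obtain e1 where e1: "e1 > 0" "ball v e1 \<inter> \<Union>G = {}"
    by (metis (no_types, lifting) ComplI Int_commute disjoint_eq_subset_Compl open_Compl open_contains_ball)
  define e where "e = min e0 e1"
  have e: "e > 0" "ball v e \<subseteq> disk" "ball v e \<subseteq> ball v e0" "ball v e \<subseteq> ball v e1" using e0 e1 by (auto simp: e_def)
  have through: "v \<in> d" if "d \<in> A" "d \<inter> ball v e \<noteq> {}" for d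
  proof (rule ccontr)
    assume "v \<notin> d"
    then have "d \<in> G" using that e unfolding G_def by blast
    then show False using that e1 e by blast
  qed
  obtain x where x: "x \<in> Q" "x \<in> ball v e"
    using vQ e(1) unfolding closure_approachable by (auto simp: dist_commute)
  show False
  proof (cases "\<exists>d\<in>A. v \<in> d")
    case False
    then have "ball v e \<subseteq> disk - \<Union>A" using through e(2) by blast
    then have "ball v e \<subseteq> Q"
      using components_maximal[of Q "disk - \<Union>A" "ball v e"] Q x unfolding pieces_def by blast
    then have b: "ball v e \<subseteq> closure Q" using closure_subset by blast
    have "v - (e / 2, 0) \<in> ball v e" "v + (e / 2, 0) \<in> ball v e"
      using e(1) by (simp_all add: dist_norm norm_Pair)
    then have "(e / 2, 0) = (0 :: point)" using midpoint_not_extreme[OF ext] b by blast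
    then show False using e(1) by (simp add: zero_prod_def)
  next
    case True
    then obtain d where d: "d \<in> A" "v \<in> d" by blast
    \<comment> \<open>Two arcs through \<open>v\<close> would cross there.\<close>
    have uniq: "d' = d" if "d' \<in> A" "d' \<inter> ball v e \<noteq> {}" for d'
      using tess_not_crosses[OF A that(1) d(1)] through[OF that] d vd unfolding crosses_def by blast
    obtain p0 q0 where pq0: "d = seg p0 q0" "p0 \<in> circle" "q0 \<in> circle" "p0 \<noteq> q0"
      using dyadic_arcE[OF tess_dyadic_arcs[OF A d(1)]] by blast
    have xA: "x \<notin> \<Union>A" "x \<in> disk" using piece_subset[OF Q] x by blast+
    have "side p0 q0 x \<noteq> 0"
      using on_line_in_segment[OF pq0(2-4), of x] xA d pq0(1) by (auto simp: mem_disk)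
    then obtain p q where pq: "d = seg p q" "p \<in> circle" "q \<in> circle" "p \<noteq> q" "side p q x > 0"
    proof (cases "side p0 q0 x > 0")
      case False
      then have "side q0 p0 x > 0" using \<open>side p0 q0 x \<noteq> 0\<close> side_swap[of q0 p0 x] by linarith
      then show ?thesis using that[OF _ pq0(3,2)] pq0(1,4) closed_segment_commute[of p0 q0] by metis
    qed (rule that[OF pq0])
    define H where "H = {y \<in> ball v e. side p q y > 0}"
    have "convex {y. side p q y > 0}"
      unfolding convex_alt
    proof (intro ballI allI impI)
      fix a b u assume "a \<in> {y. side p q y > 0}" "b \<in> {y. side p q y > 0}" "0 \<le> u \<and> u \<le> (1 :: real)"
      then have "min (side p q a) (side p q b) > 0" "(1 - u) *\<^sub>R a + u *\<^sub>R b \<in> closed_segment a b"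
        by (simp, unfold in_segment, blast)
      then show "(1 - u) *\<^sub>R a + u *\<^sub>R b \<in> {y. side p q y > 0}"
        using side_closed_between[of "(1 - u) *\<^sub>R a + u *\<^sub>R b" a b p q] unfolding mem_Collect_eq by linarith
    qed
    moreover have "H = ball v e \<inter> {y. side p q y > 0}" unfolding H_def by blast
    ultimately have "convex H" by (simp only: convex_Int convex_ball)
    have "H \<inter> \<Union>A = {}"
    proof -
      have False if y: "y \<in> H" "y \<in> d'" "d' \<in> A" for y d'
      proof -
        have "d' = d" using uniq[OF y(3)] y(1,2) unfolding H_def by blast
        then have "side p q y = 0" using y(2) pq(1) side_on_segment by blast
        then show False using y(1) by (simp add: H_def)
      qed
      then show ?thesis by blast
    qed
    then have "H \<subseteq> disk - \<Union>A" using e(2) unfolding H_def by blast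
    moreover have xH: "x \<in> H" using x pq by (simp add: H_def)
    ultimately have HQ: "H \<subseteq> Q"
      using components_maximal[of Q "disk - \<Union>A" H] Q x convex_connected[OF \<open>convex H\<close>] unfolding pieces_def by blast
    have cl: "y \<in> closure Q" if y: "y \<in> ball v e" "side p q y = 0" for y
    proof -
      have "open_segment y x \<subseteq> H"
      proof
        fix z assume z: "z \<in> open_segment y x"
        have "z \<in> ball v e" using z y x convex_ball[of v e] unfolding convex_contains_open_segment by blast
        moreover have "side p q z > 0" using side_between(2)[OF z, of p q] y pq by simp
        ultimately show "z \<in> H" by (simp add: H_def)
      qed
      then have "closure (open_segment y x) \<subseteq> closure Q" using HQ by (intro closure_mono) blast
      moreover have "y \<noteq> x" using y pq by auto
      ultimately show ?thesis by auto
    qed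
    define z where "z = (e / (2 * norm (q - p))) *\<^sub>R (q - p)"
    have "norm z = e / 2" using e(1) pq(4) by (simp add: z_def)
    then have zb: "v - z \<in> ball v e" "v + z \<in> ball v e" using e(1) by (simp_all add: dist_norm)
    have "side p q v = 0" using d pq side_on_segment by blast
    moreover have "side p q (v + t *\<^sub>R (q - p)) = side p q v" for t
      by (simp add: side_def algebra_simps)
    from this[of "e / (2 * norm (q - p))"] this[of "- (e / (2 * norm (q - p)))"]
    have "side p q (v - z) = side p q v" "side p q (v + z) = side p q v" by (simp_all add: z_def)
    ultimately have "side p q (v - z) = 0" "side p q (v + z) = 0" by simp_all
    then have "z = 0" using midpoint_not_extreme[OF ext] cl zb by blast
    then show False using \<open>norm z = e / 2\<close> e(1) by simp
  qed
qed

lemma diagonal_piece: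
  assumes "tess A" "Q \<in> pieces disk A" "d \<in> diagonals Q"
  obtains x y where "d = seg x y" "x \<in> circle" "y \<in> circle" "x \<noteq> y" "open_segment x y \<subseteq> Q"
    "x \<in> closure Q" "y \<in> closure Q" "d \<inter> disk = open_segment x y" "midpoint x y \<in> Q" "midpoint x y \<in> d"
proof -
  obtain x y where xy: "d = seg x y" "x \<in> vertices Q" "y \<in> vertices Q" "x \<noteq> y" "open_segment x y \<subseteq> Q"
    using assms(3) unfolding diagonals_def by blast
  have c: "x \<in> circle" "y \<in> circle" using tess_vertices_circle assms xy by blast+
  have "x \<in> closure Q" "y \<in> closure Q" using xy by (auto simp: vertices_def extreme_point_of_def)
  moreover have "midpoint x y \<in> open_segment x y" using xy by simp
  ultimately show ?thesis
    using that[of x y] xy c closed_segment_Int_disk[OF c] open_closed_segment by blast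
qed

lemma diagonalI:
  assumes "Q \<in> pieces disk A" "x \<in> circle" "y \<in> circle" "x \<noteq> y" "open_segment x y \<subseteq> Q"
  shows "seg x y \<in> diagonals Q"
proof -
  have "closure (open_segment x y) \<subseteq> closure Q" using assms by (intro closure_mono)
  then have "x \<in> closure Q" "y \<in> closure Q" using assms by auto
  then have "x \<in> vertices Q" "y \<in> vertices Q"
    using extreme_on_circle[OF piece_closure[OF assms(1)]] assms by (auto simp: vertices_def)
  then show ?thesis using assms unfolding diagonals_def by blast
qed

text \<open>A consequence of \<open>no_chord_in_triangle\<close>: restricting weights to
  nontriangular pieces loses no diagonal.\<close>

lemma diagonal_not_triangle:
  assumes "tess A" "Q \<in> pieces disk A" "d \<in> diagonals Q"
  shows "Q \<in> nontriangular_pieces disk A"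
proof -
  have "\<not> open_triangle Q"
  proof
    assume "open_triangle Q"
    then obtain a b c where abc: "\<not> collinear {a, b, c}" "Q = interior (convex hull {a, b, c})"
      unfolding open_triangle_def by blast
    have "convex hull {a, b, c} \<subseteq> cball 0 rad"
      using triangle_hull_in_cball[OF abc(1)] piece_subset[OF assms(2)] unfolding abc(2) by blast
    moreover obtain x y where "x \<in> circle" "y \<in> circle" "x \<noteq> y" "open_segment x y \<subseteq> Q"
      using assms by (rule diagonal_piece)
    ultimately show False using no_chord_in_triangle unfolding abc(2) by blast
  qed
  then show ?thesis using assms by (simp add: nontriangular_pieces_def)
qed

text \<open>The midpoint of a diagonal lies in its piece, and pieces are disjoint. So the sum over
  pieces in \<open>global_weight\<close> has at most one term.\<close>

lemma diagonal_unique_piece: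
  assumes "tess A" "Q \<in> pieces disk A" "d \<in> diagonals Q" "Q' \<in> pieces disk A" "d \<in> diagonals Q'"
  shows "Q = Q'"
proof -
  obtain x y where 1: "d = seg x y" "open_segment x y \<subseteq> Q" "d \<inter> disk = open_segment x y" "midpoint x y \<in> Q" "midpoint x y \<in> d"
    using assms(1-3) by (rule diagonal_piece)
  obtain x' y' where 2: "d = seg x' y'" "open_segment x' y' \<subseteq> Q'" "d \<inter> disk = open_segment x' y'"
    using assms(1,4,5) by (rule diagonal_piece)
  have "midpoint x y \<in> disk" using 1 piece_subset[OF assms(2)] by blast
  then have "midpoint x y \<in> Q'" using 1 2 by blast
  then show ?thesis using components_eq[of Q _ Q'] assms 1 unfolding pieces_def by blast
qed

lemma diagonal_notin:
  assumes "tess A" "Q \<in> pieces disk A" "d \<in> diagonals Q" shows "d \<notin> A"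
proof -
  obtain x y where "midpoint x y \<in> Q" "midpoint x y \<in> d" using assms by (rule diagonal_piece)
  then show ?thesis using piece_subset[OF assms(2)] by blast
qed

section \<open>Pieces and diagonals of nested tessellations\<close>

context
  fixes A B :: "chord set"
  assumes A: "tess A" and B: "tess B" and BA: "B \<subseteq> A"
begin

text \<open>The interior of the arc is a connected subset of the complement of \<open>B\<close>, so
  it stays in the one piece that it enters.\<close>

lemma arc_is_diagonal:
  assumes "R \<in> pieces disk B" "a \<in> A" "a \<inter> R \<noteq> {}" shows "a \<in> diagonals R"
proof -
  obtain p q where pq: "a = seg p q" "p \<in> circle" "q \<in> circle" "p \<noteq> q"
    using dyadic_arcE[OF tess_dyadic_arcs[OF A assms(2)]] by blast
  have R: "R \<subseteq> disk - \<Union>B" using piece_subset assms by blast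
  have "a \<notin> B" using assms R by blast
  then have "open_segment p q \<subseteq> disk - \<Union>B"
    using tess_not_crosses[OF A assms(2)] BA open_segment_in_disk[OF pq(2,3)] open_closed_segment
    unfolding pq(1) crosses_def by blast
  moreover have "open_segment p q \<inter> R \<noteq> {}"
    using assms(3) R closed_segment_Int_disk[OF pq(2,3)] unfolding pq(1) by blast
  ultimately have "open_segment p q \<subseteq> R"
    using components_maximal[OF assms(1)[unfolded pieces_def] convex_connected[OF convex_open_segment[of p q]]] by blast
  then show ?thesis unfolding pq(1) using diagonalI[OF assms(1) pq(2-4)] by blast
qed

lemma arc_in_piece:
  assumes "a \<in> A" "a \<notin> B" obtains R where "R \<in> pieces disk B" "a \<in> diagonals R"
proof -
  obtain p q where pq: "a = seg p q" "p \<in> circle" "q \<in> circle" "p \<noteq> q"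
    using dyadic_arcE[OF tess_dyadic_arcs[OF A assms(1)]] by blast
  have m: "midpoint p q \<in> open_segment p q" using pq by simp
  then have "midpoint p q \<in> disk" "midpoint p q \<in> a" using open_segment_in_disk[OF pq(2,3)] open_closed_segment pq by blast+
  then have "midpoint p q \<in> disk - \<Union>B" using tess_not_crosses[OF A assms(1)] BA assms(2) unfolding crosses_def by blast
  then obtain R where "R \<in> pieces disk B" "midpoint p q \<in> R" unfolding pieces_def by (metis UnionE Union_components)
  then show ?thesis using that[of R] arc_is_diagonal[of R a] assms \<open>midpoint p q \<in> a\<close> by blast
qed

text \<open>The arcs of \<open>A\<close> that enter \<open>R\<close> are diagonals of
  \<open>R\<close>, and a component of the complement of \<open>A\<close> cannot leave a piece of
  the coarser \<open>B\<close>. This translates the local cutting of \<open>R\<close> in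
  \<open>cell_inclusion\<close> into global pieces of \<open>A\<close>.\<close>

lemma pieces_in_piece:
  assumes R: "R \<in> pieces disk B"
  shows "pieces R (A \<inter> diagonals R) = {Q \<in> pieces disk A. Q \<subseteq> R}"
proof -
  have e: "R - \<Union>(A \<inter> diagonals R) = R - \<Union>A" using arc_is_diagonal[OF R] by blast
  have Rd: "R \<subseteq> disk - \<Union>B" using piece_subset R by blast
  show ?thesis unfolding pieces_def e
  proof (intro equalityI subsetI)
    fix Q assume Q: "Q \<in> components (R - \<Union>A)"
    have QR: "Q \<subseteq> R - \<Union>A" "Q \<noteq> {}" "connected Q"
      using in_components_subset[OF Q] in_components_nonempty[OF Q] in_components_connected[OF Q] by blast+
    then obtain Q' where Q': "Q' \<in> components (disk - \<Union>A)" "Q \<subseteq> Q'"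
      using exists_component_superset[of Q "disk - \<Union>A"] Rd by blast
    have c: "connected Q'" "Q' \<subseteq> disk - \<Union>A" using in_components_connected[OF Q'(1)] in_components_subset[OF Q'(1)] by blast+
    have "Q' \<subseteq> disk - \<Union>B" using c(2) BA by blast
    moreover have "R \<inter> Q' \<noteq> {}" using QR(1,2) Q'(2) by blast
    ultimately have "Q' \<subseteq> R" by (rule components_maximal[OF R[unfolded pieces_def] c(1)])
    then have "Q' \<subseteq> R - \<Union>A" using c(2) by blast
    moreover have "Q \<inter> Q' \<noteq> {}" using QR(2) Q'(2) by blast
    ultimately have "Q' \<subseteq> Q" by (rule components_maximal[OF Q c(1)])
    then have "Q' = Q" using Q'(2) by (rule equalityI)
    then show "Q \<in> {Q \<in> components (disk - \<Union>A). Q \<subseteq> R}" using Q'(1) QR(1) by blast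
  next
    fix Q assume Q: "Q \<in> {Q \<in> components (disk - \<Union>A). Q \<subseteq> R}"
    then have "Q \<subseteq> R - \<Union>A" using in_components_subset[of Q] by blast
    then show "Q \<in> components (R - \<Union>A)" using Q Rd components_intermediate_subset[of Q "disk - \<Union>A" "R - \<Union>A"] by blast
  qed
qed

lemma piece_in_piece:
  assumes "Q \<in> pieces disk A" obtains R where "R \<in> pieces disk B" "Q \<subseteq> R"
proof -
  have Q: "Q \<in> components (disk - \<Union>A)" using assms by (simp add: pieces_def)
  have "Q \<subseteq> disk - \<Union>A" by (rule in_components_subset[OF Q])
  then have "Q \<subseteq> disk - \<Union>B" "disk - \<Union>B \<noteq> {}" using BA in_components_nonempty[OF Q] by blast+
  then obtain R where "R \<in> components (disk - \<Union>B)" "Q \<subseteq> R"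
    using exists_component_superset in_components_connected[OF Q] by metis
  then show ?thesis using that[of R] by (simp add: pieces_def)
qed

lemma diagonal_of_bigger_piece:
  assumes "Q \<in> pieces disk A" "d \<in> diagonals Q" "R \<in> pieces disk B" "Q \<subseteq> R"
  shows "d \<in> diagonals R"
proof -
  obtain x y where "d = seg x y" "x \<in> circle" "y \<in> circle" "x \<noteq> y" "open_segment x y \<subseteq> Q"
    using A assms(1,2) by (rule diagonal_piece)
  then show ?thesis using diagonalI[OF assms(3), of x y] assms(4) by blast
qed

lemma smaller_piece_of_diagonal:
  assumes "Q \<in> pieces disk A" "d \<in> diagonals Q" "R \<in> pieces disk B" "d \<in> diagonals R"
  shows "Q \<subseteq> R"
proof -
  obtain R' where R': "R' \<in> pieces disk B" "Q \<subseteq> R'" using piece_in_piece[OF assms(1)] .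
  then have "d \<in> diagonals R'" using diagonal_of_bigger_piece assms by blast
  then show ?thesis using diagonal_unique_piece[OF B] assms R' by blast
qed

end

text \<open>The weight that a point of \<^term>\<open>cell A\<close> puts on a chord, arcs of \<open>A\<close> having weight 1. It is
  invariant under gluing and recovers \<open>A\<close> from a generic point of the cell.\<close>

definition global_weight :: "chord set \<Rightarrow> (point set \<Rightarrow> weight) \<Rightarrow> weight" where
  "global_weight A x d =
     (if d \<in> A then 1 else \<Sum>Q | Q \<in> nontriangular_pieces disk A \<and> d \<in> diagonals Q. x Q d)"

lemma global_weight_diagonal:
  assumes "tess A" "Q \<in> pieces disk A" "d \<in> diagonals Q"
  shows "global_weight A x d = x Q d"
proof -
  have "{Q'. Q' \<in> nontriangular_pieces disk A \<and> d \<in> diagonals Q'} = {Q}"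
    using diagonal_unique_piece[OF assms] diagonal_not_triangle[OF assms] assms
    unfolding nontriangular_pieces_def by blast
  then show ?thesis using diagonal_notin[OF assms] by (simp add: global_weight_def)
qed

lemma global_weight_no_diagonal:
  assumes "d \<notin> A" "\<And>Q. Q \<in> pieces disk A \<Longrightarrow> d \<notin> diagonals Q"
  shows "global_weight A x d = 0"
proof -
  have "{Q'. Q' \<in> nontriangular_pieces disk A \<and> d \<in> diagonals Q'} = {}"
    using assms unfolding nontriangular_pieces_def by blast
  then show ?thesis using assms by (simp only: global_weight_def if_False sum.empty)
qed

lemma cell_component:
  assumes "x \<in> cell A" "Q \<in> nontriangular_pieces disk A" shows "x Q \<in> associahedron Q"
  using assms unfolding cell_def associahedra_product_def by blast

lemma global_weight_range:
  assumes A: "tess A" and x: "x \<in> cell A" shows "global_weight A x d \<in> {0..1}"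
proof (cases "d \<in> A")
  case False
  show ?thesis
  proof (cases "\<exists>Q\<in>pieces disk A. d \<in> diagonals Q")
    case True
    then obtain Q where Q: "Q \<in> pieces disk A" "d \<in> diagonals Q" by blast
    then have "x Q \<in> associahedron Q" using cell_component[OF x] diagonal_not_triangle[OF A] by blast
    then show ?thesis using Q global_weight_diagonal[OF A Q, of x] unfolding associahedron_def
      by (metis (no_types, lifting) PiE_mem mem_Collect_eq)
  next
    case False
    then have "global_weight A x d = 0" using \<open>d \<notin> A\<close> by (intro global_weight_no_diagonal) auto
    then show ?thesis by simp
  qed
qed (simp add: global_weight_def)

text \<open>An arc of \<open>A\<close> never enters a piece, diagonals of different pieces do not
  meet in the disk, and within one piece the support of a point of the associahedron is
  noncrossing.\<close>

lemma global_weight_noncrossing: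
  assumes A: "tess A" and x: "x \<in> cell A" and d: "global_weight A x d \<noteq> 0" "global_weight A x d' \<noteq> 0"
  shows "\<not> crosses d d'"
proof -
  have mixed: "d \<inter> d' \<inter> disk = {}" if *: "d \<in> A" "d' \<notin> A" "global_weight A x d' \<noteq> 0" for d d'
  proof -
    obtain Q where Q: "Q \<in> pieces disk A" "d' \<in> diagonals Q"
      using *(2,3) global_weight_no_diagonal[of d' A x] by blast
    obtain u v where "open_segment u v \<subseteq> Q" "d' \<inter> disk = open_segment u v" using A Q by (rule diagonal_piece)
    then show ?thesis using piece_subset[OF Q(1)] *(1) by blast
  qed
  consider "d \<in> A" "d' \<in> A" | "d \<in> A" "d' \<notin> A" | "d \<notin> A" "d' \<in> A" | "d \<notin> A" "d' \<notin> A" by blast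
  then show ?thesis
  proof cases
    case 1 then show ?thesis using tess_not_crosses[OF A] by blast
  next
    case 2 then show ?thesis using mixed[of d d'] d unfolding crosses_def by blast
  next
    case 3 then show ?thesis using mixed[of d' d] d unfolding crosses_def by blast
  next
    case 4
    obtain Q where Q: "Q \<in> pieces disk A" "d \<in> diagonals Q" using d 4 global_weight_no_diagonal[of d A x] by blast
    obtain Q' where Q': "Q' \<in> pieces disk A" "d' \<in> diagonals Q'" using d 4 global_weight_no_diagonal[of d' A x] by blast
    obtain u v where u: "open_segment u v \<subseteq> Q" "d \<inter> disk = open_segment u v" using A Q by (rule diagonal_piece)
    obtain u' v' where u': "open_segment u' v' \<subseteq> Q'" "d' \<inter> disk = open_segment u' v'" using A Q' by (rule diagonal_piece)
    show ?thesis
    proof (cases "Q = Q'")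
      case True
      have "x Q d \<noteq> 0" "x Q d' \<noteq> 0"
        using d global_weight_diagonal[OF A Q, of x] global_weight_diagonal[OF A Q', of x] True by simp_all
      moreover have "x Q \<in> associahedron Q" using cell_component[OF x] diagonal_not_triangle[OF A Q] .
      ultimately have "d \<noteq> d' \<Longrightarrow> d \<inter> d' \<inter> Q = {}"
        using Q Q' True unfolding associahedron_def tessellation_def noncrossing_def pairwise_def by blast
      then show ?thesis using u unfolding crosses_def by blast
    next
      case False
      then have "Q \<inter> Q' = {}" using components_nonoverlap[of Q _ Q'] Q Q' unfolding pieces_def by blast
      then show ?thesis using u u' unfolding crosses_def by blast
    qed
  qed
qed

section \<open>Gluing maps seen through the global weight\<close>

context
  fixes A B :: "chord set"
  assumes A: "tess A" and B: "tess B" and BA: "B \<subseteq> A"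
begin

text \<open>The polygons in \<open>R\<close> that have \<open>d\<close> as a diagonal are exactly
  the pieces of \<open>A\<close> with this property. So an inclusion of cells merely restricts one
  function on chords, and its properties are read off from that function.\<close>

lemma cell_inclusion_eq_weight:
  assumes "R \<in> nontriangular_pieces disk B" "d \<in> diagonals R"
  shows "cell_inclusion B A x R d = global_weight A x d"
proof -
  have R: "R \<in> pieces disk B" using assms by (simp add: nontriangular_pieces_def)
  have np: "nontriangular_pieces R (A \<inter> diagonals R) = {Q \<in> nontriangular_pieces disk A. Q \<subseteq> R}"
    unfolding nontriangular_pieces_def pieces_in_piece[OF A B BA R] by blast
  have "{Q. Q \<in> nontriangular_pieces R (A \<inter> diagonals R) \<and> d \<in> diagonals Q}
     = {Q. Q \<in> nontriangular_pieces disk A \<and> d \<in> diagonals Q}"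
    unfolding np using smaller_piece_of_diagonal[OF A B BA _ _ R assms(2)]
    unfolding nontriangular_pieces_def by blast
  then show ?thesis
    using assms unfolding cell_inclusion_def cell_iso_def global_weight_def Let_def by (auto intro!: sum.cong)
qed

text \<open>Arcs of \<open>A\<close> outside \<open>B\<close> and diagonals of pieces of
  \<open>A\<close> are diagonals of pieces of \<open>B\<close>. Hence a chord that is neither in
  \<open>B\<close> nor a diagonal of one of its pieces has weight 0 on both sides.\<close>

lemma global_weight_cell_inclusion: "global_weight B (cell_inclusion B A x) = global_weight A x"
proof
  fix d
  show "global_weight B (cell_inclusion B A x) d = global_weight A x d"
  proof (cases "d \<in> B")
    case True
    then show ?thesis using BA by (auto simp: global_weight_def)
  next
    case dB: False
    show ?thesis
    proof (cases "\<exists>R\<in>pieces disk B. d \<in> diagonals R")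
      case True
      then obtain R where R: "R \<in> pieces disk B" "d \<in> diagonals R" by blast
      then show ?thesis
        using global_weight_diagonal[OF B R] cell_inclusion_eq_weight diagonal_not_triangle[OF B R] by simp
    next
      case False
      then have "global_weight B (cell_inclusion B A x) d = 0" using dB by (intro global_weight_no_diagonal) blast+
      moreover have "d \<notin> A" using False dB arc_in_piece[OF A B BA] by blast
      moreover have "d \<notin> diagonals Q" if "Q \<in> pieces disk A" for Q
        using False that piece_in_piece[OF A B BA that] diagonal_of_bigger_piece[OF A B BA that] by metis
      ultimately show ?thesis using global_weight_no_diagonal[of d A x] by simp
    qed
  qed
qed

lemma cell_inclusion_in_cell:
  assumes x: "x \<in> cell A" shows "cell_inclusion B A x \<in> cell B"
  unfolding cell_def associahedra_product_def
proof (rule PiE_I)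
  fix R assume R: "R \<in> nontriangular_pieces disk B"
  then have Rd: "R \<subseteq> disk" using piece_subset[of R disk B] by (auto simp: nontriangular_pieces_def)
  note w = cell_inclusion_eq_weight[OF R]
  have "cell_inclusion B A x R \<in> diagonals R \<rightarrow>\<^sub>E {0..1}"
  proof (rule PiE_I)
    fix d assume "d \<in> diagonals R"
    then show "cell_inclusion B A x R d \<in> {0..1}" using w global_weight_range[OF A x] by simp
  next
    fix d assume "d \<notin> diagonals R"
    then show "cell_inclusion B A x R d = undefined"
      using R unfolding cell_inclusion_def cell_iso_def Let_def by simp
  qed
  moreover have "noncrossing R {d \<in> diagonals R. cell_inclusion B A x R d \<noteq> 0}"
    using global_weight_noncrossing[OF A x] w Rd unfolding noncrossing_def pairwise_def crosses_def by fastforce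
  ultimately show "cell_inclusion B A x R \<in> associahedron R"
    unfolding associahedron_def tessellation_def by blast
next
  fix R assume "R \<notin> nontriangular_pieces disk B"
  then show "cell_inclusion B A x R = undefined" unfolding cell_inclusion_def by simp
qed

end

lemma equivclp_glued_global_weight:
  assumes "equivclp glued p q"
  shows "global_weight (fst p) (snd p) = global_weight (fst q) (snd q)"
  using assms
proof (induction rule: equivclp_induct)
  case (step y z)
  have *: "global_weight (fst u) (snd u) = global_weight (fst v) (snd v)" if "glued u v" for u v
    using that
  proof cases
    case (1 A B x)
    then show ?thesis using global_weight_cell_inclusion[of A B x] by (auto simp: F_tessellations_eq)
  qed
  show ?case using step *[of y z] *[of z y] by auto
qed simp

text \<open>The point with weight 0 on every diagonal is the centre of the cell, and its global
  weight is 1 exactly on \<open>A\<close>. A point of the cell of \<open>B\<close> has weight 1 on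
  all of \<open>B\<close>, and the weight depends only on the class in the quotient.\<close>

lemma generic_point:
  assumes A: "A \<in> F_tessellations"
  obtains c where "c \<in> closed_cell A" "\<And>B. B \<in> F_tessellations \<Longrightarrow> c \<in> closed_cell B \<Longrightarrow> B \<subseteq> A"
proof -
  have tA: "tess A" using A by (simp add: F_tessellations_eq)
  let ?r = "{(p, q). equivclp glued p q}"
  define x0 :: "point set \<Rightarrow> weight" where
    "x0 = (\<lambda>Q\<in>nontriangular_pieces disk A. \<lambda>d\<in>diagonals Q. 0)"
  have x0Q: "x0 Q d = 0" if "Q \<in> nontriangular_pieces disk A" "d \<in> diagonals Q" for Q d
    using that by (simp add: x0_def)
  have x0: "x0 \<in> cell A" unfolding cell_def associahedra_product_def
  proof (rule PiE_I)
    fix Q assume Q: "Q \<in> nontriangular_pieces disk A"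
    have e: "{d \<in> diagonals Q. x0 Q d \<noteq> 0} = {}" using x0Q[OF Q] by blast
    have "tessellation Q {d \<in> diagonals Q. x0 Q d \<noteq> 0}" unfolding e by (simp add: tessellation_def noncrossing_def)
    moreover have "x0 Q \<in> diagonals Q \<rightarrow>\<^sub>E {0..1}" using Q by (simp add: x0_def)
    ultimately show "x0 Q \<in> associahedron Q" by (simp add: associahedron_def)
  qed (simp add: x0_def)
  show ?thesis
  proof (rule that)
    show "?r `` {(A, x0)} \<in> closed_cell A" unfolding closed_cell_def quotient_def using x0 by blast
    fix B assume B: "B \<in> F_tessellations" and sub: "?r `` {(A, x0)} \<in> closed_cell B"
    obtain y where y: "y \<in> cell B" "?r `` {(A, x0)} = ?r `` {(B, y)}"
      using sub unfolding closed_cell_def quotient_def by blast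
    have "(B, y) \<in> ?r `` {(B, y)}" using reflpD[OF reflp_equivclp] by auto
    then have "equivclp glued (A, x0) (B, y)" unfolding y(2)[symmetric] by simp
    from equivclp_glued_global_weight[OF this]
    have w: "global_weight A x0 = global_weight B y" by simp
    show "B \<subseteq> A"
    proof
      fix b assume "b \<in> B"
      then have "global_weight A x0 b = 1" unfolding w by (simp add: global_weight_def)
      then show "b \<in> A"
        using global_weight_no_diagonal[of b A x0] global_weight_diagonal[OF tA, of _ b x0] x0Q diagonal_not_triangle[OF tA]
        by (metis zero_neq_one)
    qed
  qed
qed

text \<open>One direction tests the generic point of the cell of \<open>A\<close>; the other holds
  because each point of that cell is glued to its image under the inclusion.\<close>

lemma closed_cell_subset_iff:
  assumes A: "A \<in> F_tessellations" and B: "B \<in> F_tessellations"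
  shows "closed_cell A \<subseteq> closed_cell B \<longleftrightarrow> B \<subseteq> A"
proof
  assume "closed_cell A \<subseteq> closed_cell B"
  then show "B \<subseteq> A" using generic_point[OF A] B by (metis subsetD)
next
  assume BA: "B \<subseteq> A"
  have tA: "tess A" and tB: "tess B" using A B by (simp_all add: F_tessellations_eq)
  let ?r = "{(p, q). equivclp glued p q}"
  show "closed_cell A \<subseteq> closed_cell B"
  proof (cases "B = A")
    case False
    show ?thesis
    proof
      fix c assume "c \<in> closed_cell A"
      then obtain x where x: "x \<in> cell A" "c = ?r `` {(A, x)}" unfolding closed_cell_def quotient_def by blast
      have "glued (A, x) (B, cell_inclusion B A x)" using A B BA False x by (intro glued.intros) auto
      then have g: "equivclp glued (A, x) (B, cell_inclusion B A x)"
        unfolding equivclp_def by (intro r_into_rtranclp) auto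
      have "equivclp glued (A, x) z \<longleftrightarrow> equivclp glued (B, cell_inclusion B A x) z" for z
        using g equivclp_sym[OF g] transpD[OF transp_equivclp[of glued]] by blast
      then have "c = ?r `` {(B, cell_inclusion B A x)}" unfolding x(2) by auto
      then show "c \<in> closed_cell B"
        unfolding closed_cell_def quotient_def using cell_inclusion_in_cell[OF tA tB BA x(1)] by blast
    qed
  qed simp
qed

lemma closed_cell_inj: "A \<in> F_tessellations \<Longrightarrow> B \<in> F_tessellations \<Longrightarrow> closed_cell A = closed_cell B \<longleftrightarrow> A = B"
  using closed_cell_subset_iff by blast

section \<open>Order automorphisms and vertex permutations\<close>

definition order_auto :: "(chord set \<Rightarrow> chord set) \<Rightarrow> bool" where
  "order_auto f \<longleftrightarrow> bij_betw f F_tessellations F_tessellations \<and>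
     (\<forall>A\<in>F_tessellations. \<forall>B\<in>F_tessellations. f A \<subseteq> f B \<longleftrightarrow> A \<subseteq> B)"

lemma order_auto_inverse:
  assumes "order_auto f" shows "order_auto (inv_into F_tessellations f)"
proof -
  let ?g = "inv_into F_tessellations f"
  have bij: "bij_betw f F_tessellations F_tessellations" using assms by (simp add: order_auto_def)
  have g: "bij_betw ?g F_tessellations F_tessellations" using bij by (rule bij_betw_inv_into)
  have "?g A \<subseteq> ?g B \<longleftrightarrow> A \<subseteq> B" if "A \<in> F_tessellations" "B \<in> F_tessellations" for A B
    using assms that bij_betw_inv_into_right[OF bij] bij_betwE[OF g] unfolding order_auto_def by metis
  then show ?thesis using g by (simp add: order_auto_def)
qed

lemma tess_arc_exists:
  assumes "a \<in> dyadic_arcs" shows "\<exists>A\<in>F_tessellations. a \<in> A"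
  using compatible_tess[OF assms assms] unfolding F_tessellations_eq by auto

lemma F_tess_Diff: "A \<in> F_tessellations \<Longrightarrow> A - {a} \<in> F_tessellations"
  unfolding F_tessellations_eq using tess_Diff by blast

text \<open>The image of an arc is the arc lost when it is removed, which might depend on the
  tessellation. Since \<open>f\<close> preserves intersections, a tessellation and a smaller one
  containing the arc give the same result; two arbitrary ones are compared through their
  intersection.\<close>

lemma order_auto_arc_map:
  assumes "order_auto f"
  obtains \<beta> where "\<And>A a. A \<in> F_tessellations \<Longrightarrow> a \<in> A \<Longrightarrow> \<beta> a \<in> f A \<and> f (A - {a}) = f A - {\<beta> a}"
    "\<And>A. A \<in> F_tessellations \<Longrightarrow> f A = \<beta> ` A"
proof -
  let ?T = "F_tessellations"
  have bij: "bij_betw f ?T ?T" and ord: "\<And>A B. A \<in> ?T \<Longrightarrow> B \<in> ?T \<Longrightarrow> f A \<subseteq> f B \<longleftrightarrow> A \<subseteq> B"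
    using assms by (auto simp: order_auto_def)
  have inT: "f A \<in> ?T" if "A \<in> ?T" for A using bij that by (rule bij_betw_apply)
  have surj: "\<exists>A\<in>?T. f A = B" if "B \<in> ?T" for B using bij_betw_imp_surj_on[OF bij] that by (metis imageE)
  have IntT: "A \<inter> B \<in> ?T" if "A \<in> ?T" "B \<in> ?T" for A B using that tess_Int by (simp add: F_tessellations_eq)
  have fInt: "f (A \<inter> B) = f A \<inter> f B" if A: "A \<in> ?T" and B: "B \<in> ?T" for A B
  proof
    show "f (A \<inter> B) \<subseteq> f A \<inter> f B" using ord[OF IntT[OF A B] A] ord[OF IntT[OF A B] B] by blast
    obtain C where C: "C \<in> ?T" "f C = f A \<inter> f B" using surj IntT inT A B by metis
    then have "C \<subseteq> A" "C \<subseteq> B" using ord[of C A] ord[of C B] A B by simp_all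
    then show "f A \<inter> f B \<subseteq> f (A \<inter> B)" using ord[OF C(1) IntT[OF A B]] C(2) by simp
  qed
  \<comment> \<open>Take any \<open>b\<close> in \<open>f A\<close> that is lost. The preimage of
    \<open>f A - {b}\<close> contains \<open>A - {a}\<close> and is properly contained in
    \<open>A\<close>, so it is \<open>A - {a}\<close>.\<close>
  have coatom: "\<exists>b. b \<in> f A \<and> f (A - {a}) = f A - {b}" if A: "A \<in> ?T" "a \<in> A" for A a
  proof -
    have A': "A - {a} \<in> ?T" using A F_tess_Diff by blast
    have sub: "f (A - {a}) \<subseteq> f A" using ord[OF A' A(1)] by blast
    have "\<not> f A \<subseteq> f (A - {a})" using ord[OF A(1) A'] A by blast
    then obtain b where b: "b \<in> f A" "b \<notin> f (A - {a})" by blast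
    obtain C where C: "C \<in> ?T" "f C = f A - {b}" using surj[OF F_tess_Diff[OF inT[OF A(1)]]] by blast
    have "A - {a} \<subseteq> C" using ord[OF A' C(1)] C(2) sub b by blast
    moreover have "C \<subseteq> A" using ord[OF C(1) A(1)] C(2) by blast
    moreover have "C \<noteq> A" using C(2) b by blast
    ultimately have "C = A - {a}" by blast
    then show ?thesis using C b by blast
  qed
  define bb where "bb A a = (SOME b. b \<in> f A \<and> f (A - {a}) = f A - {b})" for A a
  have bb: "bb A a \<in> f A \<and> f (A - {a}) = f A - {bb A a}" if "A \<in> ?T" "a \<in> A" for A a
    unfolding bb_def using someI_ex[OF coatom[OF that]] .
  have restr: "bb A a = bb X a" if "A \<in> ?T" "X \<in> ?T" "X \<subseteq> A" "a \<in> X" for A X a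
  proof -
    have "X - {a} = X \<inter> (A - {a})" using that by blast
    then have "f (X - {a}) = f (X \<inter> (A - {a}))" by (rule arg_cong)
    also have "\<dots> = f X \<inter> f (A - {a})" by (rule fInt[OF that(2) F_tess_Diff[OF that(1)]])
    also have "f (A - {a}) = f A - {bb A a}" using bb[OF that(1)] that by blast
    also have "f X \<inter> (f A - {bb A a}) = f X - {bb A a}" using ord[OF that(2,1)] that by blast
    finally have "f X - {bb X a} = f X - {bb A a}" using bb[OF that(2,4)] by simp
    then show ?thesis using bb[OF that(2,4)] by blast
  qed
  have indep: "bb A a = bb A' a" if "A \<in> ?T" "A' \<in> ?T" "a \<in> A" "a \<in> A'" for A A' a
    using restr[OF that(1) IntT[OF that(1,2)] Int_lower1] restr[OF that(2) IntT[OF that(1,2)] Int_lower2] that(3,4)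
    by (metis IntI)
  define \<beta> where "\<beta> a = bb (SOME A. A \<in> ?T \<and> a \<in> A) a" for a
  have \<beta>: "\<beta> a = bb A a" if "A \<in> ?T" "a \<in> A" for A a
  proof -
    have "(SOME A. A \<in> ?T \<and> a \<in> A) \<in> ?T \<and> a \<in> (SOME A. A \<in> ?T \<and> a \<in> A)"
      using that by (intro someI[of "\<lambda>A. A \<in> ?T \<and> a \<in> A" A]) blast
    then show ?thesis unfolding \<beta>_def using indep that by blast
  qed
  have 1: "\<beta> a \<in> f A \<and> f (A - {a}) = f A - {\<beta> a}" if "A \<in> ?T" "a \<in> A" for A a
    using bb[OF that] \<beta>[OF that] by simp
  have 2: "f A = \<beta> ` A" if A: "A \<in> ?T" for A
  proof
    show "\<beta> ` A \<subseteq> f A" using 1[OF A] by blast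
    show "f A \<subseteq> \<beta> ` A"
    proof
      fix b assume b: "b \<in> f A"
      \<comment> \<open>The preimage of \<open>f A - {b}\<close> lacks some arc \<open>a\<close> of
        \<open>A\<close>, and removing this \<open>a\<close> can only remove
        \<open>b\<close>.\<close>
      obtain C where C: "C \<in> ?T" "f C = f A - {b}" using surj[OF F_tess_Diff[OF inT[OF A]]] by blast
      have "C \<subseteq> A" using ord[OF C(1) A] C(2) by blast
      moreover have "C \<noteq> A" using C(2) b by blast
      ultimately obtain a where a: "a \<in> A" "C \<subseteq> A - {a}" by blast
      then have "f A - {b} \<subseteq> f A - {\<beta> a}"
        using ord[OF C(1) F_tess_Diff[OF A, of a]] C(2) 1[OF A a(1)] by simp
      then have "\<beta> a = b" using 1[OF A a(1)] by blast
      then show "b \<in> \<beta> ` A" using a by blast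
    qed
  qed
  show ?thesis using that[of \<beta>] 1 2 by blast
qed

text \<open>The arc maps of \<open>f\<close> and of its inverse invert each other, as is seen by
  removing an arc and mapping forth and back. Both preserve noncrossing because noncrossing arcs lie
  in a common tessellation.\<close>

lemma order_auto_arc_bij:
  assumes f: "order_auto f"
  obtains \<beta> where "bij_betw \<beta> dyadic_arcs dyadic_arcs" "\<And>A. A \<in> F_tessellations \<Longrightarrow> f A = \<beta> ` A"
    "\<And>d d'. d \<in> dyadic_arcs \<Longrightarrow> d' \<in> dyadic_arcs \<Longrightarrow> crosses (\<beta> d) (\<beta> d') \<longleftrightarrow> crosses d d'"
proof -
  let ?T = "F_tessellations"
  define g where "g = inv_into ?T f"
  have g: "order_auto g" unfolding g_def using f by (rule order_auto_inverse)
  have bij: "bij_betw f ?T ?T" using f by (simp add: order_auto_def)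
  have gf: "g (f A) = A" "f (g A) = A" "f A \<in> ?T" "g A \<in> ?T" if "A \<in> ?T" for A
    using bij_betw_inv_into_left[OF bij that] bij_betw_inv_into_right[OF bij that] bij_betw_apply[OF bij that]
      bij_betw_apply[OF bij_betw_inv_into[OF bij] that] by (simp_all add: g_def)
  obtain \<beta> where b: "\<And>A a. A \<in> ?T \<Longrightarrow> a \<in> A \<Longrightarrow> \<beta> a \<in> f A \<and> f (A - {a}) = f A - {\<beta> a}"
    "\<And>A. A \<in> ?T \<Longrightarrow> f A = \<beta> ` A" using order_auto_arc_map[OF f] by blast
  obtain \<gamma> where c: "\<And>A a. A \<in> ?T \<Longrightarrow> a \<in> A \<Longrightarrow> \<gamma> a \<in> g A \<and> g (A - {a}) = g A - {\<gamma> a}"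
    "\<And>A. A \<in> ?T \<Longrightarrow> g A = \<gamma> ` A" using order_auto_arc_map[OF g] by blast
  have arcs: "A \<subseteq> dyadic_arcs" if "A \<in> ?T" for A using that by (simp add: F_tessellations_eq tess_def)
  have bin: "\<beta> a \<in> dyadic_arcs" and cb: "\<gamma> (\<beta> a) = a" if a: "a \<in> dyadic_arcs" for a
  proof -
    obtain A where A: "A \<in> ?T" "a \<in> A" using tess_arc_exists[OF a] by blast
    show "\<beta> a \<in> dyadic_arcs" using b(1)[OF A] arcs[OF gf(3)[OF A(1)]] by blast
    have "g (f A - {\<beta> a}) = A - {a}" using b(1)[OF A] gf(1)[OF F_tess_Diff[OF A(1)]] by metis
    moreover have "g (f A - {\<beta> a}) = A - {\<gamma> (\<beta> a)}" "\<gamma> (\<beta> a) \<in> A"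
      using c(1)[OF gf(3)[OF A(1)], of "\<beta> a"] b(1)[OF A] gf(1)[OF A(1)] by simp_all
    ultimately show "\<gamma> (\<beta> a) = a" using A by blast
  qed
  have cin: "\<gamma> a \<in> dyadic_arcs" and bc: "\<beta> (\<gamma> a) = a" if a: "a \<in> dyadic_arcs" for a
  proof -
    obtain A where A: "A \<in> ?T" "a \<in> A" using tess_arc_exists[OF a] by blast
    show "\<gamma> a \<in> dyadic_arcs" using c(1)[OF A] arcs[OF gf(4)[OF A(1)]] by blast
    have "f (g A - {\<gamma> a}) = A - {a}" using c(1)[OF A] gf(2)[OF F_tess_Diff[OF A(1)]] by metis
    moreover have "f (g A - {\<gamma> a}) = A - {\<beta> (\<gamma> a)}" "\<beta> (\<gamma> a) \<in> A"
      using b(1)[OF gf(4)[OF A(1)], of "\<gamma> a"] c(1)[OF A] gf(2)[OF A(1)] by simp_all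
    ultimately show "\<beta> (\<gamma> a) = a" using A by blast
  qed
  have 1: "bij_betw \<beta> dyadic_arcs dyadic_arcs"
    by (rule bij_betw_byWitness[of _ \<gamma>]) (use bin cb cin bc in auto)
  have nc: "\<not> crosses (\<beta> d) (\<beta> d')" if dd: "d \<in> dyadic_arcs" "d' \<in> dyadic_arcs" "\<not> crosses d d'" for d d'
  proof -
    obtain A where A: "tess A" "d \<in> A" "d' \<in> A" using compatible_tess[OF dd] .
    then have "A \<in> ?T" by (simp add: F_tessellations_eq)
    then have "tess (f A)" "\<beta> d \<in> f A" "\<beta> d' \<in> f A" using gf(3)[of A] b(1)[of A] A by (simp_all add: F_tessellations_eq)
    then show ?thesis using tess_not_crosses by blast
  qed
  have nc': "\<not> crosses (\<gamma> d) (\<gamma> d')" if dd: "d \<in> dyadic_arcs" "d' \<in> dyadic_arcs" "\<not> crosses d d'" for d d'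
  proof -
    obtain A where A: "tess A" "d \<in> A" "d' \<in> A" using compatible_tess[OF dd] .
    then have "A \<in> ?T" by (simp add: F_tessellations_eq)
    then have "tess (g A)" "\<gamma> d \<in> g A" "\<gamma> d' \<in> g A" using gf(4)[of A] c(1)[of A] A by (simp_all add: F_tessellations_eq)
    then show ?thesis using tess_not_crosses by blast
  qed
  have "crosses (\<beta> d) (\<beta> d') \<longleftrightarrow> crosses d d'" if d: "d \<in> dyadic_arcs" "d' \<in> dyadic_arcs" for d d'
    using nc[OF d] nc'[OF bin[OF d(1)] bin[OF d(2)]] cb d by auto
  then show ?thesis using that[of \<beta>] 1 b(2) by blast
qed

section \<open>Incidence of arcs recovered from crossings\<close>

lemma separating_chord:
  assumes a: "a \<in> dyadic_points" and F: "finite F" "F \<subseteq> circle" "a \<notin> F"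
  obtains u v where "u \<in> dyadic_points" "v \<in> dyadic_points" "u \<noteq> v" "side u v a < 0" "\<And>w. w \<in> F \<Longrightarrow> side u v w > 0"
proof -
  obtain x where x: "a = gam x" using a unfolding dyadic_points_def by blast
  \<comment> \<open>All points of \<open>F\<close> keep parameter distance at least e from
    \<open>a\<close>, so a chord with ends closer than e on both sides of \<open>a\<close> separates
    it from them. The bound 1/2 keeps this neighbourhood shorter than one turn.\<close>
  have "\<exists>e>0. e < 1/2 \<and> (\<forall>w\<in>F. \<exists>z. w = gam z \<and> x + e \<le> z \<and> z \<le> x + 1 - e)"
    using F
  proof (induction F rule: finite_induct)
    case empty
    then show ?case by (intro exI[of _ "1/4"]) simp
  next
    case (insert w F)
    then obtain e where e: "e > 0" "e < 1/2" "\<forall>w\<in>F. \<exists>z. w = gam z \<and> x + e \<le> z \<and> z \<le> x + 1 - e" by auto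
    obtain z where z: "x \<le> z" "z < x + 1" "w = gam z" using circle_param[of w x] insert by auto
    have "z \<noteq> x" using insert z x by auto
    define e' where "e' = min e (min (z - x) (x + 1 - z))"
    have "e' > 0" "e' < 1/2" "x + e' \<le> z" "z \<le> x + 1 - e'" "e' \<le> e" using e z \<open>z \<noteq> x\<close> by (auto simp: e'_def min_def)
    moreover have "\<exists>z. v = gam z \<and> x + e' \<le> z \<and> z \<le> x + 1 - e'" if v: "v \<in> insert w F" for v
    proof (cases "v = w")
      case False
      then obtain y where "v = gam y" "x + e \<le> y" "y \<le> x + 1 - e" using e(3) v by blast
      then show ?thesis using \<open>e' \<le> e\<close> by (intro exI[of _ y]) auto
    qed (use z(3) \<open>x + e' \<le> z\<close> \<open>z \<le> x + 1 - e'\<close> in blast)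
    ultimately show ?case by blast
  qed
  then obtain e where e: "e > 0" "e < 1/2" "\<And>w. w \<in> F \<Longrightarrow> \<exists>z. w = gam z \<and> x + e \<le> z \<and> z \<le> x + 1 - e" by blast
  have l: "x - e < x" "x < x + e" using e by auto
  obtain s where s: "s \<in> dyadics" "x - e < s" "s < x" using dyadics_dense[OF l(1)] .
  obtain t where t: "t \<in> dyadics" "x < t" "t < x + e" using dyadics_dense[OF l(2)] .
  have neg: "side (gam s) (gam t) a < 0" unfolding x using s t e by (intro side_gam_neg) auto
  have "side (gam s) (gam t) w > 0" if "w \<in> F" for w
  proof -
    obtain z where "w = gam z" "x + e \<le> z" "z \<le> x + 1 - e" using e(3) \<open>w \<in> F\<close> by blast
    then show ?thesis using s t e by (auto intro!: side_gam_pos)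
  qed
  moreover have "gam s \<noteq> gam t" using neg by (auto simp: side_def)
  ultimately show ?thesis using that[of "gam s" "gam t"] s t neg gam_mem_dyadic_points_iff by blast
qed

text \<open>Incidence in terms of crossing: noncrossing arcs have a common endpoint iff no two of their
  separators cross. If \<open>a\<close> is a common endpoint, a short chord around \<open>a\<close> shows that all separators
  end at \<open>a\<close>; if \<open>(a, b)\<close> and \<open>(c, e)\<close> are disjoint, the diagonals of the quadrilateral are
  separators.\<close>

definition separators :: "chord \<Rightarrow> chord \<Rightarrow> chord set" where
  "separators d d' = {f \<in> dyadic_arcs. \<forall>x\<in>dyadic_arcs. crosses x d \<and> crosses x d' \<longrightarrow> crosses x f}"

lemma dyadic_arcI: "p \<in> dyadic_points \<Longrightarrow> q \<in> dyadic_points \<Longrightarrow> p \<noteq> q \<Longrightarrow> seg p q \<in> dyadic_arcs"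
  unfolding dyadic_arcs_def by blast

lemma dyadic_crosses_iff:
  assumes "{p, q, u, v} \<subseteq> dyadic_points" "p \<noteq> q" "u \<noteq> v"
  shows "crosses (seg p q) (seg u v) \<longleftrightarrow> side p q u * side p q v < 0"
  using assms dyadic_points_circle by (intro crosses_iff) auto

abbreviation ends :: "chord \<Rightarrow> point set" where "ends d \<equiv> d \<inter> circle"

lemma ends_seg: "p \<in> dyadic_points \<Longrightarrow> q \<in> dyadic_points \<Longrightarrow> ends (seg p q) = {p, q}"
  using closed_segment_Int_circle dyadic_points_circle by blast

lemma arc_with_end:
  assumes "d \<in> dyadic_arcs" "a \<in> ends d"
  obtains b where "d = seg a b" "a \<in> dyadic_points" "b \<in> dyadic_points" "a \<noteq> b"
proof -
  obtain p q where pq: "d = seg p q" "p \<in> dyadic_points" "q \<in> dyadic_points" "p \<noteq> q" using dyadic_arcE[OF assms(1)] by metis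
  then have "a = p \<or> a = q" using ends_seg assms(2) by auto
  then show ?thesis
  proof
    assume "a = p" then show ?thesis using that[of q] pq by blast
  next
    assume "a = q" then show ?thesis using that[of p] pq closed_segment_commute[of p q] by metis
  qed
qed

lemma arc_eq_ends:
  assumes "d \<in> dyadic_arcs" "a \<in> ends d" "b \<in> ends d" "a \<noteq> b" shows "d = seg a b"
proof -
  obtain c where c: "d = seg a c" "a \<in> dyadic_points" "c \<in> dyadic_points" using arc_with_end[OF assms(1,2)] by metis
  then have "b = c" using ends_seg[OF c(2,3)] assms by auto
  then show ?thesis using c by simp
qed

lemma separators_share:
  assumes f: "f \<in> separators (seg a b) (seg a c)"
    and abc: "{a, b, c} \<subseteq> dyadic_points" "a \<noteq> b" "a \<noteq> c"
  shows "a \<in> ends f"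
proof (rule ccontr)
  assume na: "a \<notin> ends f"
  have fa: "f \<in> dyadic_arcs" using f by (simp add: separators_def)
  then obtain p q where pq: "f = seg p q" "p \<in> dyadic_points" "q \<in> dyadic_points" "p \<noteq> q" using dyadic_arcE by metis
  have "a \<notin> {b, c, p, q}" using na ends_seg[OF pq(2,3)] pq(1) abc by auto
  moreover have "{b, c, p, q} \<subseteq> circle" using pq abc dyadic_points_circle by auto
  ultimately obtain u v where uv: "u \<in> dyadic_points" "v \<in> dyadic_points" "u \<noteq> v" "side u v a < 0"
     "\<And>w. w \<in> {b, c, p, q} \<Longrightarrow> side u v w > 0"
    using separating_chord[of a "{b, c, p, q}"] abc by (metis finite.emptyI finite.insertI insert_subset)
  have "crosses (seg u v) (seg a b)" "crosses (seg u v) (seg a c)" "\<not> crosses (seg u v) f"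
    unfolding pq(1) using uv(1-4) uv(5)[of b] uv(5)[of c] uv(5)[of p] uv(5)[of q] abc pq
    by (simp_all add: dyadic_crosses_iff mult_less_0_iff not_less)
  then show False using f dyadic_arcI[OF uv(1-3)] unfolding separators_def by blast
qed

lemma side_separates:
  assumes "side u v a \<ge> 0" "side u v c \<ge> 0" "side u v b < 0" "side u v e < 0"
  shows "\<not> crosses (seg a c) (seg b e)"
proof
  assume "crosses (seg a c) (seg b e)"
  then obtain w where "w \<in> seg a c" "w \<in> seg b e" unfolding crosses_def by blast
  then show False using side_closed_between[of w a c u v] side_closed_between[of w b e u v] assms by auto
qed

text \<open>Otherwise \<open>a\<close> and \<open>c\<close> would lie on one closed side of the line
  through \<open>u\<close> and \<open>v\<close>, and \<open>b\<close> and \<open>e\<close> strictly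
  on the other, so their chords could not meet.\<close>

lemma side_separates_weak:
  assumes "crosses (seg a c) (seg b e)" "side u v a * side u v b < 0" "side u v b * side u v e > 0"
  shows "side u v a * side u v c < 0"
proof (rule ccontr)
  assume n: "\<not> side u v a * side u v c < 0"
  show False
  proof (cases "side u v a > 0")
    case True
    then have "side u v b < 0" "side u v e < 0" "side u v c \<ge> 0"
      using assms n by (auto simp: mult_less_0_iff zero_less_mult_iff)
    then show False using side_separates[of u v a c b e] assms True by auto
  next
    case False
    then have "side u v a < 0" "side u v b > 0" "side u v e > 0" "side u v c \<le> 0"
      using assms n by (auto simp: mult_less_0_iff zero_less_mult_iff)
    then have "side v u a \<ge> 0" "side v u c \<ge> 0" "side v u b < 0" "side v u e < 0"
      unfolding side_swap[of v u] by auto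
    then show False using side_separates assms(1) by blast
  qed
qed

lemma separator_of_disjoint:
  assumes "{a, b, c, e} \<subseteq> dyadic_points" "distinct [a, b, c, e]" "crosses (seg a c) (seg b e)"
  shows "seg a c \<in> separators (seg a b) (seg c e)"
  unfolding separators_def
proof (intro CollectI conjI ballI impI)
  show "seg a c \<in> dyadic_arcs" using assms by (intro dyadic_arcI) auto
  fix x assume x: "x \<in> dyadic_arcs" "crosses x (seg a b) \<and> crosses x (seg c e)"
  obtain u v where uv: "x = seg u v" "u \<in> dyadic_points" "v \<in> dyadic_points" "u \<noteq> v" using dyadic_arcE[OF x(1)] by metis
  have s: "side u v a * side u v b < 0" "side u v c * side u v e < 0"
    using x(2) uv assms by (simp_all add: dyadic_crosses_iff)
  have "side u v a * side u v c < 0"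
  proof (rule ccontr)
    assume n: "\<not> side u v a * side u v c < 0"
    then have "side u v b * side u v e > 0" using s by (auto simp: mult_less_0_iff zero_less_mult_iff)
    then show False using side_separates_weak[OF assms(3) s(1)] n by blast
  qed
  then show "crosses x (seg a c)" using uv assms by (simp add: dyadic_crosses_iff)
qed

text \<open>Of three arcs that start at \<open>a\<close>, the one to \<open>c\<close> is the middle
  one, since it crosses the chord between the other two ends; a chord crossing both outer arcs
  crosses it as well.\<close>

lemma separator_of_star:
  assumes "{a, b, c, e} \<subseteq> dyadic_points" "distinct [a, b, c, e]" "crosses (seg a c) (seg b e)"
  shows "seg a c \<in> separators (seg a b) (seg a e)"
  unfolding separators_def
proof (intro CollectI conjI ballI impI)
  show "seg a c \<in> dyadic_arcs" using assms by (intro dyadic_arcI) auto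
  fix x assume x: "x \<in> dyadic_arcs" "crosses x (seg a b) \<and> crosses x (seg a e)"
  obtain u v where uv: "x = seg u v" "u \<in> dyadic_points" "v \<in> dyadic_points" "u \<noteq> v" using dyadic_arcE[OF x(1)] by metis
  have s: "side u v a * side u v b < 0" "side u v a * side u v e < 0"
    using x(2) uv assms by (simp_all add: dyadic_crosses_iff)
  then have "side u v b * side u v e > 0" by (auto simp: mult_less_0_iff zero_less_mult_iff)
  then have "side u v a * side u v c < 0" using side_separates_weak[OF assms(3) s(1)] by blast
  then show "crosses x (seg a c)" using uv assms by (simp add: dyadic_crosses_iff)
qed

definition sharing :: "chord \<Rightarrow> chord \<Rightarrow> bool" where
  "sharing d d' \<longleftrightarrow> d \<noteq> d' \<and> \<not> crosses d d' \<and> (\<forall>f\<in>separators d d'. \<forall>g\<in>separators d d'. \<not> crosses f g)"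

lemma sharing_iff:
  assumes d: "d \<in> dyadic_arcs" "d' \<in> dyadic_arcs"
  shows "sharing d d' \<longleftrightarrow> d \<noteq> d' \<and> ends d \<inter> ends d' \<noteq> {}"
proof
  assume "d \<noteq> d' \<and> ends d \<inter> ends d' \<noteq> {}"
  then obtain a where a: "d \<noteq> d'" "a \<in> ends d" "a \<in> ends d'" by blast
  obtain b where b: "d = seg a b" "a \<in> dyadic_points" "b \<in> dyadic_points" "a \<noteq> b" using arc_with_end[OF d(1) a(2)] .
  obtain c where c: "d' = seg a c" "c \<in> dyadic_points" "a \<noteq> c" using arc_with_end[OF d(2) a(3)] by metis
  have share: "\<not> crosses (seg a p) (seg a q)" if "p \<in> dyadic_points" "q \<in> dyadic_points" "a \<noteq> p" "a \<noteq> q" for p q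
    using not_crosses_share that b dyadic_points_circle by blast
  have "\<not> crosses f g" if fg: "f \<in> separators d d'" "g \<in> separators d d'" for f g
  proof -
    have "a \<in> ends f" "a \<in> ends g" using separators_share[of _ a b c] fg b c by auto
    moreover have "f \<in> dyadic_arcs" "g \<in> dyadic_arcs" using fg by (auto simp: separators_def)
    ultimately show ?thesis using arc_with_end share by metis
  qed
  then show "sharing d d'" unfolding sharing_def using a share b c by blast
next
  assume sh: "sharing d d'"
  have "ends d \<inter> ends d' \<noteq> {}"
  proof
    assume disj: "ends d \<inter> ends d' = {}"
    obtain a b where ab: "d = seg a b" "a \<in> dyadic_points" "b \<in> dyadic_points" "a \<noteq> b" using dyadic_arcE[OF d(1)] by metis
    obtain c e where ce: "d' = seg c e" "c \<in> dyadic_points" "e \<in> dyadic_points" "c \<noteq> e" using dyadic_arcE[OF d(2)] by metis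
    have dis: "distinct [a, b, c, e]" using disj ends_seg ab ce by auto
    have X: "{a, b, c, e} \<subseteq> dyadic_points" using ab ce by simp
    \<comment> \<open>The crossing pair is taken in the form \<open>a c\<close>, \<open>b e\<close>;
      the other possible pattern arises by exchanging the ends of \<open>d'\<close>.\<close>
    have key: False if "crosses (seg a c) (seg b e)" "d' = seg c e" "{a, b, c, e} \<subseteq> dyadic_points" "distinct [a, b, c, e]" for c e
    proof -
      have "seg a c \<in> separators d d'"
        unfolding ab(1) that(2) using separator_of_disjoint[of a b c e] that by blast
      moreover have "seg b e \<in> separators (seg b a) (seg e c)"
        using separator_of_disjoint[of b a e c] that crosses_sym by auto
      then have "seg b e \<in> separators d d'"
        unfolding ab(1) that(2) by (simp only: closed_segment_commute[of b a] closed_segment_commute[of e c])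
      ultimately show False using sh that(1) unfolding sharing_def by blast
    qed
    have "\<not> crosses (seg a b) (seg c e)" using sh unfolding sharing_def ab ce by blast
    moreover have "{a, b, c, e} \<subseteq> circle" using X dyadic_points_circle by blast
    ultimately consider "crosses (seg a c) (seg b e)" | "crosses (seg a e) (seg b c)" using pairings_cross[OF _ dis] by blast
    then show False
    proof cases
      case 1 then show False using key[of c e] ce X dis by blast
    next
      case 2 then show False using key[of e c] ce X dis closed_segment_commute[of c e] by auto
    qed
  qed
  then show "d \<noteq> d' \<and> ends d \<inter> ends d' \<noteq> {}" using sh by (simp add: sharing_def)
qed

text \<open>Distinguishes three arcs with a common endpoint from the three sides of a triangle.\<close>

definition starlike :: "chord \<Rightarrow> chord \<Rightarrow> chord \<Rightarrow> bool" where
  "starlike d1 d2 d3 \<longleftrightarrow> sharing d1 d2 \<and> sharing d1 d3 \<and> sharing d2 d3 \<and>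
     (d1 \<in> separators d2 d3 \<or> d2 \<in> separators d1 d3 \<or> d3 \<in> separators d1 d2)"

text \<open>By \<open>separators_share\<close>, a separator of two arcs with a common end also ends
  there.\<close>

lemma starlike_common_end:
  assumes d: "d1 \<in> dyadic_arcs" "d2 \<in> dyadic_arcs" "d3 \<in> dyadic_arcs" and st: "starlike d1 d2 d3"
  shows "ends d1 \<inter> ends d2 \<inter> ends d3 \<noteq> {}"
proof -
  have *: "ends d \<inter> ends d' \<inter> ends f \<noteq> {}" if *: "d \<in> dyadic_arcs" "d' \<in> dyadic_arcs" "sharing d d'" "f \<in> separators d d'" for d d' f
  proof -
    obtain a where a: "a \<in> ends d" "a \<in> ends d'" using * sharing_iff by blast
    obtain b where b: "d = seg a b" "a \<in> dyadic_points" "b \<in> dyadic_points" "a \<noteq> b" using arc_with_end[OF *(1) a(1)] .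
    obtain c where c: "d' = seg a c" "c \<in> dyadic_points" "a \<noteq> c" using arc_with_end[OF *(2) a(2)] by metis
    have "a \<in> ends f" using separators_share[of f a b c] *(4) b c by simp
    then show ?thesis using a by blast
  qed
  show ?thesis using st *[of d2 d3 d1] *[of d1 d3 d2] *[of d1 d2 d3] d unfolding starlike_def by blast
qed

lemma common_end_starlike:
  assumes d: "d1 \<in> dyadic_arcs" "d2 \<in> dyadic_arcs" "d3 \<in> dyadic_arcs" "distinct [d1, d2, d3]"
    and a: "a \<in> ends d1" "a \<in> ends d2" "a \<in> ends d3"
  shows "starlike d1 d2 d3"
proof -
  obtain b where b: "d1 = seg a b" "a \<in> dyadic_points" "b \<in> dyadic_points" "a \<noteq> b" using arc_with_end[OF d(1) a(1)] .
  obtain c where c: "d2 = seg a c" "c \<in> dyadic_points" "a \<noteq> c" using arc_with_end[OF d(2) a(2)] by metis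
  obtain e where e: "d3 = seg a e" "e \<in> dyadic_points" "a \<noteq> e" using arc_with_end[OF d(3) a(3)] by metis
  have X: "{a, b, c, e} \<subseteq> dyadic_points" using b c e by simp
  have dis: "distinct [a, b, c, e]" using d(4) b c e by auto
  have "{a, b, c, e} \<subseteq> circle" using X dyadic_points_circle by blast
  from pairings_cross[OF this dis]
  have "d1 \<in> separators d2 d3 \<or> d2 \<in> separators d1 d3 \<or> d3 \<in> separators d1 d2"
  proof (elim disjE)
    assume "crosses (seg a b) (seg c e)"
    then show ?thesis unfolding b c e using separator_of_star[of a c b e] X dis by auto
  next
    assume "crosses (seg a c) (seg b e)"
    then show ?thesis unfolding b c e using separator_of_star[of a b c e] X dis by auto
  next
    assume "crosses (seg a e) (seg b c)"
    then show ?thesis unfolding b c e using separator_of_star[of a b e c] X dis by auto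
  qed
  then show ?thesis unfolding starlike_def using d a by (auto simp: sharing_iff)
qed

lemma two_other_points:
  obtains b c where "b \<in> dyadic_points" "c \<in> dyadic_points" "a \<noteq> b" "a \<noteq> c" "b \<noteq> (c :: point)"
proof -
  have "gam 0 \<in> dyadic_points" "gam (1/4) \<in> dyadic_points" "gam (1/2) \<in> dyadic_points"
    unfolding gam_mem_dyadic_points_iff using dyadicsI[of 0 0] dyadicsI[of 1 2] dyadicsI[of 1 1] by simp_all
  moreover have "gam 0 \<noteq> gam (1/4)" "gam 0 \<noteq> gam (1/2)" "gam (1/4) \<noteq> gam (1/2)"
    using gam_inj[of 0 "1/4"] gam_inj[of 0 "1/2"] gam_inj[of "1/4" "1/2"] by auto
  ultimately show ?thesis using that by metis
qed

text \<open>\<open>separators\<close>, \<open>sharing\<close> and \<open>starlike\<close> are built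
  from crossing alone, so \<open>\<beta>\<close> preserves them. The images of two arcs at
  \<open>a\<close> have exactly one common end, and every further arc at \<open>a\<close> forms a
  starlike triple with these two, so its image ends there too.\<close>

lemma arc_bij_vertex_image:
  assumes bij: "bij_betw \<beta> dyadic_arcs dyadic_arcs"
    and cr: "\<And>d d'. d \<in> dyadic_arcs \<Longrightarrow> d' \<in> dyadic_arcs \<Longrightarrow> crosses (\<beta> d) (\<beta> d') \<longleftrightarrow> crosses d d'"
    and a: "a \<in> dyadic_points"
  shows "\<exists>a'\<in>dyadic_points. \<forall>d\<in>dyadic_arcs. a \<in> ends d \<longrightarrow> a' \<in> ends (\<beta> d)"
proof -
  have bin: "\<beta> d \<in> dyadic_arcs" if "d \<in> dyadic_arcs" for d using bij that by (rule bij_betw_apply)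
  have surj: "\<exists>d\<in>dyadic_arcs. \<beta> d = e" if "e \<in> dyadic_arcs" for e using bij_betw_imp_surj_on[OF bij] that by (metis imageE)
  have inj: "\<beta> d = \<beta> d' \<longleftrightarrow> d = d'" if "d \<in> dyadic_arcs" "d' \<in> dyadic_arcs" for d d'
    using bij that by (metis bij_betw_def inj_on_eq_iff)
  have sep: "\<beta> f \<in> separators (\<beta> d) (\<beta> d') \<longleftrightarrow> f \<in> separators d d'" if "d \<in> dyadic_arcs" "d' \<in> dyadic_arcs" "f \<in> dyadic_arcs" for d d' f
  proof -
    \<comment> \<open>The quantifier over all arcs is re-indexed by the surjective
      \<open>\<beta>\<close>.\<close>
    have "(\<forall>x\<in>dyadic_arcs. crosses x (\<beta> d) \<and> crosses x (\<beta> d') \<longrightarrow> crosses x (\<beta> f)) \<longleftrightarrow>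
       (\<forall>x\<in>dyadic_arcs. crosses (\<beta> x) (\<beta> d) \<and> crosses (\<beta> x) (\<beta> d') \<longrightarrow> crosses (\<beta> x) (\<beta> f))"
      using surj bin by metis
    also have "\<dots> \<longleftrightarrow> (\<forall>x\<in>dyadic_arcs. crosses x d \<and> crosses x d' \<longrightarrow> crosses x f)"
      using cr that by simp
    finally show ?thesis unfolding separators_def using that bin by simp
  qed
  have sh: "sharing (\<beta> d) (\<beta> d')" if d: "d \<in> dyadic_arcs" "d' \<in> dyadic_arcs" "sharing d d'" for d d'
  proof -
    have "\<not> crosses f g" if fg: "f \<in> separators (\<beta> d) (\<beta> d')" "g \<in> separators (\<beta> d) (\<beta> d')" for f g
    proof -
      obtain f' where "f' \<in> dyadic_arcs" "f = \<beta> f'" using fg(1) surj by (auto simp: separators_def)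
      moreover obtain g' where "g' \<in> dyadic_arcs" "g = \<beta> g'" using fg(2) surj by (auto simp: separators_def)
      ultimately show ?thesis using fg sep d cr unfolding sharing_def by metis
    qed
    then show ?thesis using d inj cr unfolding sharing_def by blast
  qed
  have st: "starlike (\<beta> d1) (\<beta> d2) (\<beta> d3)" if "d1 \<in> dyadic_arcs" "d2 \<in> dyadic_arcs" "d3 \<in> dyadic_arcs" "starlike d1 d2 d3" for d1 d2 d3
    using that sh sep unfolding starlike_def by blast
  obtain b c where bc: "b \<in> dyadic_points" "c \<in> dyadic_points" "a \<noteq> b" "a \<noteq> c" "b \<noteq> c" using two_other_points .
  define d1 d2 where "d1 = seg a b" and "d2 = seg a c"
  have e12: "ends d1 = {a, b}" "ends d2 = {a, c}" using ends_seg a bc by (simp_all add: d1_def d2_def)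
  have d12: "d1 \<in> dyadic_arcs" "d2 \<in> dyadic_arcs" using a bc dyadic_arcI by (simp_all add: d1_def d2_def)
  have ne: "d1 \<noteq> d2" using e12 bc by auto
  then have "sharing d1 d2" using sharing_iff[OF d12] e12 by auto
  then have "sharing (\<beta> d1) (\<beta> d2)" using sh d12 by blast
  then obtain a' where a': "a' \<in> ends (\<beta> d1)" "a' \<in> ends (\<beta> d2)" using sharing_iff[OF bin[OF d12(1)] bin[OF d12(2)]] by blast
  have uniq: "x = a'" if x: "x \<in> ends (\<beta> d1)" "x \<in> ends (\<beta> d2)" for x
  proof (rule ccontr)
    assume "x \<noteq> a'"
    then have "\<beta> d1 = \<beta> d2" using arc_eq_ends[OF bin[OF d12(1)] x(1) a'(1)] arc_eq_ends[OF bin[OF d12(2)] x(2) a'(2)] by simp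
    then show False using inj d12 ne by blast
  qed
  have "a' \<in> ends (\<beta> d)" if d: "d \<in> dyadic_arcs" "a \<in> ends d" for d
  proof (cases "d = d1 \<or> d = d2")
    case False
    then have "starlike d1 d2 d" using common_end_starlike[of d1 d2 d a] d12 d ne e12 by auto
    then have "ends (\<beta> d1) \<inter> ends (\<beta> d2) \<inter> ends (\<beta> d) \<noteq> {}"
      using st[OF d12 d(1)] starlike_common_end[OF bin[OF d12(1)] bin[OF d12(2)] bin[OF d(1)]] by blast
    then show ?thesis using uniq by blast
  qed (use a' in blast)
  moreover have "a' \<in> dyadic_points" using arc_with_end[OF bin[OF d12(1)] a'(1)] by metis
  ultimately show ?thesis by blast
qed

text \<open>A point is determined by the arcs that end at it, so the vertex maps obtained from
  \<open>\<beta>\<close> and from its inverse are inverse to each other.\<close>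

lemma arc_bij_induced:
  assumes bij: "bij_betw \<beta> dyadic_arcs dyadic_arcs"
    and cr: "\<And>d d'. d \<in> dyadic_arcs \<Longrightarrow> d' \<in> dyadic_arcs \<Longrightarrow> crosses (\<beta> d) (\<beta> d') \<longleftrightarrow> crosses d d'"
  obtains \<sigma> where "bij_betw \<sigma> dyadic_points dyadic_points"
    "\<And>p q. p \<in> dyadic_points \<Longrightarrow> q \<in> dyadic_points \<Longrightarrow> p \<noteq> q \<Longrightarrow> \<beta> (seg p q) = seg (\<sigma> p) (\<sigma> q)"
proof -
  define \<gamma> where "\<gamma> = inv_into dyadic_arcs \<beta>"
  have bij': "bij_betw \<gamma> dyadic_arcs dyadic_arcs" unfolding \<gamma>_def using bij by (rule bij_betw_inv_into)
  have gb: "\<gamma> (\<beta> d) = d" "\<beta> (\<gamma> d) = d" "\<beta> d \<in> dyadic_arcs" "\<gamma> d \<in> dyadic_arcs" if "d \<in> dyadic_arcs" for d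
    using bij_betw_inv_into_left[OF bij that] bij_betw_inv_into_right[OF bij that] bij_betw_apply[OF bij that] bij_betw_apply[OF bij' that]
    by (simp_all add: \<gamma>_def)
  have cr': "crosses (\<gamma> d) (\<gamma> d') \<longleftrightarrow> crosses d d'" if "d \<in> dyadic_arcs" "d' \<in> dyadic_arcs" for d d'
    using cr[of "\<gamma> d" "\<gamma> d'"] gb that by simp
  have "\<forall>a\<in>dyadic_points. \<exists>a'. a' \<in> dyadic_points \<and> (\<forall>d\<in>dyadic_arcs. a \<in> ends d \<longrightarrow> a' \<in> ends (\<beta> d))"
    using arc_bij_vertex_image[OF bij cr] by blast
  then obtain \<sigma> where s: "\<And>a. a \<in> dyadic_points \<Longrightarrow> \<sigma> a \<in> dyadic_points"
     "\<And>a d. a \<in> dyadic_points \<Longrightarrow> d \<in> dyadic_arcs \<Longrightarrow> a \<in> ends d \<Longrightarrow> \<sigma> a \<in> ends (\<beta> d)" by metis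
  have "\<forall>a\<in>dyadic_points. \<exists>a'. a' \<in> dyadic_points \<and> (\<forall>d\<in>dyadic_arcs. a \<in> ends d \<longrightarrow> a' \<in> ends (\<gamma> d))"
    using arc_bij_vertex_image[OF bij' cr'] by blast
  then obtain \<tau> where t: "\<And>a. a \<in> dyadic_points \<Longrightarrow> \<tau> a \<in> dyadic_points"
     "\<And>a d. a \<in> dyadic_points \<Longrightarrow> d \<in> dyadic_arcs \<Longrightarrow> a \<in> ends d \<Longrightarrow> \<tau> a \<in> ends (\<gamma> d)" by metis
  have determined: "x = a" if "a \<in> dyadic_points" "\<And>d. d \<in> dyadic_arcs \<Longrightarrow> a \<in> ends d \<Longrightarrow> x \<in> ends d" for a x
  proof -
    obtain b c where bc: "b \<in> dyadic_points" "c \<in> dyadic_points" "a \<noteq> b" "a \<noteq> c" "b \<noteq> c" using two_other_points .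
    have "x \<in> {a, b}" "x \<in> {a, c}"
      using that(2)[of "seg a b"] that(2)[of "seg a c"] ends_seg[OF that(1) bc(1)] ends_seg[OF that(1) bc(2)]
        dyadic_arcI[OF that(1) bc(1)] dyadic_arcI[OF that(1) bc(2)] bc by auto
    then show ?thesis using bc by blast
  qed
  have ts: "\<tau> (\<sigma> a) = a" if a: "a \<in> dyadic_points" for a
  proof (rule determined[OF a])
    fix d assume d: "d \<in> dyadic_arcs" "a \<in> ends d"
    show "\<tau> (\<sigma> a) \<in> ends d" using t(2)[OF s(1)[OF a] gb(3)[OF d(1)] s(2)[OF a d]] gb(1)[OF d(1)] by simp
  qed
  have st: "\<sigma> (\<tau> a) = a" if a: "a \<in> dyadic_points" for a
  proof (rule determined[OF a])
    fix d assume d: "d \<in> dyadic_arcs" "a \<in> ends d"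
    show "\<sigma> (\<tau> a) \<in> ends d" using s(2)[OF t(1)[OF a] gb(4)[OF d(1)] t(2)[OF a d]] gb(2)[OF d(1)] by simp
  qed
  have "bij_betw \<sigma> dyadic_points dyadic_points"
    by (rule bij_betw_byWitness[of _ \<tau>]) (use s t st ts in auto)
  moreover have "\<beta> (seg p q) = seg (\<sigma> p) (\<sigma> q)" if pq: "p \<in> dyadic_points" "q \<in> dyadic_points" "p \<noteq> q" for p q
  proof (rule arc_eq_ends)
    have d: "seg p q \<in> dyadic_arcs" using pq by (rule dyadic_arcI)
    then show "\<beta> (seg p q) \<in> dyadic_arcs" by (rule gb)
    show "\<sigma> p \<in> ends (\<beta> (seg p q))" "\<sigma> q \<in> ends (\<beta> (seg p q))" using s(2)[OF _ d] ends_seg pq by simp_all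
    show "\<sigma> p \<noteq> \<sigma> q" using ts pq by metis
  qed
  ultimately show ?thesis using that by blast
qed

section \<open>Piecewise linear circle maps\<close>

text \<open>The normal form for the Thompson group: one affine formula per interval of a uniform
  level. By \<open>T_noI\<close> and \<open>T_no_dyadic_affine\<close>, it characterizes membership
  among the maps satisfying \<open>dyadic_homeo\<close>.\<close>

definition dyadic_affine :: "(point \<Rightarrow> point) \<Rightarrow> nat \<Rightarrow> bool" where
  "dyadic_affine h N \<longleftrightarrow> (\<forall>m::int. 0 \<le> m \<and> m < 2 ^ N \<longrightarrow>
     (\<exists>e k c. (e = 1 \<or> e = - 1) \<and> c \<in> dyadics \<and>
        (\<forall>u\<in>{of_int m / 2 ^ N..(of_int m + 1) / 2 ^ N}. h (gam u) = gam (e * 2 powi k * u + c))))"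

definition dyadic_homeo :: "(point \<Rightarrow> point) \<Rightarrow> bool" where
  "dyadic_homeo h \<longleftrightarrow> h \<in> Bij circle \<and> continuous_on circle h \<and> h ` dyadic_points = dyadic_points"

text \<open>The lift minus the affine function is integer valued near \<open>s\<close> within the
  interval and continuous at \<open>s\<close>, so it is constant there and has derivative 0. Since
  \<open>s\<close> may be an end of the interval, the derivative at possible break points is
  covered.\<close>

lemma circle_derivative_unique:
  assumes ab: "a < b" "s \<in> {a..b}" and lin: "\<And>u. u \<in> {a..b} \<Longrightarrow> h (gam u) = gam (m * u + c)"
    and d: "has_circle_derivative h d s"
  shows "d = m"
proof -
  obtain g where g: "\<forall>\<^sub>F u in nhds s. h (gam u) = gam (g u)" "(g has_real_derivative d) (at s)"
    using d unfolding has_circle_derivative_def by blast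
  obtain e1 where e1: "e1 > 0" "\<And>u. dist u s < e1 \<Longrightarrow> h (gam u) = gam (g u)"
    using g(1) unfolding eventually_nhds_metric by blast
  define f where "f u = g u - (m * u + c)" for u
  have f: "(f has_real_derivative (d - m)) (at s)"
    unfolding f_def using g(2) by (auto intro!: derivative_eq_intros)
  then have "isCont f s" by (rule DERIV_isCont)
  then obtain e2 where e2: "e2 > 0" "\<And>u. dist u s < e2 \<Longrightarrow> dist (f u) (f s) < 1"
    unfolding continuous_at_eps_delta by (metis zero_less_one)
  define e where "e = min e1 e2"
  have int: "\<exists>i::int. f u = of_int i" if "u \<in> {a..b}" "dist u s < e" for u
  proof -
    have "gam (g u) = gam (m * u + c)" using lin[OF that(1)] e1(2)[of u] that by (simp add: e_def)
    then show ?thesis unfolding gam_eq_iff f_def by auto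
  qed
  have const: "f s = f u" if u: "u \<in> {a..b}" "dist u s < e" for u
  proof -
    obtain i j :: int where "f u = of_int i" "f s = of_int j" using int[OF u] int[of s] ab e1 e2 by (auto simp: e_def)
    then show ?thesis using e2(2)[of u] u by (simp add: e_def dist_real_def)
  qed
  have "((\<lambda>_. f s) has_vector_derivative 0) (at s within cbox a b)" by simp
  then have "(f has_vector_derivative 0) (at s within cbox a b)"
    by (rule has_vector_derivative_transform_within[where d=e and f="\<lambda>_. f s"]) (use const e1(1) e2(1) ab in \<open>simp_all add: e_def\<close>)
  moreover have "(f has_vector_derivative (d - m)) (at s within cbox a b)"
    using f has_vector_derivative_at_within by (metis has_real_derivative_iff_has_vector_derivative)
  ultimately have "0 = d - m"
    using vector_derivative_unique_within_closed_interval[OF ab(1), of s f 0 "d - m"] ab by simp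
  then show ?thesis by simp
qed

lemma affine_has_circle_derivative:
  assumes "a < s" "s < b" and lin: "\<And>u. u \<in> {a<..<b} \<Longrightarrow> h (gam u) = gam (m * u + c)"
  shows "has_circle_derivative h m s"
  unfolding has_circle_derivative_def
proof (intro exI conjI)
  show "\<forall>\<^sub>F u in nhds s. h (gam u) = gam (m * u + c)"
    unfolding eventually_nhds using assms by (intro exI[of _ "{a<..<b}"]) auto
  show "((\<lambda>u. m * u + c) has_real_derivative m) (at s)" by (auto intro!: derivative_eq_intros)
qed

lemma abs_slope: "e = 1 \<or> e = - 1 \<Longrightarrow> \<bar>e * 2 powi k :: real\<bar> = 2 powi k"
  by (auto simp: abs_mult)

lemma T_no_carrier: "carrier T_no = {h \<in> Bij circle.
        (\<exists>k. homeomorphism circle circle h k) \<and>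
        piecewise_linear h \<and>
        h ` dyadic_points = dyadic_points \<and>
        (\<exists>S. finite S \<and> S \<subseteq> dyadics \<inter> {0..1} \<and>
           (\<forall>s\<in>{0..1} - S. \<exists>d. has_circle_derivative h d s)) \<and>
        (\<forall>s\<in>{0..1}. \<forall>d. has_circle_derivative h d s \<longrightarrow> (\<exists>k :: int. \<bar>d\<bar> = 2 powi k))}"
  by (simp add: T_no_def)

lemma level_interval:
  fixes s :: real
  assumes "0 \<le> s" "s < 1"
  obtains m :: int where "0 \<le> m" "m < 2 ^ N" "of_int m / 2 ^ N \<le> s" "s < (of_int m + 1) / 2 ^ N" "m = \<lfloor>s * 2 ^ N\<rfloor>"
proof -
  define m where "m = \<lfloor>s * 2 ^ N\<rfloor>"
  have m: "of_int m \<le> s * 2 ^ N" "s * 2 ^ N < of_int m + 1" unfolding m_def by linarith+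
  have "s * 2 ^ N < 2 ^ N" using assms by simp
  then have "real_of_int m < 2 ^ N" using m by linarith
  then have "real_of_int m < real_of_int (2 ^ N)" by (simp only: of_int_power of_int_numeral)
  then have "m < 2 ^ N" by (simp only: of_int_less_iff)
  moreover have "0 \<le> m" unfolding m_def using assms by simp
  ultimately show ?thesis using that[of m] m by (simp add: m_def field_simps)
qed

text \<open>Only points of level \<open>N\<close> can be break points. The map may be differentiable
  at some of them; the condition on the derivative is verified there from the interval on one
  side.\<close>

lemma T_noI:
  assumes h: "dyadic_homeo h" and aff: "dyadic_affine h N"
  shows "h \<in> carrier T_no"
proof -
  have Bij: "h \<in> Bij circle" and cont: "continuous_on circle h" and dy: "h ` dyadic_points = dyadic_points"
    using h by (simp_all add: dyadic_homeo_def)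
  have "bij_betw h circle circle" using Bij by (simp add: Bij_def)
  moreover have "compact circle" by (simp add: circle_def)
  ultimately have hom: "\<exists>k. homeomorphism circle circle h k"
    using cont by (intro homeomorphism_compact) (auto simp: bij_betw_def)
  \<comment> \<open>Containing 0 and 1 and all points of level \<open>N\<close> between them,
    \<open>S\<close> confines any interval that avoids it to one interval of level
    \<open>N\<close>.\<close>
  define S :: "real set" where "S = (\<lambda>m::int. of_int m / 2 ^ N) ` {0..2 ^ N}"
  have S1: "of_int m / 2 ^ N \<in> S" if "0 \<le> m" "m \<le> 2 ^ N" for m :: int using that by (auto simp: S_def)
  have S01: "0 \<in> S" "1 \<in> S" using S1[of 0] S1[of "2 ^ N"] by simp_all
  have finS: "finite S" by (simp add: S_def)
  have Sd: "S \<subseteq> dyadics \<inter> {0..1}"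
  proof
    fix s assume "s \<in> S"
    then obtain m :: int where m: "s = of_int m / 2 ^ N" "0 \<le> m" "m \<le> 2 ^ N" by (auto simp: S_def)
    then have "real_of_int m \<le> of_int (2 ^ N)" by linarith
    then show "s \<in> dyadics \<inter> {0..1}" using m by auto
  qed
  have pl: "piecewise_linear h" unfolding piecewise_linear_def
  proof (intro exI[of _ S] conjI allI impI finS)
    fix a b :: real assume ab: "a < b \<and> {a<..<b} \<subseteq> {0..1} - S"
    define s where "s = (a + b) / 2"
    have s: "a < s" "s < b" using ab by (auto simp: s_def)
    then have "s \<in> {0..1} - S" using ab by auto
    then have "0 \<le> s" "s < 1" using S01 by (auto simp: order_less_le)
    then obtain m :: int where m: "0 \<le> m" "m < 2 ^ N" "of_int m / 2 ^ N \<le> s" "s < (of_int m + 1) / 2 ^ N"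
      using level_interval by metis
    have ms: "of_int m / 2 ^ N \<in> S" "(of_int m + 1) / 2 ^ N \<in> S" using S1[of m] S1[of "m + 1"] m by auto
    have sub: "u \<in> {of_int m / 2 ^ N..(of_int m + 1) / 2 ^ N}" if u: "u \<in> {a<..<b}" for u
    proof (rule ccontr)
      assume "\<not> ?thesis"
      then have "u < of_int m / 2 ^ N \<or> (of_int m + 1) / 2 ^ N < u" by auto
      then have "of_int m / 2 ^ N \<in> {a<..<b} \<or> (of_int m + 1) / 2 ^ N \<in> {a<..<b}" using u s m by auto
      then show False using ab ms by blast
    qed
    obtain e k c where "\<forall>u\<in>{of_int m / 2 ^ N..(of_int m + 1) / 2 ^ N}. h (gam u) = gam (e * 2 powi k * u + c)"
      using aff m unfolding dyadic_affine_def by blast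
    then show "\<exists>m c. \<forall>u\<in>{a<..<b}. h (gam u) = gam (m * u + c)" using sub by blast
  qed
  have diff: "\<exists>d. has_circle_derivative h d s" if s: "s \<in> {0..1} - S" for s
  proof -
    have "0 \<le> s" "s < 1" using s S01 by (auto simp: order_less_le)
    then obtain m :: int where m: "0 \<le> m" "m < 2 ^ N" "of_int m / 2 ^ N \<le> s" "s < (of_int m + 1) / 2 ^ N"
      using level_interval by metis
    have "of_int m / 2 ^ N \<noteq> s" using S1[of m] m s by auto
    then have "of_int m / 2 ^ N < s" using m by simp
    moreover obtain e k c where "\<forall>u\<in>{of_int m / 2 ^ N..(of_int m + 1) / 2 ^ N}. h (gam u) = gam (e * 2 powi k * u + c)"
      using aff m unfolding dyadic_affine_def by blast
    ultimately have "has_circle_derivative h (e * 2 powi k) s"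
      using m by (intro affine_has_circle_derivative[where c=c and a="of_int m / 2 ^ N" and b="(of_int m + 1) / 2 ^ N"]) auto
    then show ?thesis by blast
  qed
  have slope: "\<exists>k :: int. \<bar>d\<bar> = 2 powi k" if s: "s \<in> {0..1}" "has_circle_derivative h d s" for s d
  proof -
    have "\<exists>m::int. 0 \<le> m \<and> m < 2 ^ N \<and> s \<in> {of_int m / 2 ^ N..(of_int m + 1) / 2 ^ N}"
    proof (cases "s < 1")
      case True
      then obtain m :: int where "0 \<le> m" "m < 2 ^ N" "of_int m / 2 ^ N \<le> s" "s < (of_int m + 1) / 2 ^ N"
        using level_interval[of s N] s(1) by (metis atLeastAtMost_iff)
      then show ?thesis by (intro exI[of _ m]) simp
    next
      case False
      then have "s = 1" using s by auto
      then show ?thesis by (intro exI[of _ "2 ^ N - 1"]) (auto simp: field_simps)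
    qed
    then obtain m :: int where m: "0 \<le> m" "m < 2 ^ N" "s \<in> {of_int m / 2 ^ N..(of_int m + 1) / 2 ^ N}" by blast
    obtain e k c where e: "e = 1 \<or> e = - 1" "\<forall>u\<in>{of_int m / 2 ^ N..(of_int m + 1) / 2 ^ N}. h (gam u) = gam (e * 2 powi k * u + c)"
      using aff m unfolding dyadic_affine_def by blast
    have "d = e * 2 powi k"
      by (rule circle_derivative_unique[OF _ m(3) _ s(2)]) (use e(2) in \<open>auto simp: field_simps\<close>)
    then show ?thesis using abs_slope[OF e(1)] by blast
  qed
  show ?thesis unfolding T_no_carrier
  proof (intro CollectI conjI)
    show "\<exists>S. finite S \<and> S \<subseteq> dyadics \<inter> {0..1} \<and> (\<forall>s\<in>{0..1} - S. \<exists>d. has_circle_derivative h d s)"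
      using finS Sd diff by (intro exI[of _ S]) blast
    show "\<forall>s\<in>{0..1}. \<forall>d. has_circle_derivative h d s \<longrightarrow> (\<exists>k :: int. \<bar>d\<bar> = 2 powi k)"
      using slope by blast
  qed (fact Bij hom pl dy)+
qed

lemma finite_dyadics_level:
  assumes "finite S" "S \<subseteq> dyadics" obtains N where "\<And>s. s \<in> S \<Longrightarrow> \<exists>i::int. s = of_int i / 2 ^ N"
proof -
  have "\<exists>N. \<forall>s\<in>S. \<exists>i::int. s = of_int i / 2 ^ N" using assms
  proof (induction S rule: finite_induct)
    case (insert s S)
    then obtain N where N: "\<forall>s\<in>S. \<exists>i::int. s = of_int i / 2 ^ N" by auto
    obtain j k where s: "s = of_int j / 2 ^ k" using insert.prems dyadicsE[of s] by auto
    have "\<exists>i::int. r = of_int i / 2 ^ (N + k)" if r: "r \<in> insert s S" for r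
    proof (cases "r = s")
      case True
      then show ?thesis using s dyadics_raise[of j k N] by (metis add.commute)
    next
      case False
      then obtain i :: int where "r = of_int i / 2 ^ N" using N r by auto
      then show ?thesis using dyadics_raise[of i N k] by metis
    qed
    then show ?case by blast
  qed auto
  then show ?thesis using that by blast
qed

section \<open>From the definition of the Thompson group to the normal form\<close>

lemma affine_mod_unique:
  assumes ab: "a < b" and eq: "\<And>u. u \<in> {a<..<b} \<Longrightarrow> gam (m * u + c) = gam (m' * u + c')"
  shows "m = m'" "\<exists>i::int. c = c' + of_int i"
proof -
  show mm: "m = m'"
  proof (rule ccontr)
    assume ne: "m \<noteq> m'"
    \<comment> \<open>Over a step of this length the two affine functions drift apart by at most
      1/4, while the drift is an integer.\<close>
    define t where "t = min (b - a) (1 / \<bar>m - m'\<bar>) / 4"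
    have pos: "\<bar>m - m'\<bar> > 0" using ne by simp
    have t: "t > 0" "t \<le> (b - a) / 4" "t \<le> (1 / \<bar>m - m'\<bar>) / 4" using ab pos by (auto simp: t_def)
    define u where "u = (a + b) / 2"
    have u: "u \<in> {a<..<b}" "u + t \<in> {a<..<b}" using ab t by (auto simp: u_def field_simps)
    obtain i :: int where i: "m * u + c = m' * u + c' + of_int i" using eq[OF u(1)] gam_eq_iff by blast
    obtain j :: int where j: "m * (u + t) + c = m' * (u + t) + c' + of_int j" using eq[OF u(2)] gam_eq_iff by blast
    have "(m - m') * t = of_int (j - i)" using i j by (simp add: algebra_simps)
    moreover have "\<bar>(m - m') * t\<bar> \<le> 1 / 4"
    proof -
      have "\<bar>m - m'\<bar> * t \<le> \<bar>m - m'\<bar> * ((1 / \<bar>m - m'\<bar>) / 4)" using t(3) pos by (intro mult_left_mono) auto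
      also have "\<dots> = 1 / 4" using pos by simp
      finally show ?thesis using t(1) by (simp add: abs_mult)
    qed
    ultimately have "\<bar>real_of_int (j - i)\<bar> \<le> 1 / 4" by simp
    then have "j - i = 0" by linarith
    then show False using \<open>(m - m') * t = of_int (j - i)\<close> ne t(1) by simp
  qed
  have "(a + b) / 2 \<in> {a<..<b}" using ab by auto
  from eq[OF this] show "\<exists>i::int. c = c' + of_int i" unfolding mm gam_eq_iff by auto
qed

lemma affine_mod_extend:
  assumes cont: "continuous_on circle h" and ab: "a < b"
    and lin: "\<And>u. u \<in> {a<..<b} \<Longrightarrow> h (gam u) = gam (m * u + c)" and u: "u \<in> {a..b}"
  shows "h (gam u) = gam (m * u + c)"
proof -
  have "continuous_on {a..b} (\<lambda>u. h (gam u) - gam (m * u + c))"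
  proof (intro continuous_on_diff)
    show "continuous_on {a..b} (\<lambda>u. h (gam u))"
      using continuous_on_compose2[OF cont continuous_gam] gam_circle by blast
    show "continuous_on {a..b} (\<lambda>u. gam (m * u + c))"
      by (rule continuous_on_compose2[OF continuous_gam[of UNIV]]) (auto intro!: continuous_intros)
  qed
  then have "closed {u \<in> {a..b}. h (gam u) - gam (m * u + c) = 0}"
    by (intro continuous_closed_preimage_constant) auto
  moreover have "{a<..<b} \<subseteq> {u \<in> {a..b}. h (gam u) - gam (m * u + c) = 0}" using lin by auto
  ultimately have "closure {a<..<b} \<subseteq> {u \<in> {a..b}. h (gam u) - gam (m * u + c) = 0}" by (intro closure_minimal)
  then show ?thesis using u ab by auto
qed

text \<open>\<open>piecewise_linear\<close> allows break points unrelated to \<open>S\<close>. At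
  such a point outside \<open>S\<close> the derivative exists and equals the slopes on both sides,
  and the constants agree up to an integer because the map has a single value there.\<close>

lemma T_no_locally_affine:
  assumes h: "h \<in> carrier T_no" and S: "\<And>s. s \<in> {0..1} - S \<Longrightarrow> \<exists>d. has_circle_derivative h d s"
    and s: "s \<in> {0<..<1}" "s \<notin> S"
  shows "\<exists>t>0. \<exists>m c. \<forall>u\<in>{s - t<..<s + t}. h (gam u) = gam (m * u + c)"
proof -
  have pl: "piecewise_linear h" and cont: "continuous_on circle h"
    using h unfolding T_no_carrier homeomorphism_def by auto
  obtain S1 where S1: "finite S1"
    "\<And>a b. a < b \<Longrightarrow> {a<..<b} \<subseteq> {0..1} - S1 \<Longrightarrow> \<exists>m c. \<forall>u\<in>{a<..<b}. h (gam u) = gam (m * u + c)"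
    using pl unfolding piecewise_linear_def by blast
  \<comment> \<open>The point \<open>s\<close> is kept, as it may itself be one of the break points
    in \<open>S1\<close>.\<close>
  have "open ({0<..<1} - (S1 - {s}))" using S1(1) by (intro open_Diff finite_imp_closed) auto
  moreover have "s \<in> {0<..<1} - (S1 - {s})" using s by auto
  ultimately obtain t where t: "t > 0" "ball s t \<subseteq> {0<..<1} - (S1 - {s})" unfolding open_contains_ball by blast
  have b: "ball s t = {s - t<..<s + t}" by (auto simp: dist_real_def)
  have "{s - t<..<s} \<subseteq> {0..1} - S1" "{s<..<s + t} \<subseteq> {0..1} - S1"
  proof -
    have "u \<in> {0..1} - S1" if "u \<in> {s - t<..<s + t}" "u \<noteq> s" for u
      using subsetD[OF t(2), of u] that unfolding b by auto
    then show "{s - t<..<s} \<subseteq> {0..1} - S1" "{s<..<s + t} \<subseteq> {0..1} - S1" using t(1) by (intro subsetI; simp)+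
  qed
  then obtain m1 c1 m2 c2 where l: "\<And>u. u \<in> {s - t<..<s} \<Longrightarrow> h (gam u) = gam (m1 * u + c1)"
    "\<And>u. u \<in> {s<..<s + t} \<Longrightarrow> h (gam u) = gam (m2 * u + c2)"
  proof -
    have "s - t < s" "s < s + t" using t by auto
    with S1(2) \<open>{s - t<..<s} \<subseteq> {0..1} - S1\<close> \<open>{s<..<s + t} \<subseteq> {0..1} - S1\<close> show ?thesis using that by meson
  qed
  have lt: "s - t < s" "s < s + t" using t by auto
  have l': "h (gam u) = gam (m1 * u + c1)" if "u \<in> {s - t..s}" for u
    using affine_mod_extend[OF cont lt(1) l(1) that] .
  have r': "h (gam u) = gam (m2 * u + c2)" if "u \<in> {s..s + t}" for u
    using affine_mod_extend[OF cont lt(2) l(2) that] .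
  obtain d where d: "has_circle_derivative h d s" using S[of s] s by auto
  have "d = m1" using circle_derivative_unique[OF lt(1) _ l' d] t by auto
  moreover have "d = m2" using circle_derivative_unique[OF lt(2) _ r' d] t by auto
  ultimately have mm: "m1 = m2" by simp
  have "gam (m1 * s + c1) = gam (m1 * s + c2)" using l'[of s] r'[of s] t mm by auto
  then obtain i :: int where "m1 * s + c1 = m1 * s + c2 + of_int i" unfolding gam_eq_iff by blast
  then have i: "c1 = c2 + of_int i" by simp
  have "h (gam u) = gam (m1 * u + c2)" if u: "u \<in> {s - t<..<s + t}" for u
  proof (cases "u \<le> s")
    case True
    then have "h (gam u) = gam (m1 * u + c2 + of_int i)" using l'[of u] u i by (simp add: add.assoc)
    then show ?thesis by simp
  qed (use r'[of u] u mm in auto)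
  then show ?thesis using t(1) by blast
qed

text \<open>Having the same formula up to an integer constant is an equivalence relation that is
  locally trivial, hence trivial on a connected interval.\<close>

lemma T_no_affine_between:
  assumes h: "h \<in> carrier T_no" and S: "\<And>s. s \<in> {0..1} - S \<Longrightarrow> \<exists>d. has_circle_derivative h d s"
    and pq: "p < q" "{p<..<q} \<subseteq> {0<..<1} - S"
  shows "\<exists>m c. \<forall>u\<in>{p<..<q}. h (gam u) = gam (m * u + c)"
proof -
  have "\<forall>s\<in>{p<..<q}. \<exists>t m c. t > 0 \<and> (\<forall>u\<in>{s - t<..<s + t}. h (gam u) = gam (m * u + c))"
    using T_no_locally_affine[OF h S] pq by blast
  then obtain T M C where loc: "\<And>s. s \<in> {p<..<q} \<Longrightarrow> T s > 0"
    "\<And>s u. s \<in> {p<..<q} \<Longrightarrow> u \<in> {s - T s<..<s + T s} \<Longrightarrow> h (gam u) = gam (M s * u + C s)" by metis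
  define R where "R x y \<longleftrightarrow> M x = M y \<and> (\<exists>i::int. C x = C y + of_int i)" for x y
  have R_sym: "R y x" if r: "R x y" for x y
  proof -
    obtain i :: int where "M x = M y" "C x = C y + of_int i" using r unfolding R_def by blast
    then show ?thesis unfolding R_def by (intro conjI exI[of _ "- i"]) auto
  qed
  have R_trans: "R x z" if r: "R x y" "R y z" for x y z
  proof -
    obtain i j :: int where "M x = M y" "C x = C y + of_int i" "M y = M z" "C y = C z + of_int j" using r unfolding R_def by blast
    then show ?thesis unfolding R_def by (intro conjI exI[of _ "i + j"]) auto
  qed
  have R_loc: "\<exists>U. openin (top_of_set {p<..<q}) U \<and> a \<in> U \<and> (\<forall>x\<in>U. R a x)" if a: "a \<in> {p<..<q}" for a
  proof (intro exI conjI ballI)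
    let ?U = "{p<..<q} \<inter> {a - T a<..<a + T a}"
    show "openin (top_of_set {p<..<q}) ?U" by (intro openin_open_Int) simp
    show "a \<in> ?U" using a loc(1)[OF a] by auto
    fix x assume x: "x \<in> ?U"
    define l r where "l = max (a - T a) (x - T x)" and "r = min (a + T a) (x + T x)"
    have "l < x" "x < r" using x loc(1)[of x] by (auto simp: l_def r_def)
    then have lr: "l < r" by simp
    have "gam (M a * u + C a) = gam (M x * u + C x)" if "u \<in> {l<..<r}" for u
      using loc(2)[OF a, of u] loc(2)[of x u] x that by (auto simp: l_def r_def)
    then show "R a x" unfolding R_def using affine_mod_unique[OF lr, of "M a" "C a" "M x" "C x"] by blast
  qed
  define s where "s = (p + q) / 2"
  have s: "s \<in> {p<..<q}" using pq by (auto simp: s_def)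
  have "h (gam u) = gam (M s * u + C s)" if u: "u \<in> {p<..<q}" for u
  proof -
    have "connected {p<..<q}" by simp
    from connected_equivalence_relation[OF this u s, of R] have "R u s" using R_sym R_trans R_loc by blast
    then obtain i :: int where i: "M u = M s" "C u = C s + of_int i" unfolding R_def by blast
    have "h (gam u) = gam (M u * u + C u)" using loc[OF u] by auto
    also have "\<dots> = gam (M s * u + C s + of_int i)" by (simp add: i add.assoc)
    finally show ?thesis by simp
  qed
  then show ?thesis by blast
qed

lemma T_no_dyadic_homeo: "h \<in> carrier T_no \<Longrightarrow> dyadic_homeo h"
  unfolding T_no_carrier dyadic_homeo_def homeomorphism_def mem_Collect_eq by meson

text \<open>Choose \<open>N\<close> so that all points of \<open>S\<close> have level
  \<open>N\<close>. Between neighbours of that level the map is affine, its slope is a derivative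
  and so of the right form, and the constant is dyadic because the left end goes to a dyadic
  point.\<close>

lemma T_no_dyadic_affine:
  assumes h: "h \<in> carrier T_no" obtains N where "dyadic_affine h N"
proof -
  obtain S where S: "finite S" "S \<subseteq> dyadics \<inter> {0..1}" "\<And>s. s \<in> {0..1} - S \<Longrightarrow> \<exists>d. has_circle_derivative h d s"
    using h unfolding T_no_carrier by blast
  have slope: "\<exists>k :: int. \<bar>d\<bar> = 2 powi k" if "s \<in> {0..1}" "has_circle_derivative h d s" for s d
    using h that unfolding T_no_carrier by blast
  have cont: "continuous_on circle h" and dy: "h ` dyadic_points = dyadic_points"
    using T_no_dyadic_homeo[OF h] by (auto simp: dyadic_homeo_def)
  obtain N where N: "\<And>s. s \<in> S \<Longrightarrow> \<exists>i::int. s = of_int i / 2 ^ N"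
    using finite_dyadics_level[of S] S(1,2) by blast
  have "\<exists>e k c. (e = 1 \<or> e = - 1) \<and> c \<in> dyadics \<and>
        (\<forall>u\<in>{of_int m / 2 ^ N..(of_int m + 1) / 2 ^ N}. h (gam u) = gam (e * 2 powi k * u + c))"
    if m: "0 \<le> m" "m < 2 ^ N" for m :: int
  proof -
    let ?p = "of_int m / 2 ^ N :: real" and ?q = "(of_int m + 1) / 2 ^ N :: real"
    have pq: "?p < ?q" by (simp add: field_simps)
    have "real_of_int (m + 1) \<le> of_int (2 ^ N)" using m by linarith
    then have p0: "0 \<le> ?p" "?q \<le> 1" using m by (simp_all add: field_simps)
    have "u \<notin> S" if u: "u \<in> {?p<..<?q}" for u
    proof
      assume "u \<in> S"
      then obtain i :: int where i: "u = of_int i / 2 ^ N" using N by blast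
      then have "real_of_int m < of_int i" "real_of_int i < of_int m + 1" using u by (auto simp: field_simps)
      then have "m < i" "i < m + 1" by (metis of_int_less_iff, metis of_int_less_iff of_int_add of_int_1)
      then show False by linarith
    qed
    moreover have "u \<in> {0<..<1}" if "u \<in> {?p<..<?q}" for u
      using that p0 unfolding greaterThanLessThan_iff by linarith
    ultimately have sub: "{?p<..<?q} \<subseteq> {0<..<1} - S" by blast
    obtain a c where ac: "\<forall>u\<in>{?p<..<?q}. h (gam u) = gam (a * u + c)" using T_no_affine_between[OF h S(3) pq sub] by blast
    have cl: "h (gam u) = gam (a * u + c)" if "u \<in> {?p..?q}" for u
      using affine_mod_extend[OF cont pq _ that] ac by blast
    obtain s where s: "?p < s" "s < ?q" using dense[OF pq] by blast
    have "has_circle_derivative h a s" using affine_has_circle_derivative[OF s] ac by blast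
    moreover have "s \<in> {0..1}" using s p0 unfolding atLeastAtMost_iff by linarith
    ultimately obtain k where k: "\<bar>a\<bar> = 2 powi k" using slope by blast
    define e :: real where "e = (if a \<ge> 0 then 1 else - 1)"
    have e: "e = 1 \<or> e = - 1" "a = e * 2 powi k" using k by (auto simp: e_def)
    have "gam ?p \<in> dyadic_points" using gam_mem_dyadic_points_iff by blast
    then have "gam (a * ?p + c) \<in> dyadic_points" using cl[of ?p] pq dy by (metis atLeastAtMost_iff image_eqI less_imp_le order_refl)
    then have "a * ?p + c \<in> dyadics" by (simp add: gam_mem_dyadic_points_iff)
    moreover have "a \<in> dyadics" using e dyadics_uminus[of "2 powi k"] by auto
    then have "a * ?p \<in> dyadics" by (intro dyadics_mult) auto
    ultimately have "a * ?p + c - a * ?p \<in> dyadics" by (rule dyadics_diff)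
    then have "c \<in> dyadics" by simp
    then show ?thesis using e cl by blast
  qed
  then have "dyadic_affine h N" unfolding dyadic_affine_def by blast
  then show ?thesis by (rule that)
qed

section \<open>Circle homeomorphisms preserve noncrossing\<close>

lemma connected_same_side:
  assumes "connected K" "K \<subseteq> circle - {p, q}" "p \<in> circle" "q \<in> circle" "p \<noteq> q" "u \<in> K" "v \<in> K"
  shows "\<not> side p q u * side p q v < 0"
proof
  assume neg: "side p q u * side p q v < 0"
  have c: "connected (side p q ` K)"
    using assms(1) by (intro connected_continuous_image continuous_side)
  have "0 \<in> side p q ` K"
    using connectedD_interval[OF c, of "side p q u" "side p q v" 0] connectedD_interval[OF c, of "side p q v" "side p q u" 0] neg assms(6,7)
    by (auto simp: mult_less_0_iff)
  then obtain w where "w \<in> K" "side p q w = 0" by (metis imageE)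
  then show False using side_eq_0_iff[of p q w] assms by blast
qed

text \<open>The two sides of the chord cut the circle into two open arcs, each the image of an
  interval under \<open>gam\<close>.\<close>

lemma same_side_connected:
  assumes c: "p \<in> circle" "q \<in> circle" "p \<noteq> q" "u \<in> circle" "v \<in> circle" and s: "side p q u * side p q v > 0"
  obtains K where "connected K" "K \<subseteq> circle - {p, q}" "u \<in> K" "v \<in> K"
proof -
  obtain x where x: "p = gam x" using circle_param[OF c(1)] by metis
  obtain y where y: "x \<le> y" "y < x + 1" "q = gam y" using circle_param[OF c(2)] by metis
  have xy: "x < y" using y c(3) x by (cases "x = y") auto
  obtain z where z: "x \<le> z" "z < x + 1" "u = gam z" using circle_param[OF c(4)] by metis
  obtain w where w: "x \<le> w" "w < x + 1" "v = gam w" using circle_param[OF c(5)] by metis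
  have conn: "connected (gam ` I)" if "connected I" for I :: "real set"
    using that continuous_gam by (rule connected_continuous_image[rotated])
  have avoid: "gam ` I \<subseteq> circle - {p, q}" if I: "\<And>t. t \<in> I \<Longrightarrow> x < t \<and> t < x + 1 \<and> t \<noteq> y" for I
  proof -
    have "gam t \<noteq> p" "gam t \<noteq> q" if "t \<in> I" for t
      using gam_inj[of t x] gam_inj[of t y] I[OF that] xy y unfolding x y(3) by (auto simp: abs_less_iff)
    then show ?thesis using gam_circle by (intro image_subsetI) blast
  qed
  consider "side p q u < 0" "side p q v < 0" | "side p q u > 0" "side p q v > 0" using s by (auto simp: zero_less_mult_iff)
  then show ?thesis
  proof cases
    case 1
    then have "z \<in> {x<..<y}" "w \<in> {x<..<y}" using side_gam_neg_iff xy y z w x by auto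
    moreover have "gam ` {x<..<y} \<subseteq> circle - {p, q}" by (rule avoid) (use y in auto)
    ultimately show ?thesis using that[OF conn[of "{x<..<y}"]] z w by auto
  next
    case 2
    then have "z \<in> {y<..<x + 1}" "w \<in> {y<..<x + 1}" using side_gam_pos_iff xy y z w x by auto
    moreover have "gam ` {y<..<x + 1} \<subseteq> circle - {p, q}" by (rule avoid) (use xy in auto)
    ultimately show ?thesis using that[OF conn[of "{y<..<x + 1}"]] z w by auto
  qed
qed

lemma dyadic_homeoD:
  assumes "dyadic_homeo h"
  shows "bij_betw h circle circle" "bij_betw h dyadic_points dyadic_points" "continuous_on circle h"
    "h \<in> extensional circle"
proof -
  show 1: "bij_betw h circle circle" "continuous_on circle h" "h \<in> extensional circle"
    using assms by (auto simp: dyadic_homeo_def Bij_def)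
  have "dyadic_points \<subseteq> circle" using dyadic_points_circle by blast
  then show "bij_betw h dyadic_points dyadic_points"
    using bij_betw_subset[OF 1(1)] assms by (auto simp: dyadic_homeo_def)
qed

text \<open>Points other than the ends of a chord are on the same side of it iff a connected subset
  of the circle that avoids the ends joins them. This does not refer to an orientation, so reversing
  maps are included.\<close>

lemma homeo_not_crosses:
  assumes h: "dyadic_homeo h" and c: "p \<in> circle" "q \<in> circle" "p \<noteq> q" "u \<in> circle" "v \<in> circle" "u \<noteq> v"
    and nc: "\<not> crosses (seg p q) (seg u v)"
  shows "\<not> crosses (seg (h p) (h q)) (seg (h u) (h v))"
proof -
  have hc: "h w \<in> circle" if "w \<in> circle" for w using dyadic_homeoD(1)[OF h] that by (rule bij_betw_apply)
  have hi: "h w = h w' \<longleftrightarrow> w = w'" if "w \<in> circle" "w' \<in> circle" for w w'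
    using dyadic_homeoD(1)[OF h] that by (metis bij_betw_def inj_on_eq_iff)
  have "\<not> side (h p) (h q) (h u) * side (h p) (h q) (h v) < 0"
  proof (cases "u \<in> {p, q} \<or> v \<in> {p, q}")
    case True
    then have "side (h p) (h q) (h u) * side (h p) (h q) (h v) = 0" by auto
    then show ?thesis by linarith
  next
    case False
    then have "side p q u \<noteq> 0" "side p q v \<noteq> 0" using side_eq_0_iff c by auto
    then have "side p q u * side p q v \<noteq> 0" by simp
    then have "side p q u * side p q v > 0" using nc crosses_iff[OF c] by linarith
    then obtain K where K: "connected K" "K \<subseteq> circle - {p, q}" "u \<in> K" "v \<in> K" using same_side_connected[OF c(1-5)] by blast
    have "connected (h ` K)" using K dyadic_homeoD(3)[OF h] by (intro connected_continuous_image) (auto intro: continuous_on_subset)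
    moreover have "h ` K \<subseteq> circle - {h p, h q}" using K(2) hc hi c by blast
    ultimately show ?thesis using connected_same_side[of "h ` K" "h p" "h q" "h u" "h v"] K hc hi c by blast
  qed
  then show ?thesis using crosses_iff[of "h p" "h q" "h u" "h v"] hc hi c by simp
qed

text \<open>\<open>act\<close> refers to pairs of endpoints. The hull of the image of both ends is a
  function of the chord, independent of the order of the ends, so that facts about images and
  inverses apply.\<close>

definition chord_map :: "(point \<Rightarrow> point) \<Rightarrow> chord \<Rightarrow> chord" where
  "chord_map h d = convex hull (h ` ends d)"

lemma chord_map_seg: "p \<in> dyadic_points \<Longrightarrow> q \<in> dyadic_points \<Longrightarrow> chord_map h (seg p q) = seg (h p) (h q)"
  unfolding chord_map_def by (simp only: ends_seg image_insert image_empty) (rule segment_convex_hull[symmetric])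

lemma act_eq_chord_map:
  assumes "A \<subseteq> dyadic_arcs" shows "act h A = chord_map h ` A"
proof (intro equalityI subsetI)
  fix d assume "d \<in> act h A"
  then obtain p q where pq: "d = seg (h p) (h q)" "seg p q \<in> A" unfolding act_def by blast
  have "seg p q \<in> dyadic_arcs" using assms pq(2) by blast
  then obtain r s where rs: "seg p q = seg r s" "r \<in> dyadic_points" "s \<in> dyadic_points" using dyadic_arcE by metis
  then have "{p, q} = {r, s}" by (simp only: closed_segment_eq)
  then have "p \<in> {r, s}" "q \<in> {r, s}" by blast+
  then have "p \<in> dyadic_points" "q \<in> dyadic_points" using rs by blast+
  then show "d \<in> chord_map h ` A" using pq chord_map_seg by (metis imageI)
next
  fix d assume "d \<in> chord_map h ` A"
  then obtain a where a: "a \<in> A" "d = chord_map h a" by blast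
  have "a \<in> dyadic_arcs" using assms a by blast
  then obtain p q where "a = seg p q" "p \<in> dyadic_points" "q \<in> dyadic_points" using dyadic_arcE by metis
  then show "d \<in> act h A" using a chord_map_seg unfolding act_def by blast
qed

lemma dyadic_homeo_inverse:
  assumes h: "dyadic_homeo h"
  shows "dyadic_homeo (restrict (inv_into circle h) circle)"
proof -
  let ?k = "restrict (inv_into circle h) circle"
  have "?k \<in> Bij circle" using h by (simp add: dyadic_homeo_def restrict_inv_into_Bij)
  moreover have "continuous_on circle ?k"
  proof -
    obtain g where g: "homeomorphism circle circle h g"
      using homeomorphism_compact[of circle h circle] dyadic_homeoD[OF h] by (auto simp: bij_betw_def circle_def)
    have "?k w = g w" if "w \<in> circle" for w
      using g that bij_betw_inv_into_left[OF dyadic_homeoD(1)[OF h]] unfolding homeomorphism_def by (metis imageI restrict_apply')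
    then show ?thesis using g unfolding homeomorphism_def by (simp cong: continuous_on_cong)
  qed
  moreover have "?k ` dyadic_points = dyadic_points"
  proof -
    have "?k ` dyadic_points = ?k ` (h ` dyadic_points)" using h by (simp add: dyadic_homeo_def)
    also have "\<dots> = (\<lambda>w. w) ` dyadic_points" unfolding image_image
    proof (rule image_cong[OF refl])
      fix w assume "w \<in> dyadic_points"
      then have w: "w \<in> circle" by (rule dyadic_points_circle)
      then have "h w \<in> circle" using dyadic_homeoD(1)[OF h] bij_betw_apply by metis
      then show "?k (h w) = w" using bij_betw_inv_into_left[OF dyadic_homeoD(1)[OF h] w] by simp
    qed
    finally show ?thesis by simp
  qed
  ultimately show ?thesis by (simp add: dyadic_homeo_def)
qed

lemma dyadic_homeo_compose:
  assumes h: "dyadic_homeo h" and g: "dyadic_homeo g" shows "dyadic_homeo (compose circle h g)"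
proof -
  have "compose circle h g \<in> Bij circle" using h g by (simp add: dyadic_homeo_def compose_Bij)
  moreover have "continuous_on circle (compose circle h g)"
  proof -
    have "continuous_on circle (\<lambda>w. h (g w))"
      using dyadic_homeoD(3)[OF g] dyadic_homeoD(3)[OF h] bij_betw_imp_surj_on[OF dyadic_homeoD(1)[OF g]]
      by (metis continuous_on_compose2 order_refl)
    then show ?thesis by (simp add: compose_def cong: continuous_on_cong)
  qed
  moreover have "compose circle h g ` dyadic_points = h ` (g ` dyadic_points)"
    unfolding image_image by (rule image_cong) (auto simp: compose_def dest: dyadic_points_circle)
  then have "compose circle h g ` dyadic_points = dyadic_points" using h g by (simp add: dyadic_homeo_def)
  ultimately show ?thesis by (simp add: dyadic_homeo_def)
qed

context
  fixes h assumes h: "dyadic_homeo h"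
begin

lemma homeo_dyadic: "p \<in> dyadic_points \<Longrightarrow> h p \<in> dyadic_points"
  using dyadic_homeoD(2)[OF h] by (rule bij_betw_apply)

lemma homeo_inj: "p \<in> circle \<Longrightarrow> q \<in> circle \<Longrightarrow> h p = h q \<longleftrightarrow> p = q"
  using dyadic_homeoD(1)[OF h] by (metis bij_betw_def inj_on_eq_iff)

lemma chord_map_arc: "d \<in> dyadic_arcs \<Longrightarrow> chord_map h d \<in> dyadic_arcs"
proof -
  assume "d \<in> dyadic_arcs"
  then obtain p q where "d = seg p q" "p \<in> dyadic_points" "q \<in> dyadic_points" "p \<in> circle" "q \<in> circle" "p \<noteq> q" by (rule dyadic_arcE)
  then show ?thesis using chord_map_seg homeo_dyadic homeo_inj dyadic_arcI by metis
qed

lemma chord_map_not_crosses: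
  assumes "d \<in> dyadic_arcs" "d' \<in> dyadic_arcs" "\<not> crosses d d'"
  shows "\<not> crosses (chord_map h d) (chord_map h d')"
proof -
  obtain p q where 1: "d = seg p q" "p \<in> dyadic_points" "q \<in> dyadic_points" "p \<in> circle" "q \<in> circle" "p \<noteq> q"
    using assms(1) by (rule dyadic_arcE)
  obtain u v where 2: "d' = seg u v" "u \<in> dyadic_points" "v \<in> dyadic_points" "u \<in> circle" "v \<in> circle" "u \<noteq> v"
    using assms(2) by (rule dyadic_arcE)
  show ?thesis using homeo_not_crosses[OF h 1(4-6) 2(4-6)] assms(3) chord_map_seg 1 2 by simp
qed

end

lemma chord_map_compose:
  assumes "dyadic_homeo g" "d \<in> dyadic_arcs"
  shows "chord_map (compose circle h g) d = chord_map h (chord_map g d)"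
proof -
  obtain p q where 1: "d = seg p q" "p \<in> dyadic_points" "q \<in> dyadic_points" "p \<in> circle" "q \<in> circle" "p \<noteq> q"
    using assms(2) by (rule dyadic_arcE)
  have "compose circle h g p = h (g p)" "compose circle h g q = h (g q)" using 1 by (simp_all add: compose_eq)
  then show ?thesis using 1 chord_map_seg homeo_dyadic[OF assms(1)] by simp
qed

lemma chord_map_id:
  assumes "d \<in> dyadic_arcs" "\<And>p. p \<in> dyadic_points \<Longrightarrow> h p = p" shows "chord_map h d = d"
proof -
  obtain p q where "d = seg p q" "p \<in> dyadic_points" "q \<in> dyadic_points"
    using dyadic_arcE[OF assms(1)] by metis
  then show ?thesis using chord_map_seg assms(2) by simp
qed

section \<open>The action on tessellations\<close>

lemma ex_int_block:
  fixes i :: int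
  assumes "N \<le> n" "0 \<le> i" "i < 2 ^ n"
  obtains m where "0 \<le> m" "m < 2 ^ N" "m * 2 ^ (n - N) \<le> i" "i + 1 \<le> (m + 1) * 2 ^ (n - N)"
proof -
  define K :: int where "K = 2 ^ (n - N)"
  have K: "K > 0" by (simp add: K_def)
  have KN: "2 ^ N * K = 2 ^ n" unfolding K_def using assms(1) by (simp flip: power_add)
  define m where "m = i div K"
  have d: "i = m * K + i mod K" by (simp add: m_def)
  have r: "0 \<le> i mod K" "i mod K < K" using K by simp_all
  have 1: "m * K \<le> i" using d r by linarith
  have 2: "i + 1 \<le> (m + 1) * K" using d r by (simp add: distrib_right)
  have "m * K < 2 ^ N * K" using 1 KN assms(3) by linarith
  then have "m < 2 ^ N" using K by simp
  moreover have "0 \<le> m" using assms(2) K by (simp add: m_def pos_imp_zdiv_nonneg_iff)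
  ultimately show ?thesis using that 1 2 unfolding K_def by blast
qed

text \<open>The slope takes intervals of level \<open>n\<close> to intervals of the length of level
  n - k, and for large \<open>n\<close> the dyadic constant shifts by a multiple of this
  length.\<close>

lemma affine_sarc:
  assumes hom: "\<And>u. u \<in> {of_int m / 2 ^ N..(of_int m + 1) / 2 ^ N} \<Longrightarrow> h (gam u) = gam (e * 2 powi k * u + c)"
    and e: "e = 1 \<or> e = - 1" and c: "c \<in> dyadics"
  shows "\<exists>M\<ge>N. \<forall>n\<ge>M. \<forall>i. m * 2 ^ (n - N) \<le> i \<and> i + 1 \<le> (m + 1) * 2 ^ (n - N) \<longrightarrow> chord_map h (sarc n i) \<in> A_F"
proof -
  obtain cn l where cl: "c = of_int cn / 2 ^ l" using c by (rule dyadicsE)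
  define E :: int where "E = (if e = 1 then 1 else - 1)"
  have E: "e = of_int E" "E = 1 \<or> E = - 1" using e by (auto simp: E_def)
  \<comment> \<open>From this level on, n - k is at least 1 and at least the level \<open>l\<close>
    of the constant.\<close>
  define M where "M = max N (nat (k + int l + 1))"
  have "chord_map h (sarc n i) \<in> A_F"
    if n: "M \<le> n" and i: "m * 2 ^ (n - N) \<le> i" "i + 1 \<le> (m + 1) * 2 ^ (n - N)" for n i
  proof -
    have nN: "N \<le> n" and nk: "k + int l + 1 \<le> int n" using n by (auto simp: M_def)
    define j where "j = nat (int n - k)"
    have j: "1 \<le> j" "l \<le> j" "int j = int n - k" using nk by (auto simp: j_def)
    define v where "v = E * i + cn * 2 ^ (j - l)"
    have ends: "of_int m / 2 ^ N = (of_int (m * 2 ^ (n - N)) / 2 ^ n :: real)"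
      "(of_int m + 1) / 2 ^ N = (of_int ((m + 1) * 2 ^ (n - N)) / 2 ^ n :: real)"
      using dyadics_raise[of m N "n - N"] dyadics_raise[of "m + 1" N "n - N"] nN by simp_all
    have kj: "2 powi k * (x / 2 ^ n) = x / (2 ^ j :: real)" for x :: real
    proof -
      have "(2::real) powi k * 2 ^ j = 2 powi (k + int j)" by (simp add: power_int_add)
      also have "\<dots> = 2 ^ n" using j(3) by simp
      finally have "(2::real) ^ n = 2 powi k * 2 ^ j" by simp
      then show ?thesis by simp
    qed
    have im: "h (gam (of_int a / 2 ^ n)) = gam (of_int (E * a + cn * 2 ^ (j - l)) / 2 ^ j)"
      if a: "m * 2 ^ (n - N) \<le> a" "a \<le> (m + 1) * 2 ^ (n - N)" for a
    proof -
      have "of_int a / 2 ^ n \<in> {of_int m / 2 ^ N..(of_int m + 1) / (2 ^ N :: real)}"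
        unfolding ends using a by (simp only: atLeastAtMost_iff) (metis divide_right_mono of_int_le_iff zero_le_numeral zero_le_power)
      from hom[OF this] have "h (gam (of_int a / 2 ^ n)) = gam (of_int E * (2 powi k * (of_int a / 2 ^ n)) + of_int cn / 2 ^ l)"
        by (simp only: E(1) cl mult.assoc)
      also have "of_int cn / 2 ^ l = (of_int (cn * 2 ^ (j - l)) / 2 ^ j :: real)"
        using dyadics_raise[of cn l "j - l"] j(2) by simp
      also have "of_int E * (2 powi k * (of_int a / 2 ^ n)) + of_int (cn * 2 ^ (j - l)) / 2 ^ j
         = (of_int (E * a + cn * 2 ^ (j - l)) / 2 ^ j :: real)"
        unfolding kj by (simp add: add_divide_distrib)
      finally show ?thesis .
    qed
    have h1: "h (gam (of_int i / 2 ^ n)) = gam (of_int v / 2 ^ j)" using im[of i] i by (simp add: v_def)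
    have "E * (i + 1) + cn * 2 ^ (j - l) = v + E" by (simp add: v_def algebra_simps)
    then have h2: "h (gam ((of_int i + 1) / 2 ^ n)) = gam (of_int (v + E) / 2 ^ j)" using im[of "i + 1"] i by simp
    have "chord_map h (sarc n i) = seg (gam (of_int v / 2 ^ j)) (gam (of_int (v + E) / 2 ^ j))"
      unfolding sarc_def using sarc_ends_Lev Lev_dyadic_points by (subst chord_map_seg) (blast, blast, simp only: h1 h2)
    also have "\<dots> \<in> A_F" using E(2)
    proof
      assume "E = 1"
      then have "seg (gam (of_int v / 2 ^ j)) (gam (of_int (v + E) / 2 ^ j)) = sarc j v" unfolding sarc_def by simp
      then show ?thesis using sarc_A_F j by simp
    next
      \<comment> \<open>Reversal makes the image of the left end the right end, so the image
        interval starts at \<open>v - 1\<close>.\<close>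
      assume "E = - 1"
      then have "seg (gam (of_int v / 2 ^ j)) (gam (of_int (v + E) / 2 ^ j)) = sarc j (v - 1)"
        unfolding sarc_def closed_segment_commute[of "gam (of_int v / 2 ^ j)"] by simp
      then show ?thesis using sarc_A_F j by simp
    qed
    finally show ?thesis .
  qed
  then show ?thesis by (intro exI[of _ M]) (auto simp: M_def)
qed

text \<open>Each of the finitely many intervals of level \<open>N\<close> contributes a bound from
  \<open>affine_sarc\<close>; from their maximum \<open>K\<close> on, all standard arcs have
  standard images. Indices are reduced modulo 2^n to land in these intervals.\<close>

lemma dyadic_affine_A_F:
  assumes aff: "dyadic_affine h N"
  shows "finite (chord_map h ` A_F - A_F)"
proof -
  have "\<forall>m\<in>{0..<2 ^ N}. \<exists>M\<ge>N. \<forall>n\<ge>M. \<forall>i. m * 2 ^ (n - N) \<le> i \<and> i + 1 \<le> (m + 1) * 2 ^ (n - N) \<longrightarrow> chord_map h (sarc n i) \<in> A_F"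
  proof
    fix m :: int assume "m \<in> {0..<2 ^ N}"
    then obtain e k c where "e = 1 \<or> e = - 1" "c \<in> dyadics"
      "\<forall>u\<in>{of_int m / 2 ^ N..(of_int m + 1) / 2 ^ N}. h (gam u) = gam (e * 2 powi k * u + c)"
      using aff unfolding dyadic_affine_def by (metis atLeastLessThan_iff)
    then show "\<exists>M\<ge>N. \<forall>n\<ge>M. \<forall>i. m * 2 ^ (n - N) \<le> i \<and> i + 1 \<le> (m + 1) * 2 ^ (n - N) \<longrightarrow> chord_map h (sarc n i) \<in> A_F"
      using affine_sarc[of m N h e k c] by blast
  qed
  then obtain M where M: "\<And>m. m \<in> {0..<2 ^ N} \<Longrightarrow> M m \<ge> N"
    "\<And>m n i. m \<in> {0..<2 ^ N} \<Longrightarrow> n \<ge> M m \<Longrightarrow> m * 2 ^ (n - N) \<le> i \<Longrightarrow> i + 1 \<le> (m + 1) * 2 ^ (n - N) \<Longrightarrow> chord_map h (sarc n i) \<in> A_F"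
    by metis
  define K where "K = Max (insert N (M ` {0..<2 ^ N}))"
  have K: "N \<le> K" "\<And>m. m \<in> {0..<2 ^ N} \<Longrightarrow> M m \<le> K" unfolding K_def by (intro Max_ge; simp)+
  have big: "chord_map h (sarc n i) \<in> A_F" if n: "K \<le> n" for n i
  proof -
    have nN: "N \<le> n" using n K by simp
    obtain m where m: "0 \<le> m" "m < 2 ^ N" "m * 2 ^ (n - N) \<le> i mod 2 ^ n" "i mod 2 ^ n + 1 \<le> (m + 1) * 2 ^ (n - N)"
      using ex_int_block[OF nN, of "i mod 2 ^ n"] by auto
    have "m \<in> {0..<2 ^ N}" using m by simp
    then have "chord_map h (sarc n (i mod 2 ^ n)) \<in> A_F" using M(2)[of m n "i mod 2 ^ n"] m K(2)[of m] n by auto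
    then show ?thesis by (simp only: sarc_mod)
  qed
  have "chord_map h ` A_F - A_F \<subseteq> chord_map h ` larcs K"
  proof
    fix d assume d: "d \<in> chord_map h ` A_F - A_F"
    then obtain n i where ni: "d = chord_map h (sarc n i)" "1 \<le> n" unfolding A_F_eq by blast
    then have "\<not> K \<le> n" using big d by blast
    then show "d \<in> chord_map h ` larcs K" using ni sarc_larcs[of n i] larcs_mono[of n K] by auto
  qed
  then show ?thesis using finite_larcs finite_subset by blast
qed

definition homeo_inv :: "(point \<Rightarrow> point) \<Rightarrow> point \<Rightarrow> point" where
  "homeo_inv h = restrict (inv_into circle h) circle"

lemma homeo_inv_apply:
  assumes "dyadic_homeo h" "p \<in> circle"
  shows "homeo_inv h (h p) = p" "h (homeo_inv h p) = p"
  using assms bij_betw_inv_into_left[OF dyadic_homeoD(1)] bij_betw_inv_into_right[OF dyadic_homeoD(1)]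
    bij_betw_apply[OF dyadic_homeoD(1)] by (simp_all add: homeo_inv_def)

lemma chord_map_inv:
  assumes h: "dyadic_homeo h" and d: "d \<in> dyadic_arcs"
  shows "chord_map (homeo_inv h) (chord_map h d) = d" "chord_map h (chord_map (homeo_inv h) d) = d"
proof -
  have k: "dyadic_homeo (homeo_inv h)" using dyadic_homeo_inverse[OF h] by (simp add: homeo_inv_def)
  have "compose circle (homeo_inv h) h p = p" "compose circle h (homeo_inv h) p = p" if "p \<in> dyadic_points" for p
    using homeo_inv_apply[OF h] dyadic_points_circle[OF that] by (simp_all add: compose_eq)
  then show "chord_map (homeo_inv h) (chord_map h d) = d" "chord_map h (chord_map (homeo_inv h) d) = d"
    using chord_map_id[OF d] chord_map_compose[OF h d, of "homeo_inv h"] chord_map_compose[OF k d, of h] by metis+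
qed

section \<open>Transport of tessellations by a homeomorphism and its inverse\<close>

context
  fixes h assumes h: "dyadic_homeo h" and fin: "finite (chord_map h ` A_F - A_F)"
begin

lemma homeo_inv_homeo: "dyadic_homeo (homeo_inv h)"
  using dyadic_homeo_inverse[OF h] by (simp add: homeo_inv_def)

text \<open>Applying the inverse shows that the image of \<open>A_F\<close> is again a maximal
  noncrossing family, so \<open>maximal_finite_sym_diff\<close> supplies the other half of the
  difference.\<close>

lemma chord_map_A_F_sym_diff: "finite (sym_diff (chord_map h ` A_F) A_F)"
proof -
  have "finite (A_F - chord_map h ` A_F)"
  proof (rule maximal_finite_sym_diff[OF _ _ fin])
    show "chord_map h ` A_F \<subseteq> dyadic_arcs" using chord_map_arc[OF h] A_F_dyadic_arcs by blast
    fix d assume d: "d \<in> dyadic_arcs" "\<forall>b\<in>chord_map h ` A_F. \<not> crosses d b"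
    have kd: "chord_map (homeo_inv h) d \<in> dyadic_arcs" using chord_map_arc[OF homeo_inv_homeo d(1)] .
    have "\<not> crosses a (chord_map (homeo_inv h) d)" if a: "a \<in> A_F" for a
    proof -
      have "\<not> crosses (chord_map h a) d" using d(2) a crosses_sym by blast
      then have "\<not> crosses (chord_map (homeo_inv h) (chord_map h a)) (chord_map (homeo_inv h) d)"
        using chord_map_not_crosses[OF homeo_inv_homeo] chord_map_arc[OF h] a A_F_dyadic_arcs d(1) by blast
      then show ?thesis using chord_map_inv(1)[OF h] a A_F_dyadic_arcs by (metis subsetD)
    qed
    then have "chord_map (homeo_inv h) d \<in> A_F" using A_F_maximal[OF kd] by blast
    then show "d \<in> chord_map h ` A_F" using chord_map_inv(2)[OF h d(1)] by (metis imageI)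
  qed
  then show ?thesis using fin by simp
qed

lemma chord_map_tess:
  assumes "tess A" shows "tess (chord_map h ` A)"
proof -
  have A: "A \<subseteq> dyadic_arcs" "finite (sym_diff A A_F)" using assms by (simp_all add: tess_def)
  have "noncrossing disk (chord_map h ` A)"
    unfolding noncrossing_disk_iff using chord_map_not_crosses[OF h] tess_not_crosses[OF assms] A(1) by blast
  moreover have "sym_diff (chord_map h ` A) A_F \<subseteq> chord_map h ` (sym_diff A A_F) \<union> sym_diff (chord_map h ` A_F) A_F"
    by blast
  then have "finite (sym_diff (chord_map h ` A) A_F)"
    using A(2) chord_map_A_F_sym_diff by (meson finite_UnI finite_imageI finite_subset)
  ultimately show ?thesis using chord_map_arc[OF h] A(1) by (auto simp: tess_def)
qed

text \<open>Finiteness for the inverse comes from the other half of the symmetric difference, with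
  no normal form for the inverse map.\<close>

lemma homeo_inv_A_F: "finite (chord_map (homeo_inv h) ` A_F - A_F)"
proof -
  have "chord_map (homeo_inv h) ` A_F - A_F \<subseteq> chord_map (homeo_inv h) ` (A_F - chord_map h ` A_F)"
  proof
    fix d assume d: "d \<in> chord_map (homeo_inv h) ` A_F - A_F"
    then obtain a where a: "a \<in> A_F" "d = chord_map (homeo_inv h) a" by blast
    have "a \<notin> chord_map h ` A_F"
    proof
      assume "a \<in> chord_map h ` A_F"
      then obtain b where b: "b \<in> A_F" "a = chord_map h b" by blast
      then have "b \<in> dyadic_arcs" using A_F_dyadic_arcs by blast
      then have "d = b" using a(2) b(2) chord_map_inv(1)[OF h] by simp
      then show False using d b by blast
    qed
    then show "d \<in> chord_map (homeo_inv h) ` (A_F - chord_map h ` A_F)" using a by blast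
  qed
  moreover have "finite (A_F - chord_map h ` A_F)" using chord_map_A_F_sym_diff by simp
  ultimately show ?thesis using finite_subset by blast
qed

end

lemma act_order_auto:
  assumes t: "t \<in> carrier T_no" shows "order_auto (act t)"
proof -
  let ?k = "homeo_inv t"
  have h: "dyadic_homeo t" using t by (rule T_no_dyadic_homeo)
  obtain N where "dyadic_affine t N" using T_no_dyadic_affine[OF t] .
  then have fin: "finite (chord_map t ` A_F - A_F)" by (rule dyadic_affine_A_F)
  have k: "dyadic_homeo ?k" by (rule homeo_inv_homeo[OF h fin])
  have fink: "finite (chord_map ?k ` A_F - A_F)" by (rule homeo_inv_A_F[OF h fin])
  have arcs: "A \<subseteq> dyadic_arcs" if "A \<in> F_tessellations" for A using that by (simp add: F_tessellations_eq tess_def)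
  have actt: "act t A = chord_map t ` A" if "A \<in> F_tessellations" for A using act_eq_chord_map[OF arcs[OF that]] .
  have kt: "chord_map ?k ` (chord_map t ` A) = A" "chord_map t ` (chord_map ?k ` A) = A" if A: "A \<in> F_tessellations" for A
  proof -
    have "chord_map ?k (chord_map t d) = d" "chord_map t (chord_map ?k d) = d" if "d \<in> A" for d
      using chord_map_inv[OF h] that arcs[OF A] by blast+
    then show "chord_map ?k ` (chord_map t ` A) = A" "chord_map t ` (chord_map ?k ` A) = A" by (simp_all add: image_image)
  qed
  have "bij_betw (act t) F_tessellations F_tessellations"
  proof (rule bij_betw_byWitness[of _ "\<lambda>A. chord_map ?k ` A"])
    show "\<forall>A\<in>F_tessellations. chord_map ?k ` (act t A) = A" using actt kt by simp
    have kT: "chord_map ?k ` A \<in> F_tessellations" if "A \<in> F_tessellations" for A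
      using chord_map_tess[OF k fink] that by (simp add: F_tessellations_eq)
    then show "(\<lambda>A. chord_map ?k ` A) ` F_tessellations \<subseteq> F_tessellations" by blast
    show "\<forall>A\<in>F_tessellations. act t (chord_map ?k ` A) = A" using actt kT kt by simp
    show "act t ` F_tessellations \<subseteq> F_tessellations"
      using actt chord_map_tess[OF h fin] by (auto simp: F_tessellations_eq)
  qed
  moreover have "act t A \<subseteq> act t B \<longleftrightarrow> A \<subseteq> B" if AB: "A \<in> F_tessellations" "B \<in> F_tessellations" for A B
  proof
    assume "act t A \<subseteq> act t B"
    then have "chord_map ?k ` (chord_map t ` A) \<subseteq> chord_map ?k ` (chord_map t ` B)" using actt AB by (metis image_mono)
    then show "A \<subseteq> B" using kt AB by simp
  next
    assume "A \<subseteq> B"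
    then show "act t A \<subseteq> act t B" using actt AB by (metis image_mono)
  qed
  ultimately show ?thesis by (simp add: order_auto_def)
qed

text \<open>For any other \<open>t\<close> an arc at \<open>t\<close> would cross one of the two
  half intervals' arcs, which are standard of level n + 1. This recognizes midpoints from arcs
  alone.\<close>

lemma A_F_midpoint:
  fixes m :: int and n :: nat
  defines "L \<equiv> of_int m / 2 ^ n :: real" and "R \<equiv> (of_int m + 1) / 2 ^ n :: real"
  assumes n: "n \<ge> 1" and t: "L < t" "t < R" and A: "seg (gam L) (gam t) \<in> A_F" "seg (gam t) (gam R) \<in> A_F"
  shows "t = (L + R) / 2"
proof (rule ccontr)
  assume ne: "t \<noteq> (L + R) / 2"
  have RL: "R - L \<le> 1 / 2"
    using pow_ge_2[OF n] by (simp add: L_def R_def field_simps)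
  have e1: "of_int (2 * m) / 2 ^ Suc n = L" "(of_int (2 * m) + 1) / 2 ^ Suc n = (L + R) / 2"
    "of_int (2 * m + 1) / 2 ^ Suc n = (L + R) / 2" "(of_int (2 * m + 1) + 1) / 2 ^ Suc n = R"
    by (simp_all add: L_def R_def field_simps)
  have s1: "sarc (Suc n) (2 * m) = seg (gam L) (gam ((L + R) / 2))" unfolding sarc_def e1 ..
  have s2: "sarc (Suc n) (2 * m + 1) = seg (gam ((L + R) / 2)) (gam R)" unfolding sarc_def e1 ..
  have nc: "\<not> crosses a b" if "a \<in> A_F" "b \<in> A_F" for a b using A_F_noncrossing that by (auto simp: noncrossing_disk_iff)
  have ne2: "gam L \<noteq> gam ((L + R) / 2)" "gam ((L + R) / 2) \<noteq> gam R" "gam t \<noteq> gam R" "gam L \<noteq> gam t"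
    using gam_inj[of L "(L + R) / 2"] gam_inj[of "(L + R) / 2" R] gam_inj[of t R] gam_inj[of L t] t RL by (auto simp: abs_less_iff field_simps)
  show False
  proof (cases "t < (L + R) / 2")
    case True
    have "side (gam L) (gam ((L + R) / 2)) (gam t) < 0" using t True RL by (intro side_gam_neg) auto
    moreover have "side (gam L) (gam ((L + R) / 2)) (gam R) > 0" using t True RL by (intro side_gam_pos) auto
    ultimately have "crosses (sarc (Suc n) (2 * m)) (seg (gam t) (gam R))"
      unfolding s1 using ne2 gam_circle by (simp add: crosses_iff mult_less_0_iff)
    then show False using nc sarc_A_F A by simp
  next
    case False
    then have "(L + R) / 2 < t" using ne by simp
    moreover have "R < (L + R) / 2 + 1" using RL by (simp add: field_simps)
    ultimately have "side (gam ((L + R) / 2)) (gam R) (gam t) < 0" using t by (intro side_gam_neg)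
    \<comment> \<open>The point \<open>gam L\<close> is represented by the parameter
      \<open>L + 1\<close>, to the right of \<open>R\<close>.\<close>
    moreover have "side (gam ((L + R) / 2)) (gam R) (gam (L + 1)) > 0" using t RL by (intro side_gam_pos) auto
    ultimately have "crosses (sarc (Suc n) (2 * m + 1)) (seg (gam L) (gam t))"
      unfolding s2 using ne2 gam_circle by (simp add: crosses_iff mult_less_0_iff)
    then show False using nc sarc_A_F A by simp
  qed
qed

text \<open>\<open>gam\<close> is a quotient map from the closed unit interval to the circle: the
  preimage of a closed set under \<open>f\<close> is the image of a compact set.\<close>

lemma continuous_on_circle:
  assumes "continuous_on {0..1} (\<lambda>u. f (gam u))" shows "continuous_on circle f"
proof -
  have cl: "closed circle" by (simp add: circle_def)
  have "closed (f -` B \<inter> circle)" if B: "closed B" for B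
  proof -
    have "closed ({0..1} \<inter> (\<lambda>u. f (gam u)) -` B)"
      using assms B by (simp add: continuous_on_closed_vimage Int_commute)
    then have "compact ({0..1} \<inter> (\<lambda>u. f (gam u)) -` B)"
      using compact_Int_closed[of "{0..1::real}" "{0..1} \<inter> (\<lambda>u. f (gam u)) -` B"] by (simp add: Int_absorb1)
    then have "compact (gam ` ({0..1} \<inter> (\<lambda>u. f (gam u)) -` B))"
      using continuous_gam by (intro compact_continuous_image)
    moreover have "gam ` ({0..1} \<inter> (\<lambda>u. f (gam u)) -` B) = f -` B \<inter> circle"
    proof
      show "gam ` ({0..1} \<inter> (\<lambda>u. f (gam u)) -` B) \<subseteq> f -` B \<inter> circle" using gam_circle by auto
      show "f -` B \<inter> circle \<subseteq> gam ` ({0..1} \<inter> (\<lambda>u. f (gam u)) -` B)"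
      proof
        fix w assume w: "w \<in> f -` B \<inter> circle"
        then obtain z where "0 \<le> z" "z < 0 + 1" "w = gam z" using circle_param[of w 0] by blast
        then show "w \<in> gam ` ({0..1} \<inter> (\<lambda>u. f (gam u)) -` B)" using w by (intro image_eqI[of _ _ z]) auto
      qed
    qed
    ultimately show ?thesis by (simp add: compact_imp_closed)
  qed
  then show ?thesis unfolding continuous_on_closed_vimage[OF cl] by blast
qed

section \<open>Extension of vertex permutations to the circle\<close>

lemma pow2_shift: "x * 2 ^ k / 2 ^ (n + k) = (x / 2 ^ n :: real)"
  by (simp add: power_add)

context
  fixes \<sigma> :: "point \<Rightarrow> point" and \<beta> :: "chord \<Rightarrow> chord"
  assumes sbij: "bij_betw \<sigma> dyadic_points dyadic_points"
    and sb: "\<And>p q. p \<in> dyadic_points \<Longrightarrow> q \<in> dyadic_points \<Longrightarrow> p \<noteq> q \<Longrightarrow> \<beta> (seg p q) = seg (\<sigma> p) (\<sigma> q)"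
    and bbij: "bij_betw \<beta> dyadic_arcs dyadic_arcs"
    and cr: "\<And>d d'. d \<in> dyadic_arcs \<Longrightarrow> d' \<in> dyadic_arcs \<Longrightarrow> crosses (\<beta> d) (\<beta> d') \<longleftrightarrow> crosses d d'"
    and fin: "finite (\<beta> ` A_F - A_F)"
begin

lemma sigma_dyadic: "p \<in> dyadic_points \<Longrightarrow> \<sigma> p \<in> dyadic_points"
  using sbij by (rule bij_betw_apply)

lemma sigma_inj: "p \<in> dyadic_points \<Longrightarrow> q \<in> dyadic_points \<Longrightarrow> \<sigma> p = \<sigma> q \<longleftrightarrow> p = q"
  using sbij by (metis bij_betw_def inj_on_eq_iff)

text \<open>Only finitely many standard arcs have a nonstandard image or an image of level at most
  \<open>M\<close>. The bound 2 on \<open>N\<close> gives the reference points with parameters 0,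
  1/4 and 1/2 level \<open>N\<close>.\<close>

lemma beta_small_arcs:
  obtains N where "N \<ge> 2" "\<And>n m. n \<ge> N \<Longrightarrow> \<exists>n' m'. M < n' \<and> \<beta> (sarc n m) = sarc n' m'"
proof -
  define bad where "bad = {a \<in> A_F. \<beta> a \<notin> A_F} \<union> {a \<in> A_F. \<beta> a \<in> larcs M}"
  have inj: "inj_on \<beta> S" if "S \<subseteq> A_F" for S
    using bbij that A_F_dyadic_arcs by (meson bij_betw_def inj_on_subset subset_trans)
  have "finite {a \<in> A_F. \<beta> a \<notin> A_F}"
  proof (rule finite_imageD)
    show "finite (\<beta> ` {a \<in> A_F. \<beta> a \<notin> A_F})" using fin by (rule rev_finite_subset) blast
  qed (rule inj, blast)
  moreover have "finite {a \<in> A_F. \<beta> a \<in> larcs M}"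
  proof (rule finite_imageD)
    show "finite (\<beta> ` {a \<in> A_F. \<beta> a \<in> larcs M})" using finite_larcs[of M] by (rule rev_finite_subset) blast
  qed (rule inj, blast)
  ultimately have "finite bad" by (simp add: bad_def)
  moreover have "bad \<subseteq> dyadic_arcs" using A_F_dyadic_arcs by (auto simp: bad_def)
  ultimately obtain N where N: "N \<ge> 1" "\<And>n m. n \<ge> N \<Longrightarrow> sarc n m \<notin> bad" using finite_sarc_level by blast
  have "\<exists>n' m'. M < n' \<and> \<beta> (sarc n m) = sarc n' m'" if n: "n \<ge> max N 2" for n m
  proof -
    have "sarc n m \<in> A_F" using n sarc_A_F by simp
    then have "\<beta> (sarc n m) \<in> A_F" "\<beta> (sarc n m) \<notin> larcs M" using N(2)[of n m] n by (auto simp: bad_def)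
    then obtain n' m' where "\<beta> (sarc n m) = sarc n' m'" "1 \<le> n'" "sarc n' m' \<notin> larcs M" unfolding A_F_eq by auto
    moreover then have "M < n'" using sarc_larcs[of n' m'] larcs_mono[of n' M] by (meson not_less subsetD)
    ultimately show ?thesis by blast
  qed
  then show ?thesis using that[of "max N 2"] by simp
qed

text \<open>The images of three fixed points have level \<open>M\<close>, so they are not inside the image interval,
  which forces \<open>\<sigma>\<close> to map the inside of the interval to the inside.\<close>

lemma sigma_midpoint:
  fixes m m' :: int and n n' :: nat
  defines "x \<equiv> of_int m / 2 ^ n" and "y \<equiv> (of_int m + 1) / 2 ^ n"
    and "L \<equiv> of_int m' / 2 ^ n'" and "R \<equiv> (of_int m' + 1) / 2 ^ n'"
  assumes N: "\<And>n m. n \<ge> N \<Longrightarrow> \<exists>n' m'. M < n' \<and> \<beta> (sarc n m) = sarc n' m'" "2 \<le> N" "N \<le> n" "M < n'"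
    and M: "\<sigma> ` {gam 0, gam (1/4), gam (1/2)} \<subseteq> Lev M"
    and im: "\<sigma> (gam x) = gam L \<and> \<sigma> (gam y) = gam R \<or> \<sigma> (gam x) = gam R \<and> \<sigma> (gam y) = gam L"
  shows "\<sigma> (gam ((x + y) / 2)) = gam ((L + R) / 2)"
proof -
  have n: "1 \<le> n" "2 \<le> n" "1 \<le> n'" "M \<le> n'" using N by auto
  have X: "gam x \<in> dyadic_points" "gam y \<in> dyadic_points" using sarc_ends_Lev Lev_dyadic_points unfolding x_def y_def by blast+
  have xy: "gam x \<noteq> gam y" using sarc_ends[OF n(1)] by (simp add: x_def y_def)
  have LR: "gam L \<noteq> gam R" using sarc_ends[OF n(3)] by (simp add: L_def R_def)
  have sxy: "sarc n m = seg (gam x) (gam y)" by (simp only: sarc_def x_def y_def)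
  have sLR: "sarc n' m' = seg (gam L) (gam R)" by (simp only: sarc_def L_def R_def)
  have b: "\<beta> (sarc n m) = sarc n' m'"
    using im sb[OF X xy] closed_segment_commute[of "gam L" "gam R"] unfolding sxy sLR by auto
  have RL: "L < R" "R < L + 1" using pow_ge_2[OF n(3)] by (simp_all add: L_def R_def field_simps)
  have yx: "x < y" "y < x + 1" using pow_ge_2[OF n(1)] by (simp_all add: x_def y_def field_simps)
  have e: "of_int (2 * m) / 2 ^ Suc n = x" "(of_int (2 * m) + 1) / 2 ^ Suc n = (x + y) / 2"
    "of_int (2 * m + 1) / 2 ^ Suc n = (x + y) / 2" "(of_int (2 * m + 1) + 1) / 2 ^ Suc n = y"
    by (simp_all add: x_def y_def field_simps)
  define z where "z = gam ((x + y) / 2)"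
  have s1: "sarc (Suc n) (2 * m) = seg (gam x) z" unfolding sarc_def e z_def ..
  have s2: "sarc (Suc n) (2 * m + 1) = seg z (gam y)" unfolding sarc_def e z_def ..
  have "z \<in> Lev (Suc n)" unfolding z_def e(3)[symmetric] by (rule LevI)
  then have zX: "z \<in> dyadic_points" by (rule Lev_dyadic_points)
  have zneg: "side (gam x) (gam y) z < 0" unfolding z_def using yx by (intro side_gam_neg) auto
  have zne: "gam x \<noteq> z" "z \<noteq> gam y" using zneg by auto
  have three: "gam 0 \<noteq> gam (1/4)" "gam 0 \<noteq> gam (1/2)" "gam (1/4) \<noteq> gam (1/2)"
    using gam_inj[of 0 "1/4"] gam_inj[of 0 "1/2"] gam_inj[of "1/4" "1/2"] by auto
  \<comment> \<open>At most two of the three points are ends of the interval; the third lies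
    strictly outside it and serves as reference.\<close>
  have "\<exists>p\<in>{gam 0, gam (1/4), gam (1/2)}. p \<noteq> gam x \<and> p \<noteq> gam y" using three by (metis insertCI)
  then obtain p where p: "p \<in> {gam 0, gam (1/4), gam (1/2)}" "p \<noteq> gam x" "p \<noteq> gam y" by blast
  have "p \<in> Lev 2" using p(1) LevI[of 0 2] LevI[of 1 2] LevI[of 2 2] by auto
  then have pn: "p \<in> Lev n" using Lev_mono[OF n(2)] by blast
  then have pX: "p \<in> dyadic_points" by (rule Lev_dyadic_points)
  have "side (gam x) (gam y) p \<ge> 0" using Lev_side_sarc[OF n(1) pn, of m] by (simp only: x_def y_def)
  moreover have "side (gam x) (gam y) p \<noteq> 0" using side_eq_0_iff[OF gam_circle gam_circle Lev_circle[OF pn] xy] p by simp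
  ultimately have ppos: "side (gam x) (gam y) p > 0" by simp
  have zp: "z \<noteq> p" using zneg ppos by auto
  have "crosses (sarc n m) (seg z p)"
    unfolding sxy using X zX pX xy zp zneg ppos by (simp add: dyadic_crosses_iff mult_less_0_iff)
  then have "crosses (sarc n' m') (seg (\<sigma> z) (\<sigma> p))"
    using cr[of "sarc n m" "seg z p"] sb[OF zX pX zp] b dyadic_arcI[OF zX pX zp] sarc_larcs[OF n(1)] larcs_dyadic_arcs by metis
  moreover have sz: "\<sigma> z \<noteq> \<sigma> p" "\<sigma> z \<in> circle" "\<sigma> p \<in> circle"
    using sigma_inj zX pX zp sigma_dyadic dyadic_points_circle by auto
  ultimately have prod: "side (gam L) (gam R) (\<sigma> z) * side (gam L) (gam R) (\<sigma> p) < 0"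
    unfolding sLR using crosses_iff[OF gam_circle gam_circle LR] by blast
  have "\<sigma> p \<in> Lev n'" using M p(1) Lev_mono[OF n(4)] by blast
  then have "side (gam L) (gam R) (\<sigma> p) \<ge> 0" using Lev_side_sarc[OF n(3), of "\<sigma> p" m'] by (simp only: L_def R_def)
  then have neg: "side (gam L) (gam R) (\<sigma> z) < 0" using prod by (auto simp: mult_less_0_iff)
  obtain t where t: "L \<le> t" "t < L + 1" "\<sigma> z = gam t" using circle_param[OF sz(2)] by blast
  have Lt: "L < t" "t < R" using neg side_gam_neg_iff[OF RL t(1,2)] unfolding t(3) by auto
  have small: "\<beta> (sarc (Suc n) i) \<in> A_F" for i
    using N(1)[of "Suc n" i] N(3) sarc_A_F by (metis Suc_leI le_SucI less_imp_Suc_add zero_less_Suc One_nat_def Suc_le_mono le0 order.strict_trans1)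
  have "seg (\<sigma> (gam x)) (gam t) \<in> A_F" "seg (gam t) (\<sigma> (gam y)) \<in> A_F"
    using small[of "2 * m"] small[of "2 * m + 1"] unfolding s1 s2 sb[OF X(1) zX zne(1)] sb[OF zX X(2) zne(2)] t(3) by blast+
  then have "seg (gam L) (gam t) \<in> A_F" "seg (gam t) (gam R) \<in> A_F"
    using im closed_segment_commute by metis+
  then have "t = (L + R) / 2" using A_F_midpoint[OF n(3), of m' t] Lt by (simp only: L_def R_def)
  then show ?thesis using t(3) by (simp only: z_def)
qed

text \<open>Repeated halving: the ends of an interval of level \<open>N\<close> go to the ends of a
  standard interval, and \<open>sigma_midpoint\<close> then determines the images of all its dyadic
  points, by induction on the number of halvings.\<close>

lemma sigma_locally_affine:
  assumes N: "\<And>n m. n \<ge> N \<Longrightarrow> \<exists>n' m'. M < n' \<and> \<beta> (sarc n m) = sarc n' m'" "2 \<le> N"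
    and M: "\<sigma> ` {gam 0, gam (1/4), gam (1/2)} \<subseteq> Lev M"
  shows "\<exists>e k c. (e = 1 \<or> e = - 1) \<and> c \<in> dyadics \<and>
    (\<forall>u\<in>dyadics \<inter> {of_int m / 2 ^ N..(of_int m + 1) / 2 ^ N}. \<sigma> (gam u) = gam (e * 2 powi k * u + c))"
proof -
  obtain n' m' where n': "M < n'" "\<beta> (sarc N m) = sarc n' m'" using N(1)[of N m] by auto
  define x y L R :: real where "x = of_int m / 2 ^ N" and "y = (of_int m + 1) / 2 ^ N"
    and "L = of_int m' / 2 ^ n'" and "R = (of_int m' + 1) / 2 ^ n'"
  have X: "gam x \<in> dyadic_points" "gam y \<in> dyadic_points" using sarc_ends_Lev Lev_dyadic_points unfolding x_def y_def by blast+
  have xy: "gam x \<noteq> gam y" using sarc_ends[of N m] N(2) by (simp add: x_def y_def)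
  have "seg (\<sigma> (gam x)) (\<sigma> (gam y)) = seg (gam L) (gam R)"
    using n'(2) sb[OF X xy] by (simp only: sarc_def x_def y_def L_def R_def)
  then have ends: "\<sigma> (gam x) = gam L \<and> \<sigma> (gam y) = gam R \<or> \<sigma> (gam x) = gam R \<and> \<sigma> (gam y) = gam L"
    unfolding closed_segment_eq doubleton_eq_iff .
  \<comment> \<open>The orientation of the image; \<open>a0\<close> is the parameter to which the
    left end \<open>x\<close> is sent.\<close>
  define E :: int where "E = (if \<sigma> (gam x) = gam L \<and> \<sigma> (gam y) = gam R then 1 else - 1)"
  define a0 where "a0 = (if E = 1 then L else R)"
  have E: "E = 1 \<or> E = - 1" by (simp add: E_def)
  have RL: "R = L + 1 / 2 ^ n'" by (simp add: L_def R_def add_divide_distrib)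
  have yx: "y = x + 1 / 2 ^ N" by (simp add: x_def y_def add_divide_distrib)
  have grid: "\<sigma> (gam (x + of_int i / 2 ^ (N + k))) = gam (a0 + of_int E * of_int i / 2 ^ (n' + k))"
    if "0 \<le> i" "i \<le> 2 ^ k" for i :: int and k
    using that
  proof (induction k arbitrary: i)
    case 0
    then have "i = 0 \<or> i = 1" by auto
    then show ?case using ends RL yx unfolding a0_def E_def by (auto split: if_splits)
  next
    case (Suc k)
    show ?case
    proof (cases "even i")
      case True
      then obtain j where j: "i = 2 * j" by blast
      then have "0 \<le> j" "j \<le> 2 ^ k" using Suc.prems by auto
      from Suc.IH[OF this] show ?thesis unfolding j by simp
    next
      case False
      then obtain j where j: "i = 2 * j + 1" by (auto elim: oddE)
      then have j0: "0 \<le> j" "j < 2 ^ k" using Suc.prems by auto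
      \<comment> \<open>The left index of the image of the subinterval with index \<open>j\<close>.
        If the orientation is reversed the count starts at the right end, hence the final
        \<open>- 1\<close>.\<close>
      define q where "q = (if E = 1 then m' * 2 ^ k + j else m' * 2 ^ k + 2 ^ k - j - 1)"
      have x1: "of_int (m * 2 ^ k + j) / 2 ^ (N + k) = x + of_int j / 2 ^ (N + k)"
        "(of_int (m * 2 ^ k + j) + 1) / 2 ^ (N + k) = x + of_int (j + 1) / 2 ^ (N + k)"
        using pow2_shift[of "of_int m" k N] by (simp_all add: x_def add_divide_distrib)
      have i1: "\<sigma> (gam (x + of_int j / 2 ^ (N + k))) = gam (a0 + of_int E * of_int j / 2 ^ (n' + k))"
        "\<sigma> (gam (x + of_int (j + 1) / 2 ^ (N + k))) = gam (a0 + of_int E * of_int (j + 1) / 2 ^ (n' + k))"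
        using Suc.IH[of j] Suc.IH[of "j + 1"] j0 by simp_all
      have q1: "E = 1 \<Longrightarrow> of_int q / 2 ^ (n' + k) = a0 + of_int E * of_int j / 2 ^ (n' + k)"
        "E = 1 \<Longrightarrow> (of_int q + 1) / 2 ^ (n' + k) = a0 + of_int E * of_int (j + 1) / 2 ^ (n' + k)"
        using pow2_shift[of "of_int m'" k n'] by (simp_all add: a0_def L_def q_def add_divide_distrib)
      have q2: "of_int q / 2 ^ (n' + k) = a0 + of_int E * of_int (j + 1) / 2 ^ (n' + k)"
        "(of_int q + 1) / 2 ^ (n' + k) = a0 + of_int E * of_int j / 2 ^ (n' + k)" if "E = - 1"
        using pow2_shift[of "of_int m'" k n'] pow2_shift[of 1 k n'] that
        by (simp_all add: a0_def R_def q_def add_divide_distrib diff_divide_distrib)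
      have "\<sigma> (gam ((of_int (m * 2 ^ k + j) / 2 ^ (N + k) + (of_int (m * 2 ^ k + j) + 1) / 2 ^ (N + k)) / 2)) =
         gam ((of_int q / 2 ^ (n' + k) + (of_int q + 1) / 2 ^ (n' + k)) / 2)"
      proof (rule sigma_midpoint[OF N(1) N(2) _ _ M])
        show "N \<le> N + k" "M < n' + k" using n' by auto
        show "\<sigma> (gam (of_int (m * 2 ^ k + j) / 2 ^ (N + k))) = gam (of_int q / 2 ^ (n' + k)) \<and>
          \<sigma> (gam ((of_int (m * 2 ^ k + j) + 1) / 2 ^ (N + k))) = gam ((of_int q + 1) / 2 ^ (n' + k)) \<or>
          \<sigma> (gam (of_int (m * 2 ^ k + j) / 2 ^ (N + k))) = gam ((of_int q + 1) / 2 ^ (n' + k)) \<and>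
          \<sigma> (gam ((of_int (m * 2 ^ k + j) + 1) / 2 ^ (N + k))) = gam (of_int q / 2 ^ (n' + k))"
          unfolding x1 i1 using E
        proof
          assume "E = 1"
          then show "gam (a0 + of_int E * of_int j / 2 ^ (n' + k)) = gam (of_int q / 2 ^ (n' + k)) \<and>
            gam (a0 + of_int E * of_int (j + 1) / 2 ^ (n' + k)) = gam ((of_int q + 1) / 2 ^ (n' + k)) \<or>
            gam (a0 + of_int E * of_int j / 2 ^ (n' + k)) = gam ((of_int q + 1) / 2 ^ (n' + k)) \<and>
            gam (a0 + of_int E * of_int (j + 1) / 2 ^ (n' + k)) = gam (of_int q / 2 ^ (n' + k))"
            by (simp only: q1) blast
        next
          assume "E = - 1"
          then show "gam (a0 + of_int E * of_int j / 2 ^ (n' + k)) = gam (of_int q / 2 ^ (n' + k)) \<and>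
            gam (a0 + of_int E * of_int (j + 1) / 2 ^ (n' + k)) = gam ((of_int q + 1) / 2 ^ (n' + k)) \<or>
            gam (a0 + of_int E * of_int j / 2 ^ (n' + k)) = gam ((of_int q + 1) / 2 ^ (n' + k)) \<and>
            gam (a0 + of_int E * of_int (j + 1) / 2 ^ (n' + k)) = gam (of_int q / 2 ^ (n' + k))"
            by (simp only: q2) blast
        qed
      qed
      moreover have "(of_int (m * 2 ^ k + j) / 2 ^ (N + k) + (of_int (m * 2 ^ k + j) + 1) / 2 ^ (N + k)) / 2
          = x + of_int i / 2 ^ (N + Suc k)"
        unfolding x1 j by (simp add: field_simps)
      moreover have "(of_int q / 2 ^ (n' + k) + (of_int q + 1) / 2 ^ (n' + k)) / 2 = a0 + of_int E * of_int i / 2 ^ (n' + Suc k)"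
        using E
      proof
        assume "E = 1"
        then show ?thesis unfolding q1[OF \<open>E = 1\<close>] j by (simp add: field_simps)
      next
        assume "E = - 1"
        then show ?thesis unfolding q2[OF \<open>E = - 1\<close>] j by (simp add: field_simps)
      qed
      ultimately show ?thesis by (simp only:)
    qed
  qed
  \<comment> \<open>An interval of length 1 / 2^N goes to one of length 1 / 2^n'.\<close>
  define k where "k = int N - int n'"
  have k: "2 powi k = 2 ^ N / (2 ^ n' :: real)" by (simp add: k_def power_int_diff)
  define c where "c = a0 - of_int E * 2 powi k * x"
  have "a0 \<in> dyadics" unfolding a0_def L_def R_def using dyadicsI[of "m' + 1" n'] by auto
  moreover have "x \<in> dyadics" by (auto simp: x_def)
  then have "of_int E * 2 powi k * x \<in> dyadics" by (intro dyadics_mult) auto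
  ultimately have "c \<in> dyadics" unfolding c_def by (rule dyadics_diff)
  moreover have "\<sigma> (gam u) = gam (of_int E * 2 powi k * u + c)" if u: "u \<in> dyadics" "x \<le> u" "u \<le> y" for u
  proof -
    obtain i0 l where u0: "u = of_int i0 / 2 ^ l" using u(1) by (rule dyadicsE)
    define i where "i = i0 * 2 ^ N - m * 2 ^ l"
    have ui: "u = x + of_int i / 2 ^ (N + l)"
      using pow2_shift[of "of_int i0" N l] pow2_shift[of "of_int m" l N]
      by (simp add: u0 x_def i_def diff_divide_distrib add.commute)
    have "0 \<le> real_of_int i / 2 ^ (N + l)" "real_of_int i / 2 ^ (N + l) \<le> 2 ^ l / 2 ^ (N + l)"
      using u ui yx pow2_shift[of 1 l N] by simp_all
    moreover have "(2::real) ^ (N + l) > 0" by simp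
    ultimately have "0 \<le> real_of_int i" "real_of_int i \<le> 2 ^ l"
      by (metis divide_neg_pos not_le, metis divide_le_cancel not_le)
    then have "0 \<le> real_of_int i" "real_of_int i \<le> real_of_int (2 ^ l)" by simp_all
    then have "0 \<le> i" "i \<le> 2 ^ l" by (simp_all only: of_int_le_iff of_int_0_le_iff)
    from grid[OF this] have "\<sigma> (gam u) = gam (a0 + of_int E * of_int i / 2 ^ (n' + l))" by (simp only: ui)
    also have "a0 + of_int E * of_int i / 2 ^ (n' + l) = of_int E * 2 powi k * u + c"
      unfolding c_def k ui by (simp add: field_simps power_add)
    finally show ?thesis .
  qed
  ultimately show ?thesis using E unfolding x_def y_def
    by (intro exI[of _ "of_int E"] exI[of _ k] exI[of _ c]) auto
qed

text \<open>The affine formulas of the intervals of level \<open>N\<close> are glued. At a common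
  end both formulas give the value of \<open>\<sigma>\<close>, because the end is dyadic; this makes
  the map continuous, also at the point where the parameters 0 and 1 meet.\<close>

lemma circle_extension:
  obtains h N where "continuous_on circle h" "h ` circle \<subseteq> circle" "\<And>p. p \<in> dyadic_points \<Longrightarrow> h p = \<sigma> p" "dyadic_affine h N"
proof -
  have "\<sigma> ` {gam 0, gam (1/4), gam (1/2)} \<subseteq> dyadic_points"
    using sigma_dyadic gam_mem_dyadic_points_iff dyadicsI[of 0 0] dyadicsI[of 1 2] dyadicsI[of 1 1] by auto
  moreover have "\<exists>M. P \<subseteq> Lev M" if "finite P" "P \<subseteq> dyadic_points" for P
    using that
  proof (induction P rule: finite_induct)
    case (insert p P)
    then obtain N k where "P \<subseteq> Lev N" "p \<in> Lev k" by (auto simp: dyadic_points_eq)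
    then have "insert p P \<subseteq> Lev (max N k)" using Lev_mono[of N "max N k"] Lev_mono[of k "max N k"] by auto
    then show ?case by blast
  qed auto
  ultimately obtain M where M: "\<sigma> ` {gam 0, gam (1/4), gam (1/2)} \<subseteq> Lev M"
    by (meson finite.emptyI finite.insertI finite_imageI)
  obtain N where N: "N \<ge> 2" "\<And>n m. n \<ge> N \<Longrightarrow> \<exists>n' m'. M < n' \<and> \<beta> (sarc n m) = sarc n' m'"
    using beta_small_arcs[of M] by blast
  have "\<forall>m::int. \<exists>e k c. (e = 1 \<or> e = - 1) \<and> c \<in> dyadics \<and>
    (\<forall>u\<in>dyadics \<inter> {of_int m / 2 ^ N..(of_int m + 1) / 2 ^ N}. \<sigma> (gam u) = gam (e * 2 powi k * u + c))"
    using sigma_locally_affine[OF N(2) N(1) M] by blast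
  then obtain e :: "int \<Rightarrow> real" and k :: "int \<Rightarrow> int" and c :: "int \<Rightarrow> real" where ekc:
    "\<And>m. e m = 1 \<or> e m = - 1" "\<And>m. c m \<in> dyadics"
    "\<And>m u. u \<in> dyadics \<Longrightarrow> u \<in> {of_int m / 2 ^ N..(of_int m + 1) / 2 ^ N} \<Longrightarrow> \<sigma> (gam u) = gam (e m * 2 powi (k m) * u + c m)"
    by (metis IntI)
  define f where "f m u = gam (e m * 2 powi (k m) * u + c m)" for m u
  \<comment> \<open>Parameters are taken in the half-open unit interval, so at the right end of an
    interval \<open>h\<close> uses the formula of the next one; \<open>hf\<close> reconciles the
    two.\<close>
  define par where "par w = (SOME u. 0 \<le> u \<and> u < 1 \<and> gam u = w)" for w
  have par: "par (gam u) = u" if u: "0 \<le> u" "u < 1" for u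
  proof -
    have "0 \<le> par (gam u) \<and> par (gam u) < 1 \<and> gam (par (gam u)) = gam u"
      unfolding par_def using u by (intro someI[of "\<lambda>v. 0 \<le> v \<and> v < 1 \<and> gam v = gam u" u]) simp
    then show ?thesis using gam_inj[of "par (gam u)" u] u by (auto simp: abs_less_iff)
  qed
  define h where "h w = f \<lfloor>par w * 2 ^ N\<rfloor> (par w)" for w
  have hs: "h p = \<sigma> p" if p: "p \<in> dyadic_points" for p
  proof -
    obtain u where u: "0 \<le> u" "u < 0 + 1" "p = gam u" using circle_param[OF dyadic_points_circle[OF p]] by blast
    then have ud: "u \<in> dyadics" using p gam_mem_dyadic_points_iff by blast
    obtain m :: int where m: "of_int m / 2 ^ N \<le> u" "u < (of_int m + 1) / 2 ^ N" "m = \<lfloor>u * 2 ^ N\<rfloor>" using level_interval[of u N] u by auto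
    have "h p = f m u" unfolding h_def u(3) using par[of u] u m by simp
    then show ?thesis using ekc(3)[OF ud, of m] m unfolding f_def u(3) by simp
  qed
  have hf: "h (gam u) = f m u" if m: "0 \<le> m" "m < 2 ^ N" and u: "u \<in> {of_int m / 2 ^ N..(of_int m + 1) / 2 ^ N}" for m u
  proof (cases "u = (of_int m + 1) / 2 ^ N")
    case True
    then have "u = of_int (m + 1) / 2 ^ N" by simp
    then have ud: "u \<in> dyadics" by blast
    then have "h (gam u) = \<sigma> (gam u)" using hs gam_mem_dyadic_points_iff by blast
    then show ?thesis using ekc(3)[OF ud u] by (simp add: f_def)
  next
    case False
    then have u': "of_int m / 2 ^ N \<le> u" "u < (of_int m + 1) / 2 ^ N" using u by auto
    have "real_of_int (m + 1) \<le> real_of_int (2 ^ N)" using m by (simp only: of_int_le_iff)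
    then have "(of_int m + 1) / 2 ^ N \<le> (1 :: real)" by (simp add: field_simps)
    then have "u < 1" using u' by linarith
    moreover have "0 \<le> (of_int m / 2 ^ N :: real)" using m by simp
    then have "0 \<le> u" using u' by linarith
    moreover have "\<lfloor>u * 2 ^ N\<rfloor> = m" using u' by (intro floor_unique) (auto simp: field_simps)
    ultimately show ?thesis unfolding h_def using par[of u] by simp
  qed
  have aff: "dyadic_affine h N" unfolding dyadic_affine_def using hf ekc(1,2) unfolding f_def by blast
  have hc: "h ` circle \<subseteq> circle" unfolding h_def f_def using gam_circle by blast
  have "continuous_on (\<Union>m\<in>{0..<2 ^ N}. {of_int m / 2 ^ N..(of_int m + 1) / 2 ^ N}) (\<lambda>u. h (gam u))"
  proof (rule continuous_on_closed_Union)
    fix m :: int assume m: "m \<in> {0..<2 ^ N}"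
    have "continuous_on {of_int m / 2 ^ N..(of_int m + 1) / 2 ^ N} (f m)"
      unfolding f_def by (rule continuous_on_compose2[OF continuous_gam[of UNIV]]) (auto intro!: continuous_intros)
    then show "continuous_on {of_int m / 2 ^ N..(of_int m + 1) / 2 ^ N} (\<lambda>u. h (gam u))"
      by (rule continuous_on_eq) (use hf[of m] m in simp)
  qed auto
  moreover have "{0..1} \<subseteq> (\<Union>m\<in>{0..<2 ^ N}. {of_int m / 2 ^ N..(of_int m + 1) / (2 ^ N :: real)})"
  proof
    fix s :: real assume s: "s \<in> {0..1}"
    have "\<exists>m::int. 0 \<le> m \<and> m < 2 ^ N \<and> s \<in> {of_int m / 2 ^ N..(of_int m + 1) / 2 ^ N}"
    proof (cases "s < 1")
      case True
      then obtain m :: int where "0 \<le> m" "m < 2 ^ N" "of_int m / 2 ^ N \<le> s" "s < (of_int m + 1) / 2 ^ N"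
        using level_interval[of s N] s by (metis atLeastAtMost_iff)
      then show ?thesis by (intro exI[of _ m]) simp
    next
      case False
      then have "s = 1" using s by auto
      then show ?thesis by (intro exI[of _ "2 ^ N - 1"]) (auto simp: field_simps)
    qed
    then show "s \<in> (\<Union>m\<in>{0..<2 ^ N}. {of_int m / 2 ^ N..(of_int m + 1) / (2 ^ N :: real)})" by auto
  qed
  ultimately have "continuous_on {0..1} (\<lambda>u. h (gam u))" by (rule continuous_on_subset)
  then have "continuous_on circle h" by (rule continuous_on_circle)
  then show ?thesis using that hc hs aff by blast
qed

end

section \<open>Order automorphisms come from the Thompson group\<close>

lemma continuous_agree_circle:
  assumes "continuous_on circle f" "continuous_on circle g" "\<And>p. p \<in> dyadic_points \<Longrightarrow> f p = g p" "w \<in> circle"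
  shows "f w = (g w :: point)"
proof -
  have cl: "closed circle" by (simp add: circle_def)
  have "continuous_on circle (\<lambda>w. f w - g w)" using assms by (intro continuous_on_diff)
  then have "closed {w \<in> circle. f w - g w = 0}" by (rule continuous_closed_preimage_constant[OF _ cl])
  moreover have "dyadic_points \<subseteq> {w \<in> circle. f w - g w = 0}" using assms(3) dyadic_points_circle by auto
  ultimately have "closure dyadic_points \<subseteq> {w \<in> circle. f w - g w = 0}" by (intro closure_minimal)
  then show ?thesis using assms(4) unfolding closure_dyadic_points by auto
qed

text \<open>Both the vertex bijection and its inverse are extended. The extensions invert each other
  on the dyadic points, hence on the circle by density, so they are bijective.\<close>

lemma order_auto_is_act:
  assumes f: "order_auto f"
  obtains t where "t \<in> carrier T_no" "\<And>A. A \<in> F_tessellations \<Longrightarrow> f A = act t A"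
proof -
  obtain \<beta> where b: "bij_betw \<beta> dyadic_arcs dyadic_arcs" "\<And>A. A \<in> F_tessellations \<Longrightarrow> f A = \<beta> ` A"
    "\<And>d d'. d \<in> dyadic_arcs \<Longrightarrow> d' \<in> dyadic_arcs \<Longrightarrow> crosses (\<beta> d) (\<beta> d') \<longleftrightarrow> crosses d d'"
    using order_auto_arc_bij[OF f] by blast
  obtain \<sigma> where s: "bij_betw \<sigma> dyadic_points dyadic_points"
    "\<And>p q. p \<in> dyadic_points \<Longrightarrow> q \<in> dyadic_points \<Longrightarrow> p \<noteq> q \<Longrightarrow> \<beta> (seg p q) = seg (\<sigma> p) (\<sigma> q)"
    using arc_bij_induced[OF b(1,3)] by blast
  have AFT: "A_F \<in> F_tessellations" by (simp add: F_tessellations_eq tess_A_F)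
  then have "f A_F \<in> F_tessellations" using f unfolding order_auto_def by (metis bij_betw_apply)
  then have sd: "finite (sym_diff (\<beta> ` A_F) A_F)" using b(2)[OF AFT] by (simp add: F_tessellations_eq tess_def)
  then have fin: "finite (\<beta> ` A_F - A_F)" by simp
  obtain h N where h: "continuous_on circle h" "h ` circle \<subseteq> circle" "\<And>p. p \<in> dyadic_points \<Longrightarrow> h p = \<sigma> p" "dyadic_affine h N"
    using circle_extension[OF s b(1,3) fin] by blast
  define \<sigma>' where "\<sigma>' = inv_into dyadic_points \<sigma>"
  define \<beta>' where "\<beta>' = inv_into dyadic_arcs \<beta>"
  have ss: "\<sigma>' (\<sigma> p) = p" "\<sigma> (\<sigma>' p) = p" "\<sigma> p \<in> dyadic_points" "\<sigma>' p \<in> dyadic_points" if "p \<in> dyadic_points" for p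
    using bij_betw_inv_into_left[OF s(1) that] bij_betw_inv_into_right[OF s(1) that] bij_betw_apply[OF s(1) that]
      bij_betw_apply[OF bij_betw_inv_into[OF s(1)] that] by (simp_all add: \<sigma>'_def)
  have bb: "\<beta>' (\<beta> d) = d" "\<beta> (\<beta>' d) = d" "\<beta> d \<in> dyadic_arcs" "\<beta>' d \<in> dyadic_arcs" if "d \<in> dyadic_arcs" for d
    using bij_betw_inv_into_left[OF b(1) that] bij_betw_inv_into_right[OF b(1) that] bij_betw_apply[OF b(1) that]
      bij_betw_apply[OF bij_betw_inv_into[OF b(1)] that] by (simp_all add: \<beta>'_def)
  have s1: "bij_betw \<sigma>' dyadic_points dyadic_points" unfolding \<sigma>'_def by (rule bij_betw_inv_into[OF s(1)])
  have b1: "bij_betw \<beta>' dyadic_arcs dyadic_arcs" unfolding \<beta>'_def by (rule bij_betw_inv_into[OF b(1)])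
  have sb1: "\<beta>' (seg p q) = seg (\<sigma>' p) (\<sigma>' q)" if pq: "p \<in> dyadic_points" "q \<in> dyadic_points" "p \<noteq> q" for p q
  proof -
    have ne: "\<sigma>' p \<noteq> \<sigma>' q" using ss pq by metis
    have "\<beta> (seg (\<sigma>' p) (\<sigma>' q)) = seg p q" using s(2)[OF ss(4)[OF pq(1)] ss(4)[OF pq(2)] ne] ss pq by simp
    then show ?thesis using bb(1)[OF dyadic_arcI[OF ss(4)[OF pq(1)] ss(4)[OF pq(2)] ne]] by simp
  qed
  have cr1: "crosses (\<beta>' d) (\<beta>' d') \<longleftrightarrow> crosses d d'" if "d \<in> dyadic_arcs" "d' \<in> dyadic_arcs" for d d'
    using b(3)[of "\<beta>' d" "\<beta>' d'"] bb that by simp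
  \<comment> \<open>For the inverse, finiteness comes from the other half of the symmetric
    difference between \<open>A_F\<close> and its image.\<close>
  have "\<beta>' ` A_F - A_F \<subseteq> \<beta>' ` (A_F - \<beta> ` A_F)"
  proof
    fix d assume d: "d \<in> \<beta>' ` A_F - A_F"
    then obtain a where a: "a \<in> A_F" "d = \<beta>' a" by blast
    have "a \<notin> \<beta> ` A_F" using d a bb(1) A_F_dyadic_arcs by (metis Diff_iff imageE subsetD)
    then show "d \<in> \<beta>' ` (A_F - \<beta> ` A_F)" using a by blast
  qed
  moreover have "finite (A_F - \<beta> ` A_F)" using sd by simp
  ultimately have fin1: "finite (\<beta>' ` A_F - A_F)" using finite_subset by blast
  obtain g N' where g: "continuous_on circle g" "g ` circle \<subseteq> circle" "\<And>p. p \<in> dyadic_points \<Longrightarrow> g p = \<sigma>' p" "dyadic_affine g N'"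
    using circle_extension[OF s1 sb1 b1 cr1 fin1] by blast
  have gh: "g (h w) = w" if "w \<in> circle" for w
    using continuous_agree_circle[of "\<lambda>w. g (h w)" "\<lambda>w. w" w] continuous_on_compose2[OF g(1) h(1,2)] that h(3) g(3) ss
    by (simp add: continuous_on_id)
  have hg: "h (g w) = w" if "w \<in> circle" for w
    using continuous_agree_circle[of "\<lambda>w. h (g w)" "\<lambda>w. w" w] continuous_on_compose2[OF h(1) g(1,2)] that h(3) g(3) ss
    by (simp add: continuous_on_id)
  have hbij: "bij_betw h circle circle" by (rule bij_betw_byWitness[of _ g]) (use gh hg h(2) g(2) in auto)
  \<comment> \<open>Elements of \<open>Bij circle\<close> take the value \<open>undefined\<close>
    off the circle.\<close>
  define t where "t = restrict h circle"
  have th: "t w = h w" if "w \<in> circle" for w using that by (simp add: t_def)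
  have tX: "t p = \<sigma> p" if "p \<in> dyadic_points" for p using th[OF dyadic_points_circle[OF that]] h(3)[OF that] by simp
  have "t \<in> Bij circle" using hbij th unfolding Bij_def by (simp add: t_def cong: bij_betw_cong)
  moreover have "continuous_on circle t" using h(1) th by (simp cong: continuous_on_cong)
  moreover have "t ` dyadic_points = dyadic_points" using tX bij_betw_imp_surj_on[OF s(1)] by (simp cong: image_cong)
  ultimately have homeo: "dyadic_homeo t" by (simp add: dyadic_homeo_def)
  have "dyadic_affine t N" using h(4) th[OF gam_circle] unfolding dyadic_affine_def by simp
  then have tT: "t \<in> carrier T_no" using homeo T_noI by blast
  have "f A = act t A" if A: "A \<in> F_tessellations" for A
  proof -
    have arcs: "A \<subseteq> dyadic_arcs" using A by (simp add: F_tessellations_eq tess_def)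
    have "chord_map t d = \<beta> d" if d: "d \<in> A" for d
    proof -
      obtain p q where pq: "d = seg p q" "p \<in> dyadic_points" "q \<in> dyadic_points" "p \<noteq> q" using dyadic_arcE arcs d by (metis subsetD)
      then show ?thesis using chord_map_seg tX s(2) by simp
    qed
    then show ?thesis using b(2)[OF A] act_eq_chord_map[OF arcs] by (simp cong: image_cong)
  qed
  then show ?thesis using that tT by blast
qed

section \<open>Automorphisms of the complex\<close>

text \<open>The boundary is a union, and containment in a union does not by itself give containment
  in one member; the generic point of the cell of \<open>A\<close> singles out a member.\<close>

lemma closed_cell_subset_boundary_iff:
  assumes A: "A \<in> F_tessellations" and B: "B \<in> F_tessellations"
  shows "closed_cell A \<subseteq> cell_boundary B \<longleftrightarrow> B \<subset> A"
proof
  assume sub: "closed_cell A \<subseteq> cell_boundary B"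
  obtain c where c: "c \<in> closed_cell A" "\<And>B. B \<in> F_tessellations \<Longrightarrow> c \<in> closed_cell B \<Longrightarrow> B \<subseteq> A"
    using generic_point[OF A] by blast
  have "c \<in> cell_boundary B" using c(1) sub by (rule subsetD[rotated])
  then obtain D where "D \<in> F_tessellations" "B \<subset> D" "c \<in> closed_cell D" unfolding cell_boundary_def by blast
  then show "B \<subset> A" using c(2) by blast
next
  assume "B \<subset> A"
  then have "closed_cell A \<in> {closed_cell A | A. A \<in> F_tessellations \<and> B \<subset> A}" using A by blast
  then show "closed_cell A \<subseteq> cell_boundary B" unfolding cell_boundary_def by (rule Union_upper)
qed

text \<open>Expresses triangulations through the order, so that order automorphisms preserve
  them.\<close>

lemma F_triangulation_iff_maximal:
  "F_triangulation A \<longleftrightarrow> A \<in> F_tessellations \<and> (\<forall>X\<in>F_tessellations. A \<subseteq> X \<longrightarrow> X = A)"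
proof
  assume "F_triangulation A"
  then have A: "maxtess A" by (simp add: F_triangulation_iff)
  have "X = A" if X: "X \<in> F_tessellations" "A \<subseteq> X" for X
  proof -
    have X': "tess X" using X by (simp add: F_tessellations_eq)
    have "d \<in> A" if "d \<in> X" for d
      using A tess_dyadic_arcs[OF X' that] tess_not_crosses[OF X' that] X(2) unfolding maxtess_def by blast
    then show ?thesis using X(2) by blast
  qed
  then show "A \<in> F_tessellations \<and> (\<forall>X\<in>F_tessellations. A \<subseteq> X \<longrightarrow> X = A)"
    using A by (simp add: F_tessellations_eq maxtess_def)
next
  assume A: "A \<in> F_tessellations \<and> (\<forall>X\<in>F_tessellations. A \<subseteq> X \<longrightarrow> X = A)"
  then obtain A' where "A \<subseteq> A'" "maxtess A'" using tess_extend[of A] by (auto simp: F_tessellations_eq)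
  then have "A' = A" using A by (simp add: F_tessellations_eq maxtess_def)
  then show "F_triangulation A" using \<open>maxtess A'\<close> by (simp add: F_triangulation_iff)
qed

context
  fixes f assumes f: "order_auto f"
begin

lemma order_auto_in: "A \<in> F_tessellations \<Longrightarrow> f A \<in> F_tessellations"
  using f unfolding order_auto_def by (blast intro: bij_betw_apply)

lemma order_auto_le: "A \<in> F_tessellations \<Longrightarrow> B \<in> F_tessellations \<Longrightarrow> f A \<subseteq> f B \<longleftrightarrow> A \<subseteq> B"
  using f unfolding order_auto_def by blast

lemma order_auto_eq: "A \<in> F_tessellations \<Longrightarrow> B \<in> F_tessellations \<Longrightarrow> f A = f B \<longleftrightarrow> A = B"
  using order_auto_le[of A B] order_auto_le[of B A] by auto

lemma order_auto_surj:
  assumes "B \<in> F_tessellations" obtains A where "A \<in> F_tessellations" "f A = B"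
proof -
  have "B \<in> f ` F_tessellations" using f assms by (simp add: order_auto_def bij_betw_def)
  then show ?thesis using that by blast
qed

lemma order_auto_triangulation:
  assumes "A \<in> F_tessellations" shows "F_triangulation (f A) \<longleftrightarrow> F_triangulation A"
proof -
  have "(\<forall>X\<in>F_tessellations. f A \<subseteq> X \<longrightarrow> X = f A) \<longleftrightarrow> (\<forall>X\<in>f ` F_tessellations. f A \<subseteq> X \<longrightarrow> X = f A)"
    using f by (simp add: order_auto_def bij_betw_def)
  also have "\<dots> \<longleftrightarrow> (\<forall>X\<in>F_tessellations. A \<subseteq> X \<longrightarrow> X = A)"
    using order_auto_le[OF assms] order_auto_eq[OF _ assms] by simp
  finally show ?thesis unfolding F_triangulation_iff_maximal using assms order_auto_in[OF assms] by blast
qed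

text \<open>An automorphism preserves the predicate describing the rank, so uniqueness of the rank is not
  an issue.\<close>

lemma order_auto_rank:
  assumes B: "B \<in> F_tessellations" shows "tess_rank (f B) = tess_rank B"
proof -
  obtain \<beta> where b: "bij_betw \<beta> dyadic_arcs dyadic_arcs" "\<And>A. A \<in> F_tessellations \<Longrightarrow> f A = \<beta> ` A"
    "\<And>d d'. d \<in> dyadic_arcs \<Longrightarrow> d' \<in> dyadic_arcs \<Longrightarrow> crosses (\<beta> d) (\<beta> d') \<longleftrightarrow> crosses d d'"
    using order_auto_arc_bij[OF f] by blast
  have tri: "A \<in> F_tessellations" if "F_triangulation A" for A using that by (simp add: F_triangulation_iff_maximal)
  \<comment> \<open>With \<open>K\<close> eliminated as \<open>A - D\<close>, only the order and the
    sizes of differences remain.\<close>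
  have char: "(\<exists>A K. F_triangulation A \<and> finite K \<and> K \<subseteq> A \<and> D = A - K \<and> card K = k) \<longleftrightarrow>
     (\<exists>A\<in>F_tessellations. F_triangulation A \<and> D \<subseteq> A \<and> card (A - D) = k)" if D: "D \<in> F_tessellations" for D k
  proof
    assume "\<exists>A K. F_triangulation A \<and> finite K \<and> K \<subseteq> A \<and> D = A - K \<and> card K = k"
    then obtain A K where A: "F_triangulation A" "K \<subseteq> A" "D = A - K" "card K = k" by blast
    have "A - D = K" using A(2,3) by blast
    then have "card (A - D) = k" using A(4) by simp
    moreover have "D \<subseteq> A" using A(3) by blast
    ultimately show "\<exists>A\<in>F_tessellations. F_triangulation A \<and> D \<subseteq> A \<and> card (A - D) = k"
      using tri[OF A(1)] A(1) by (intro bexI[of _ A] conjI)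
  next
    assume "\<exists>A\<in>F_tessellations. F_triangulation A \<and> D \<subseteq> A \<and> card (A - D) = k"
    then obtain A where A: "A \<in> F_tessellations" "F_triangulation A" "D \<subseteq> A" "card (A - D) = k" by blast
    have "finite (A - D)" using tess_finite_Diff A D by (simp add: F_tessellations_eq)
    moreover have "D = A - (A - D)" using A(3) by blast
    ultimately show "\<exists>A K. F_triangulation A \<and> finite K \<and> K \<subseteq> A \<and> D = A - K \<and> card K = k"
      using A(2,4) by (intro exI[of _ A] exI[of _ "A - D"] conjI Diff_subset)
  qed
  have card: "card (f A - f B) = card (A - B)" if A: "A \<in> F_tessellations" for A
  proof -
    have arcs: "A \<subseteq> dyadic_arcs" "B \<subseteq> dyadic_arcs" using A B by (simp_all add: F_tessellations_eq tess_def)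
    have "f A - f B = \<beta> ` (A - B)"
      unfolding b(2)[OF A] b(2)[OF B]
      using inj_on_image_set_diff[OF bij_betw_imp_inj_on[OF b(1)] subset_trans[OF Diff_subset arcs(1)] arcs(2)] by simp
    moreover have "inj_on \<beta> (A - B)"
      using inj_on_subset[OF bij_betw_imp_inj_on[OF b(1)] subset_trans[OF Diff_subset arcs(1)]] .
    ultimately show ?thesis by (simp add: card_image)
  qed
  have "(\<exists>A\<in>F_tessellations. F_triangulation A \<and> f B \<subseteq> A \<and> card (A - f B) = k) \<longleftrightarrow>
     (\<exists>A\<in>F_tessellations. F_triangulation A \<and> B \<subseteq> A \<and> card (A - B) = k)" for k
  proof
    assume "\<exists>A\<in>F_tessellations. F_triangulation A \<and> f B \<subseteq> A \<and> card (A - f B) = k"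
    then obtain A' where A': "A' \<in> F_tessellations" "F_triangulation A'" "f B \<subseteq> A'" "card (A' - f B) = k" by blast
    obtain A where A: "A \<in> F_tessellations" "f A = A'" using order_auto_surj[OF A'(1)] .
    then show "\<exists>A\<in>F_tessellations. F_triangulation A \<and> B \<subseteq> A \<and> card (A - B) = k"
      using A'(2-4) order_auto_triangulation[OF A(1)] order_auto_le[OF B A(1)] card[OF A(1)]
      unfolding A(2) by (intro bexI[OF _ A(1)]) simp
  next
    assume "\<exists>A\<in>F_tessellations. F_triangulation A \<and> B \<subseteq> A \<and> card (A - B) = k"
    then obtain A where A: "A \<in> F_tessellations" "F_triangulation A" "B \<subseteq> A" "card (A - B) = k" by blast
    then show "\<exists>A\<in>F_tessellations. F_triangulation A \<and> f B \<subseteq> A \<and> card (A - f B) = k"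
      using A(2-4) order_auto_triangulation[OF A(1)] order_auto_le[OF B A(1)] card[OF A(1)]
      by (intro bexI[OF _ order_auto_in[OF A(1)]]) simp
  qed
  then show ?thesis unfolding tess_rank_def char[OF B] char[OF order_auto_in[OF B]] by simp
qed

end

section \<open>Automorphisms of the complex and of the poset\<close>

definition tess_of :: "cpoint set \<Rightarrow> chord set" where
  "tess_of c = inv_into F_tessellations closed_cell c"

definition cell_map :: "(chord set \<Rightarrow> chord set) \<Rightarrow> cpoint set \<Rightarrow> cpoint set" where
  "cell_map f = (\<lambda>c\<in>closed_cells. closed_cell (f (tess_of c)))"

lemma inj_on_closed_cell: "inj_on closed_cell F_tessellations"
  by (rule inj_onI) (simp add: closed_cell_inj)

lemma tess_of_closed_cell [simp]: "A \<in> F_tessellations \<Longrightarrow> tess_of (closed_cell A) = A"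
  unfolding tess_of_def using inj_on_closed_cell by simp

lemma closed_cellsE:
  assumes "c \<in> closed_cells" obtains A where "A \<in> F_tessellations" "c = closed_cell A"
  using assms unfolding closed_cells_def by blast

lemma closed_cell_in: "A \<in> F_tessellations \<Longrightarrow> closed_cell A \<in> closed_cells"
  unfolding closed_cells_def by blast

lemma cell_map_closed_cell: "A \<in> F_tessellations \<Longrightarrow> cell_map f (closed_cell A) = closed_cell (f A)"
  by (simp add: cell_map_def closed_cell_in)

lemma cell_map_cong:
  assumes "\<And>A. A \<in> F_tessellations \<Longrightarrow> f A = g A" shows "cell_map f = cell_map g"
proof
  fix c show "cell_map f c = cell_map g c"
  proof (cases "c \<in> closed_cells")
    case True
    then obtain A where "A \<in> F_tessellations" "c = closed_cell A" by (rule closed_cellsE)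
    then show ?thesis using assms by (simp add: cell_map_closed_cell)
  qed (simp add: cell_map_def)
qed

lemma Aut_C_carrier: "carrier Aut_C = {\<phi> \<in> Bij closed_cells.
    preserves_dimensions \<phi> \<and> preserves_inclusions \<phi> \<and> preserves_boundaries \<phi>}"
  by (simp add: Aut_C_def)

lemma boundary_cells:
  assumes "B \<in> F_tessellations"
  shows "{c \<in> closed_cells. c \<subseteq> cell_boundary B} = closed_cell ` {A \<in> F_tessellations. B \<subset> A}"
proof (intro equalityI subsetI)
  fix c assume "c \<in> {c \<in> closed_cells. c \<subseteq> cell_boundary B}"
  then obtain A where "A \<in> F_tessellations" "c = closed_cell A" "c \<subseteq> cell_boundary B" using closed_cellsE by blast
  then show "c \<in> closed_cell ` {A \<in> F_tessellations. B \<subset> A}"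
    using closed_cell_subset_boundary_iff[OF _ assms] by simp
next
  fix c assume "c \<in> closed_cell ` {A \<in> F_tessellations. B \<subset> A}"
  then obtain A where "A \<in> F_tessellations" "c = closed_cell A" "B \<subset> A" by blast
  then show "c \<in> {c \<in> closed_cells. c \<subseteq> cell_boundary B}"
    using closed_cell_subset_boundary_iff[OF _ assms] closed_cell_in by simp
qed

lemma cell_map_Aut:
  assumes f: "order_auto f" shows "cell_map f \<in> carrier Aut_C"
proof -
  note fin = order_auto_in[OF f] and le = order_auto_le[OF f] and eq = order_auto_eq[OF f] and surj = order_auto_surj[OF f]
  have img: "f A = B" if "A \<in> F_tessellations" "B \<in> F_tessellations" "cell_map f (closed_cell A) = closed_cell B" for A B
    using that fin by (simp add: cell_map_closed_cell closed_cell_inj)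
  have "bij_betw (cell_map f) closed_cells closed_cells"
    unfolding bij_betw_def
  proof
    show "inj_on (cell_map f) closed_cells"
    proof (rule inj_onI)
      fix c c' assume c: "c \<in> closed_cells" "c' \<in> closed_cells" "cell_map f c = cell_map f c'"
      obtain A where A: "A \<in> F_tessellations" "c = closed_cell A" using c(1) by (rule closed_cellsE)
      obtain B where B: "B \<in> F_tessellations" "c' = closed_cell B" using c(2) by (rule closed_cellsE)
      show "c = c'" using c(3) A B fin eq by (simp add: cell_map_closed_cell closed_cell_inj)
    qed
    show "cell_map f ` closed_cells = closed_cells"
    proof
      show "cell_map f ` closed_cells \<subseteq> closed_cells"
      proof
        fix c assume "c \<in> cell_map f ` closed_cells"
        then obtain A where "A \<in> F_tessellations" "c = cell_map f (closed_cell A)" unfolding closed_cells_def by blast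
        then show "c \<in> closed_cells" using closed_cell_in[OF fin] cell_map_closed_cell by simp
      qed
      show "closed_cells \<subseteq> cell_map f ` closed_cells"
      proof
        fix c assume "c \<in> closed_cells"
        then obtain B where B: "B \<in> F_tessellations" "c = closed_cell B" by (rule closed_cellsE)
        obtain A where "A \<in> F_tessellations" "f A = B" using surj[OF B(1)] .
        then show "c \<in> cell_map f ` closed_cells" using B closed_cell_in cell_map_closed_cell by (metis imageI)
      qed
    qed
  qed
  then have "cell_map f \<in> Bij closed_cells" unfolding Bij_def by (simp add: cell_map_def)
  moreover have "preserves_dimensions (cell_map f)"
    unfolding preserves_dimensions_def using img order_auto_rank[OF f] by blast
  moreover have "preserves_inclusions (cell_map f)"
    unfolding preserves_inclusions_def
  proof (intro ballI)
    fix c c' assume c: "c \<in> closed_cells" "c' \<in> closed_cells"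
    obtain A where A: "A \<in> F_tessellations" "c = closed_cell A" using c(1) by (rule closed_cellsE)
    obtain B where B: "B \<in> F_tessellations" "c' = closed_cell B" using c(2) by (rule closed_cellsE)
    show "c \<subseteq> c' \<longleftrightarrow> cell_map f c \<subseteq> cell_map f c'"
      using A B fin le by (simp add: cell_map_closed_cell closed_cell_subset_iff)
  qed
  moreover have "preserves_boundaries (cell_map f)"
    unfolding preserves_boundaries_def
  proof (intro ballI impI)
    fix A B assume AB: "A \<in> F_tessellations" "B \<in> F_tessellations" "cell_map f (closed_cell A) = closed_cell B"
    have B: "B = f A" using img[OF AB] by simp
    have "f ` {D \<in> F_tessellations. A \<subset> D} = {D \<in> F_tessellations. B \<subset> D}"
    proof
      show "f ` {D \<in> F_tessellations. A \<subset> D} \<subseteq> {D \<in> F_tessellations. B \<subset> D}"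
        unfolding B using le AB(1) fin by (auto simp: less_le_not_le)
      show "{D \<in> F_tessellations. B \<subset> D} \<subseteq> f ` {D \<in> F_tessellations. A \<subset> D}"
      proof
        fix D assume D: "D \<in> {D \<in> F_tessellations. B \<subset> D}"
        then obtain D' where D': "D' \<in> F_tessellations" "f D' = D" using surj by blast
        then have "A \<subset> D'" using D le[OF AB(1) D'(1)] le[OF D'(1) AB(1)] unfolding B by (simp add: less_le_not_le)
        then show "D \<in> f ` {D \<in> F_tessellations. A \<subset> D}" using D' by blast
      qed
    qed
    then have "closed_cell ` {D \<in> F_tessellations. B \<subset> D} = (\<lambda>D. closed_cell (f D)) ` {D \<in> F_tessellations. A \<subset> D}"
      by (metis image_image)
    also have "\<dots> = cell_map f ` closed_cell ` {D \<in> F_tessellations. A \<subset> D}"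
      unfolding image_image by (rule image_cong) (simp_all add: cell_map_closed_cell)
    finally show "{c \<in> closed_cells. c \<subseteq> cell_boundary B} = cell_map f ` {c \<in> closed_cells. c \<subseteq> cell_boundary A}"
      unfolding boundary_cells[OF AB(1)] boundary_cells[OF AB(2)] .
  qed
  ultimately show ?thesis by (simp add: Aut_C_carrier)
qed

text \<open>Inclusion of cells is reverse inclusion of tessellations; the reversal occurs twice, so
  the induced map on tessellations preserves the order.\<close>

lemma Aut_is_cell_map:
  assumes \<phi>: "\<phi> \<in> carrier Aut_C" obtains f where "order_auto f" "\<phi> = cell_map f"
proof -
  have bij: "bij_betw \<phi> closed_cells closed_cells" and ext: "\<phi> \<in> extensional closed_cells" and inc: "preserves_inclusions \<phi>"
    using \<phi> by (auto simp: Aut_C_carrier Bij_def)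
  define f where "f A = tess_of (\<phi> (closed_cell A))" for A
  have fT: "f A \<in> F_tessellations" "closed_cell (f A) = \<phi> (closed_cell A)" if "A \<in> F_tessellations" for A
  proof -
    have "\<phi> (closed_cell A) \<in> closed_cells" using bij closed_cell_in[OF that] by (rule bij_betw_apply)
    then obtain B where "B \<in> F_tessellations" "\<phi> (closed_cell A) = closed_cell B" by (rule closed_cellsE)
    then show "f A \<in> F_tessellations" "closed_cell (f A) = \<phi> (closed_cell A)" by (simp_all add: f_def)
  qed
  have le: "f A \<subseteq> f B \<longleftrightarrow> A \<subseteq> B" if "A \<in> F_tessellations" "B \<in> F_tessellations" for A B
  proof -
    have "f A \<subseteq> f B \<longleftrightarrow> \<phi> (closed_cell B) \<subseteq> \<phi> (closed_cell A)" using closed_cell_subset_iff[of "f B" "f A"] fT that by simp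
    also have "\<dots> \<longleftrightarrow> closed_cell B \<subseteq> closed_cell A" using inc closed_cell_in that unfolding preserves_inclusions_def by blast
    finally show ?thesis using closed_cell_subset_iff that by simp
  qed
  have "bij_betw f F_tessellations F_tessellations"
    unfolding bij_betw_def
  proof
    show "inj_on f F_tessellations"
    proof (rule inj_onI)
      fix A B assume AB: "A \<in> F_tessellations" "B \<in> F_tessellations" "f A = f B"
      then have "f A \<subseteq> f B" "f B \<subseteq> f A" by simp_all
      then show "A = B" using le AB(1,2) by blast
    qed
    show "f ` F_tessellations = F_tessellations"
    proof
      show "f ` F_tessellations \<subseteq> F_tessellations" using fT by blast
      show "F_tessellations \<subseteq> f ` F_tessellations"
      proof
        fix B assume B: "B \<in> F_tessellations"
        then obtain c where "c \<in> closed_cells" "\<phi> c = closed_cell B"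
          using bij_betw_imp_surj_on[OF bij] closed_cell_in by (metis imageE)
        moreover then obtain A where "A \<in> F_tessellations" "c = closed_cell A" using closed_cellsE by blast
        ultimately have "A \<in> F_tessellations" "f A = B" using B by (simp_all add: f_def)
        then show "B \<in> f ` F_tessellations" by blast
      qed
    qed
  qed
  then have "order_auto f" using le by (simp add: order_auto_def)
  moreover have "\<phi> = cell_map f"
  proof
    fix c show "\<phi> c = cell_map f c"
    proof (cases "c \<in> closed_cells")
      case True
      then obtain A where "A \<in> F_tessellations" "c = closed_cell A" by (rule closed_cellsE)
      then show ?thesis using fT by (simp add: cell_map_closed_cell)
    next
      case False
      then show ?thesis using ext by (simp add: cell_map_def extensional_def)
    qed
  qed
  ultimately show ?thesis by (rule that)
qed

text \<open>Comparing a tessellation with and without \<open>d\<close> isolates the image of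
  \<open>d\<close>, comparing the images of two arcs at a point isolates the image of that point,
  and density extends the agreement to the circle.\<close>

lemma act_faithful:
  assumes h: "dyadic_homeo h" and g: "dyadic_homeo g"
    and eq: "\<And>A. A \<in> F_tessellations \<Longrightarrow> act h A = act g A"
  shows "h = g"
proof -
  have arc: "chord_map h d = chord_map g d" if d: "d \<in> dyadic_arcs" for d
  proof -
    obtain A where A: "A \<in> F_tessellations" "d \<in> A" using tess_arc_exists[OF d] by blast
    have arcs: "A \<subseteq> dyadic_arcs" "A - {d} \<subseteq> dyadic_arcs" using A by (auto simp: F_tessellations_eq tess_def)
    have *: "{chord_map k d} = chord_map k ` A - chord_map k ` (A - {d})" if k: "dyadic_homeo k" for k
    proof -
      have "e = d" if e: "e \<in> A" "chord_map k d = chord_map k e" for e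
      proof -
        have "e \<in> dyadic_arcs" using arcs(1) e(1) by blast
        from chord_map_inv(1)[OF k this] chord_map_inv(1)[OF k d] show ?thesis using e(2) by simp
      qed
      then have "chord_map k d \<notin> chord_map k ` (A - {d})" by blast
      then show ?thesis using A by blast
    qed
    have "{chord_map h d} = {chord_map g d}"
      unfolding *[OF h] *[OF g] using eq[OF A(1)] eq[OF F_tess_Diff[OF A(1), of d]]
      by (simp only: act_eq_chord_map[OF arcs(1)] act_eq_chord_map[OF arcs(2)])
    then show ?thesis by simp
  qed
  have pts: "h p = g p" if p: "p \<in> dyadic_points" for p
  proof -
    obtain b c where bc: "b \<in> dyadic_points" "c \<in> dyadic_points" "p \<noteq> b" "p \<noteq> c" "b \<noteq> c" by (rule two_other_points)
    have "{h p, h b} = {g p, g b}" "{h p, h c} = {g p, g c}"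
      using arc[OF dyadic_arcI[OF p bc(1,3)]] arc[OF dyadic_arcI[OF p bc(2,4)]]
      by (simp_all only: chord_map_seg p bc(1,2) closed_segment_eq)
    moreover have "h b \<noteq> h c" "g b \<noteq> g c" using homeo_inj[OF h] homeo_inj[OF g] bc dyadic_points_circle by blast+
    ultimately show ?thesis by (auto simp: doubleton_eq_iff)
  qed
  show ?thesis
  proof
    fix w show "h w = g w"
    proof (cases "w \<in> circle")
      case True
      then show ?thesis
        using continuous_agree_circle[OF dyadic_homeoD(3)[OF h] dyadic_homeoD(3)[OF g] pts] by blast
    next
      case False
      then show ?thesis using dyadic_homeoD(4)[OF h] dyadic_homeoD(4)[OF g] by (simp add: extensional_def)
    qed
  qed
qed

lemma act_compose:
  assumes "dyadic_homeo h" "dyadic_homeo g" "A \<in> F_tessellations"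
  shows "act (compose circle h g) A = act h (act g A)"
proof -
  have arcs: "A \<subseteq> dyadic_arcs" using assms(3) by (simp add: F_tessellations_eq tess_def)
  moreover have "chord_map g ` A \<subseteq> dyadic_arcs" using chord_map_arc[OF assms(2)] arcs by blast
  ultimately show ?thesis
    unfolding act_eq_chord_map[OF arcs]
    using chord_map_compose[OF assms(2), of _ h] by (simp add: act_eq_chord_map image_image subset_iff)
qed

lemma act_one:
  assumes "A \<in> F_tessellations" shows "act (\<lambda>p\<in>circle. p) A = A"
proof -
  have arcs: "A \<subseteq> dyadic_arcs" using assms by (simp add: F_tessellations_eq tess_def)
  have "chord_map (\<lambda>p\<in>circle. p) d = d" if "d \<in> A" for d
    using chord_map_id[of d "\<lambda>p\<in>circle. p"] that arcs dyadic_points_circle by auto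
  then show ?thesis unfolding act_eq_chord_map[OF arcs] by simp
qed

lemma dyadic_homeo_one: "dyadic_homeo (\<lambda>p\<in>circle. p)"
proof -
  have "(\<lambda>p\<in>circle. p) ` dyadic_points = (\<lambda>p. p) ` dyadic_points"
    by (rule image_cong) (auto dest: dyadic_points_circle)
  moreover have "continuous_on circle (\<lambda>p\<in>circle. p)"
    by (rule continuous_on_eq[OF continuous_on_id]) simp
  ultimately show ?thesis by (simp add: dyadic_homeo_def id_Bij)
qed

lemma order_auto_compose:
  assumes f: "order_auto f" and g: "order_auto g" shows "order_auto (\<lambda>A. f (g A))"
proof -
  have "bij_betw (f \<circ> g) F_tessellations F_tessellations"
    using f g by (intro bij_betw_trans[where B=F_tessellations]) (simp_all add: order_auto_def)
  then show ?thesis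
    using order_auto_le[OF f] order_auto_le[OF g] order_auto_in[OF g] by (simp add: order_auto_def o_def)
qed

text \<open>Composites and inverses act by order automorphisms, which come from elements of \<^term>\<open>T_no\<close>; by
  faithfulness these are the composites and inverses themselves.\<close>

lemma T_no_compose:
  assumes h: "h \<in> carrier T_no" and g: "g \<in> carrier T_no" shows "compose circle h g \<in> carrier T_no"
proof -
  have dh: "dyadic_homeo h" and dg: "dyadic_homeo g" using assms T_no_dyadic_homeo by blast+
  obtain t where t: "t \<in> carrier T_no" "\<And>A. A \<in> F_tessellations \<Longrightarrow> act h (act g A) = act t A"
    using order_auto_is_act[OF order_auto_compose[OF act_order_auto[OF h] act_order_auto[OF g]]] by blast
  have "compose circle h g = t"
    using act_faithful[OF dyadic_homeo_compose[OF dh dg] T_no_dyadic_homeo[OF t(1)]] act_compose[OF dh dg] t(2) by simp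
  then show ?thesis using t by simp
qed

lemma T_no_one: "(\<lambda>p\<in>circle. p) \<in> carrier T_no"
proof -
  have "order_auto (\<lambda>A. A)" by (simp add: order_auto_def bij_betw_def)
  then obtain t where t: "t \<in> carrier T_no" "\<And>A. A \<in> F_tessellations \<Longrightarrow> A = act t A"
    using order_auto_is_act by metis
  have "(\<lambda>p\<in>circle. p) = t"
    using act_faithful[OF dyadic_homeo_one T_no_dyadic_homeo[OF t(1)]] act_one t(2) by simp
  then show ?thesis using t by simp
qed

lemma T_no_left_inverse:
  assumes h: "h \<in> carrier T_no" obtains t where "t \<in> carrier T_no" "compose circle t h = (\<lambda>p\<in>circle. p)"
proof -
  have dh: "dyadic_homeo h" using h by (rule T_no_dyadic_homeo)
  have bij: "bij_betw (act h) F_tessellations F_tessellations" using act_order_auto[OF h] by (simp add: order_auto_def)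
  obtain t where t: "t \<in> carrier T_no" "\<And>A. A \<in> F_tessellations \<Longrightarrow> inv_into F_tessellations (act h) A = act t A"
    using order_auto_is_act[OF order_auto_inverse[OF act_order_auto[OF h]]] by blast
  have dt: "dyadic_homeo t" using t T_no_dyadic_homeo by blast
  have "act (compose circle t h) A = act (\<lambda>p\<in>circle. p) A" if A: "A \<in> F_tessellations" for A
    using act_compose[OF dt dh A] t(2)[of "act h A"] bij_betw_inv_into_left[OF bij A] bij_betw_apply[OF bij A] act_one[OF A] by simp
  then have "compose circle t h = (\<lambda>p\<in>circle. p)"
    using act_faithful[OF dyadic_homeo_compose[OF dt dh] dyadic_homeo_one] by blast
  then show ?thesis using that t by blast
qed

lemma T_no_Bij: "h \<in> carrier T_no \<Longrightarrow> h \<in> Bij circle"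
  by (simp add: T_no_carrier)

lemma T_no_subgroup: "subgroup (carrier T_no) (BijGroup circle)"
proof (rule subgroup.intro)
  show "carrier T_no \<subseteq> carrier (BijGroup circle)" using T_no_Bij by (auto simp: BijGroup_def)
  show "\<one>\<^bsub>BijGroup circle\<^esub> \<in> carrier T_no" using T_no_one by (simp add: BijGroup_def)
  fix h assume h: "h \<in> carrier T_no"
  then obtain t where t: "t \<in> carrier T_no" "compose circle t h = (\<lambda>p\<in>circle. p)" by (rule T_no_left_inverse)
  have "inv\<^bsub>BijGroup circle\<^esub> h = t"
    by (rule group.inv_equality[OF group_BijGroup]) (use t h T_no_Bij in \<open>simp_all add: BijGroup_def\<close>)
  then show "inv\<^bsub>BijGroup circle\<^esub> h \<in> carrier T_no" using t by simp
  fix g assume "g \<in> carrier T_no"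
  then show "h \<otimes>\<^bsub>BijGroup circle\<^esub> g \<in> carrier T_no" using h T_no_compose T_no_Bij by (simp add: BijGroup_def)
qed

lemma group_T_no: "group T_no"
proof -
  have "T_no = (BijGroup circle)\<lparr>carrier := carrier T_no\<rparr>" by (simp add: T_no_def)
  then show ?thesis using subgroup.subgroup_is_group[OF T_no_subgroup group_BijGroup] by metis
qed

lemma T_no_mult: "h \<in> carrier T_no \<Longrightarrow> g \<in> carrier T_no \<Longrightarrow> h \<otimes>\<^bsub>T_no\<^esub> g = compose circle h g"
proof -
  assume "h \<in> carrier T_no" "g \<in> carrier T_no"
  then have "h \<in> Bij circle" "g \<in> Bij circle" using T_no_Bij by blast+
  then have "h \<otimes>\<^bsub>BijGroup circle\<^esub> g = compose circle h g" by (simp add: BijGroup_def)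
  then show ?thesis by (simp add: T_no_def)
qed

theorem proposition1:
  shows "(\<exists>\<rho>. faithful_action T_no closed_cells \<rho> \<and>
              \<rho> \<in> hom T_no Aut_C \<and>
              (\<forall>t\<in>carrier T_no. \<forall>A\<in>F_tessellations.
                 act t A \<in> F_tessellations \<and>
                 \<rho> t (closed_cell A) = closed_cell (act t A))) \<and>
         group Aut_C \<and> Aut_C \<cong> T_no"
proof -
  define \<rho> where "\<rho> t = cell_map (act t)" for t
  have actT: "act t A \<in> F_tessellations" if "t \<in> carrier T_no" "A \<in> F_tessellations" for t A
    using order_auto_in[OF act_order_auto] that by blast
  have \<rho>A: "\<rho> t (closed_cell A) = closed_cell (act t A)" if "A \<in> F_tessellations" for t A
    unfolding \<rho>_def using that by (rule cell_map_closed_cell)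
  have \<rho>Aut: "\<rho> t \<in> carrier Aut_C" if "t \<in> carrier T_no" for t
    unfolding \<rho>_def using cell_map_Aut[OF act_order_auto[OF that]] .
  have AutBij: "\<phi> \<in> Bij closed_cells" if "\<phi> \<in> carrier Aut_C" for \<phi> using that by (simp add: Aut_C_carrier)
  have \<rho>mult: "\<rho> (s \<otimes>\<^bsub>T_no\<^esub> t) = compose closed_cells (\<rho> s) (\<rho> t)" if st: "s \<in> carrier T_no" "t \<in> carrier T_no" for s t
  proof
    fix c
    show "\<rho> (s \<otimes>\<^bsub>T_no\<^esub> t) c = compose closed_cells (\<rho> s) (\<rho> t) c"
    proof (cases "c \<in> closed_cells")
      case True
      then obtain A where A: "A \<in> F_tessellations" "c = closed_cell A" by (rule closed_cellsE)
      then show ?thesis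
        using True \<rho>A actT st act_compose[OF T_no_dyadic_homeo[OF st(1)] T_no_dyadic_homeo[OF st(2)] A(1)]
        by (simp add: T_no_mult compose_eq)
    qed (simp add: \<rho>_def cell_map_def compose_def)
  qed
  have homBij: "\<rho> \<in> hom T_no (BijGroup closed_cells)"
    using \<rho>mult \<rho>Aut AutBij by (auto simp: hom_def BijGroup_def)
  have homAut: "\<rho> \<in> hom T_no Aut_C"
  proof (rule homI)
    fix s t assume st: "s \<in> carrier T_no" "t \<in> carrier T_no"
    have "\<rho> s \<otimes>\<^bsub>Aut_C\<^esub> \<rho> t = \<rho> s \<otimes>\<^bsub>BijGroup closed_cells\<^esub> \<rho> t" by (simp add: Aut_C_def)
    then show "\<rho> (s \<otimes>\<^bsub>T_no\<^esub> t) = \<rho> s \<otimes>\<^bsub>Aut_C\<^esub> \<rho> t" using hom_mult[OF homBij st] by simp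
  qed (rule \<rho>Aut)
  have inj: "inj_on \<rho> (carrier T_no)"
  proof (rule inj_onI)
    fix s t assume st: "s \<in> carrier T_no" "t \<in> carrier T_no" "\<rho> s = \<rho> t"
    have "act s A = act t A" if A: "A \<in> F_tessellations" for A
      using \<rho>A[OF A, of s] \<rho>A[OF A, of t] st actT[OF _ A] by (simp add: closed_cell_inj)
    then show "s = t" using act_faithful T_no_dyadic_homeo st by blast
  qed
  have surj: "\<rho> ` carrier T_no = carrier Aut_C"
  proof
    show "\<rho> ` carrier T_no \<subseteq> carrier Aut_C" using \<rho>Aut by blast
    show "carrier Aut_C \<subseteq> \<rho> ` carrier T_no"
    proof
      fix \<phi> assume "\<phi> \<in> carrier Aut_C"
      then obtain f where f: "order_auto f" "\<phi> = cell_map f" by (rule Aut_is_cell_map)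
      obtain t where t: "t \<in> carrier T_no" "\<And>A. A \<in> F_tessellations \<Longrightarrow> f A = act t A" using order_auto_is_act[OF f(1)] by blast
      then have "\<phi> = \<rho> t" unfolding f(2) \<rho>_def by (intro cell_map_cong)
      then show "\<phi> \<in> \<rho> ` carrier T_no" using t by blast
    qed
  qed
  have gh: "group_hom T_no (BijGroup closed_cells) \<rho>"
    using group_T_no group_BijGroup homBij by (simp add: group_hom_def group_hom_axioms_def)
  then have "faithful_action T_no closed_cells \<rho>"
    using inj by (simp add: faithful_action_def faithful_action_axioms_def group_action_def)
  moreover have grp: "group Aut_C"
  proof -
    \<comment> \<open>The carrier is the image of a homomorphism into the group of all bijections of
      the cells.\<close>
    have "subgroup (carrier Aut_C) (BijGroup closed_cells)" using group_hom.img_is_subgroup[OF gh] by (simp only: surj)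
    moreover have "Aut_C = (BijGroup closed_cells)\<lparr>carrier := carrier Aut_C\<rparr>" by (simp add: Aut_C_def)
    ultimately show ?thesis using subgroup.subgroup_is_group group_BijGroup by metis
  qed
  moreover have "\<rho> \<in> iso T_no Aut_C" using homAut inj surj by (simp add: iso_def bij_betw_def)
  then have "Aut_C \<cong> T_no" using group.iso_sym[OF group_T_no] by (auto simp: is_iso_def)
  ultimately show ?thesis using homAut actT \<rho>A by blast
qed

end
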